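(* The eigenvector of $\mathbf L_0$ corresponding to the eigenvalue $\lambda_n$ takes the following form in the spectral representation: $$f_n(x)=\chi_{\{\lambda_n\}}(x)\begin{pmatrix}1\\-\lim_{\varepsilon\searrow0}u_2^{[1]}(b,\lambda_n+i\varepsilon)\end{pmatrix}\in L^2(\boldsymbol\mu),$$ where $\chi_{\{\lambda_n\}}$ denotes the characteristic function of the point $x=\lambda_n$. Moreover, $L^2(\boldsymbol\mu)=\overline{\operatorname{span}}\{f_n:n\in\mathbb N_0\}$.
   Context: Setting. Let $-\infty\le a<b\le\infty$, let $p,w>0$ a.e. and $q$ real-valued a.e. on $(a,b)$ with $1/p,q,w\in L^1_{\rm loc}((a,b),dx)$, and put $\ell[f]=-\frac1w\big((pf')'+qf\big)$, acting in $L^2[(a,b),w]$ with $\langle f,g\rangle=\int_a^b f\overline g\,w\,dx$. Let $\mathcal D_{\max}=\{f: f,pf'\in AC_{\rm loc}(a,b),\ f,\ell[f]\in L^2[(a,b),w]\}$ and $[f,g](x)=p(x)\big(f(x)\overline{g'(x)}-f'(x)\overline{g(x)}\big)$; for $f,g\in\mathcal D_{\max}$ the limits at the endpoints exist. Let $\mathcal D_{\min}=\{f\in\mathcal D_{\max}:[f,g](b)-[f,g](a)=0\ \forall g\in\mathcal D_{\max}\}$, and let $\mathbf L_{\max},\mathbf L_{\min}$ be $\ell$ with domains $\mathcal D_{\max},\mathcal D_{\min}$. Standing assumptions: both endpoints are limit-circle, and $\mathbf L_{\min}$ is semi-bounded from below with lower bound $K\in\mathbb R$ (so the endpoints are non-oscillating).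 Quasi-derivatives. Fix $\lambda_0\in\mathbb R$. A real solution $u$ of $(\ell-\lambda_0)y=0$ is principal (non-principal) at an endpoint if $1/(pu^2)$ is not integrable (is integrable) there. Let $u_a,v_a$ (resp. $u_b,v_b$) be real principal and non-principal solutions of $(\ell-\lambda_0)y=0$ at $a$ (resp. $b$) with $[u_a,v_a](a)=1$, $[u_b,v_b](b)=1$. For $f\in\mathcal D_{\max}$: $f^{[0]}(a)=[f,v_a](a)$, $f^{[1]}(a)=-[f,u_a](a)$, $f^{[0]}(b)=[f,v_b](b)$, $f^{[1]}(b)=-[f,u_b](b)$. For $\lambda\in\mathbb C$ let $u_1(\cdot,\lambda),u_2(\cdot,\lambda)$ be the solutions of $(\ell-\lambda)y=0$ with $u_1^{[0]}(a,\lambda)=1,\ u_1^{[1]}(a,\lambda)=0,\ u_2^{[0]}(a,\lambda)=0,\ u_2^{[1]}(a,\lambda)=1$; they satisfy $u_1^{[0]}(b,\lambda)u_2^{[1]}(b,\lambda)-u_1^{[1]}(b,\lambda)u_2^{[0]}(b,\lambda)=1$. Operator and spectral representation. $\mathbf L_0$ is the self-adjoint restriction of $\mathbf L_{\max}$ to $\{f\in\mathcal D_{\max}: f^{[0]}(a)=f^{[0]}(b)=0\}$; its spectrum is discrete, consisting of eigenvalues $\lambda_n$, $n\in\mathbb N_0$. Its Weyl function is $M_0(\lambda)=\frac{1}{u_2^{[0]}(b,\lambda)}\begin{pmatrix}-u_1^{[0]}(b,\lambda)&1\\1&-u_2^{[1]}(b,\lambda)\end{pmatrix}$, $\lambda\in\rho(\mathbf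 L_0)$, a matrix-valued Herglotz function, and $\boldsymbol\mu$ is the matrix-valued measure in its representation $M_0(z)=C+Dz+\int_{\mathbb R}\big((s-z)^{-1}-s(1+s^2)^{-1}\big)d\boldsymbol\mu(s)$, $z\in\mathbb C_+$. $L^2(\boldsymbol\mu)$ is the space of $\mathbb C^2$-valued functions with $\|f\|^2=\int\langle d\boldsymbol\mu(x)f(x),f(x)\rangle_{\mathbb C^2}<\infty$ (modulo null functions). The spectral representation of $\mathbf L_0$ is the operator on $L^2(\boldsymbol\mu)$ of multiplication by the independent variable, $f(x)\mapsto xf(x)$. *)

theory Defs
  imports "HOL-Analysis.Analysis"
begin

record sl_expr =
  sl_a :: ereal
  sl_b :: ereal
  sl_p :: "real \<Rightarrow> real"
  sl_q :: "real \<Rightarrow> real"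
  sl_w :: "real \<Rightarrow> real"

definition sl_int :: "sl_expr \<Rightarrow> real set" where
  "sl_int S = einterval (sl_a S) (sl_b S)"

definition sl_coefficients :: "sl_expr \<Rightarrow> bool" where
  "sl_coefficients S \<longleftrightarrow>
     sl_a S < sl_b S \<and>
     (AE x in lebesgue_on (sl_int S). 0 < sl_p S x \<and> 0 < sl_w S x) \<and>
     (\<forall>c d. {c..d} \<subseteq> sl_int S \<longrightarrow>
        (\<lambda>x. 1 / sl_p S x) absolutely_integrable_on {c..d} \<and>
        sl_q S absolutely_integrable_on {c..d} \<and>
        sl_w S absolutely_integrable_on {c..d})"

definition abs_cont_on :: "real \<Rightarrow> real \<Rightarrow> (real \<Rightarrow> complex) \<Rightarrow> bool" where
  "abs_cont_on c d f \<longleftrightarrow>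
     (\<forall>e>0. \<exists>\<delta>>0. \<forall>(n::nat) s t.
        (\<forall>i<n. c \<le> s i \<and> s i \<le> t i \<and> t i \<le> d) \<and>
        disjoint_family_on (\<lambda>i. {s i<..<t i}) {..<n} \<and>
        (\<Sum>i<n. t i - s i) < \<delta>
        \<longrightarrow> (\<Sum>i<n. norm (f (t i) - f (s i))) < e)"

definition AC_loc :: "sl_expr \<Rightarrow> (real \<Rightarrow> complex) \<Rightarrow> bool" where
  "AC_loc S f \<longleftrightarrow> (\<forall>c d. {c..d} \<subseteq> sl_int S \<longrightarrow> abs_cont_on c d f)"

text \<open>The function \<open>pf'\<close> is only defined almost everywhere; \<open>h\<close> is its locally absolutely
  continuous representative, which is unique on the interval. Existence of the derivative almost
  everywhere is automatic for absolutely continuous functions.\<close>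

definition has_qderiv :: "sl_expr \<Rightarrow> (real \<Rightarrow> complex) \<Rightarrow> (real \<Rightarrow> complex) \<Rightarrow> bool" where
  "has_qderiv S f h \<longleftrightarrow>
     AC_loc S f \<and> AC_loc S h \<and>
     (AE x in lebesgue_on (sl_int S).
        \<exists>D. (f has_vector_derivative D) (at x) \<and> h x = complex_of_real (sl_p S x) * D)"

definition qderiv :: "sl_expr \<Rightarrow> (real \<Rightarrow> complex) \<Rightarrow> real \<Rightarrow> complex" where
  "qderiv S f = (SOME h. has_qderiv S f h)"

text \<open>\<open>sl_maps S f g\<close> means that \<open>f\<close> and \<open>pf'\<close> are locally absolutely continuous and
  \<open>\<ell>[f] = g\<close> almost everywhere.\<close>

definition sl_maps :: "sl_expr \<Rightarrow> (real \<Rightarrow> complex) \<Rightarrow> (real \<Rightarrow> complex) \<Rightarrow> bool" where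
  "sl_maps S f g \<longleftrightarrow>
     (\<exists>h. has_qderiv S f h) \<and>
     (AE x in lebesgue_on (sl_int S).
        \<exists>D. (qderiv S f has_vector_derivative D) (at x) \<and>
            g x = - (1 / complex_of_real (sl_w S x)) * (D + complex_of_real (sl_q S x) * f x))"

definition sl_solution :: "sl_expr \<Rightarrow> complex \<Rightarrow> (real \<Rightarrow> complex) \<Rightarrow> bool" where
  "sl_solution S z y \<longleftrightarrow> sl_maps S y (\<lambda>x. z * y x)"

definition sl_measure :: "sl_expr \<Rightarrow> real measure" where
  "sl_measure S = density (lebesgue_on (sl_int S)) (\<lambda>x. ennreal (sl_w S x))"

definition sl_L2 :: "sl_expr \<Rightarrow> (real \<Rightarrow> complex) set" where
  "sl_L2 S = {f. f \<in> borel_measurable (sl_measure S) \<and>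
                 integrable (sl_measure S) (\<lambda>x. (norm (f x))\<^sup>2)}"

definition sl_inner :: "sl_expr \<Rightarrow> (real \<Rightarrow> complex) \<Rightarrow> (real \<Rightarrow> complex) \<Rightarrow> complex" where
  "sl_inner S f g = (LINT x|sl_measure S. f x * cnj (g x))"

text \<open>Operators are represented by their graphs. Elements of \<open>L\<^sup>2\<close> are functions, not classes,
  so domain elements are the (on the interval unique) continuous representatives.\<close>

definition L_max :: "sl_expr \<Rightarrow> ((real \<Rightarrow> complex) \<times> (real \<Rightarrow> complex)) set" where
  "L_max S = {(f, g). f \<in> sl_L2 S \<and> g \<in> sl_L2 S \<and> sl_maps S f g}"

definition D_max :: "sl_expr \<Rightarrow> (real \<Rightarrow> complex) set" where
  "D_max S = Domain (L_max S)"

definition bracket :: "sl_expr \<Rightarrow> (real \<Rightarrow> complex) \<Rightarrow> (real \<Rightarrow> complex) \<Rightarrow> real \<Rightarrow> complex" where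
  "bracket S f g x = f x * cnj (qderiv S g x) - qderiv S f x * cnj (g x)"

definition bracket_a :: "sl_expr \<Rightarrow> (real \<Rightarrow> complex) \<Rightarrow> (real \<Rightarrow> complex) \<Rightarrow> complex" where
  "bracket_a S f g = Lim (at_right (sl_a S)) (bracket S f g \<circ> real_of_ereal)"

definition bracket_b :: "sl_expr \<Rightarrow> (real \<Rightarrow> complex) \<Rightarrow> (real \<Rightarrow> complex) \<Rightarrow> complex" where
  "bracket_b S f g = Lim (at_left (sl_b S)) (bracket S f g \<circ> real_of_ereal)"

definition D_min :: "sl_expr \<Rightarrow> (real \<Rightarrow> complex) set" where
  "D_min S = {f \<in> D_max S. \<forall>g \<in> D_max S. bracket_b S f g - bracket_a S f g = 0}"

definition L_min :: "sl_expr \<Rightarrow> ((real \<Rightarrow> complex) \<times> (real \<Rightarrow> complex)) set" where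
  "L_min S = {(f, g) \<in> L_max S. f \<in> D_min S}"

text \<open>\<open>\<langle>L f, f\<rangle>\<close> and \<open>\<langle>f, f\<rangle>\<close> are real, since the minimal operator is symmetric.\<close>

definition L_min_bounded_below :: "sl_expr \<Rightarrow> real \<Rightarrow> bool" where
  "L_min_bounded_below S K \<longleftrightarrow>
     (\<forall>(f, g) \<in> L_min S. K * Re (sl_inner S f f) \<le> Re (sl_inner S g f))"

definition limit_circle_a :: "sl_expr \<Rightarrow> bool" where
  "limit_circle_a S \<longleftrightarrow>
     (\<forall>z y. sl_solution S z y \<longrightarrow>
        (\<exists>c \<in> sl_int S. set_integrable (sl_measure S) {..c} (\<lambda>x. (norm (y x))\<^sup>2)))"

definition limit_circle_b :: "sl_expr \<Rightarrow> bool" where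
  "limit_circle_b S \<longleftrightarrow>
     (\<forall>z y. sl_solution S z y \<longrightarrow>
        (\<exists>c \<in> sl_int S. set_integrable (sl_measure S) {c..} (\<lambda>x. (norm (y x))\<^sup>2)))"

definition cplx_fun :: "(real \<Rightarrow> real) \<Rightarrow> real \<Rightarrow> complex" where
  "cplx_fun u = (\<lambda>x. complex_of_real (u x))"

definition recip_pu2_integrable_on :: "sl_expr \<Rightarrow> real set \<Rightarrow> (real \<Rightarrow> real) \<Rightarrow> bool" where
  "recip_pu2_integrable_on S A u \<longleftrightarrow>
     (\<integral>\<^sup>+x\<in>A. 1 / ennreal (sl_p S x * (u x)\<^sup>2) \<partial>(lebesgue_on (sl_int S))) < \<infinity>"

definition recip_pu2_integrable_at_a :: "sl_expr \<Rightarrow> (real \<Rightarrow> real) \<Rightarrow> bool" where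
  "recip_pu2_integrable_at_a S u \<longleftrightarrow> (\<exists>c \<in> sl_int S. recip_pu2_integrable_on S {..c} u)"

definition recip_pu2_integrable_at_b :: "sl_expr \<Rightarrow> (real \<Rightarrow> real) \<Rightarrow> bool" where
  "recip_pu2_integrable_at_b S u \<longleftrightarrow> (\<exists>c \<in> sl_int S. recip_pu2_integrable_on S {c..} u)"

definition boundary_pair_a :: "sl_expr \<Rightarrow> real \<Rightarrow> (real \<Rightarrow> real) \<Rightarrow> (real \<Rightarrow> real) \<Rightarrow> bool" where
  "boundary_pair_a S l0 ua va \<longleftrightarrow>
     sl_solution S (complex_of_real l0) (cplx_fun ua) \<and> \<not> recip_pu2_integrable_at_a S ua \<and>
     sl_solution S (complex_of_real l0) (cplx_fun va) \<and> recip_pu2_integrable_at_a S va \<and>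
     bracket_a S (cplx_fun ua) (cplx_fun va) = 1"

definition boundary_pair_b :: "sl_expr \<Rightarrow> real \<Rightarrow> (real \<Rightarrow> real) \<Rightarrow> (real \<Rightarrow> real) \<Rightarrow> bool" where
  "boundary_pair_b S l0 ub vb \<longleftrightarrow>
     sl_solution S (complex_of_real l0) (cplx_fun ub) \<and> \<not> recip_pu2_integrable_at_b S ub \<and>
     sl_solution S (complex_of_real l0) (cplx_fun vb) \<and> recip_pu2_integrable_at_b S vb \<and>
     bracket_b S (cplx_fun ub) (cplx_fun vb) = 1"

definition qd0_a :: "sl_expr \<Rightarrow> (real \<Rightarrow> real) \<Rightarrow> (real \<Rightarrow> complex) \<Rightarrow> complex" where
  "qd0_a S va f = bracket_a S f (cplx_fun va)"

definition qd1_a :: "sl_expr \<Rightarrow> (real \<Rightarrow> real) \<Rightarrow> (real \<Rightarrow> complex) \<Rightarrow> complex" where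
  "qd1_a S ua f = - bracket_a S f (cplx_fun ua)"

definition qd0_b :: "sl_expr \<Rightarrow> (real \<Rightarrow> real) \<Rightarrow> (real \<Rightarrow> complex) \<Rightarrow> complex" where
  "qd0_b S vb f = bracket_b S f (cplx_fun vb)"

definition qd1_b :: "sl_expr \<Rightarrow> (real \<Rightarrow> real) \<Rightarrow> (real \<Rightarrow> complex) \<Rightarrow> complex" where
  "qd1_b S ub f = - bracket_b S f (cplx_fun ub)"

definition fundamental_system ::
  "sl_expr \<Rightarrow> (real \<Rightarrow> real) \<Rightarrow> (real \<Rightarrow> real) \<Rightarrow>
   (complex \<Rightarrow> real \<Rightarrow> complex) \<Rightarrow> (complex \<Rightarrow> real \<Rightarrow> complex) \<Rightarrow> bool" where
  "fundamental_system S ua va u1 u2 \<longleftrightarrow>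
     (\<forall>z. sl_solution S z (u1 z) \<and> qd0_a S va (u1 z) = 1 \<and> qd1_a S ua (u1 z) = 0 \<and>
          sl_solution S z (u2 z) \<and> qd0_a S va (u2 z) = 0 \<and> qd1_a S ua (u2 z) = 1)"

definition L_0 :: "sl_expr \<Rightarrow> (real \<Rightarrow> real) \<Rightarrow> (real \<Rightarrow> real) \<Rightarrow>
    ((real \<Rightarrow> complex) \<times> (real \<Rightarrow> complex)) set" where
  "L_0 S va vb = {(f, g) \<in> L_max S. qd0_a S va f = 0 \<and> qd0_b S vb f = 0}"

definition L_0_eigenvector ::
  "sl_expr \<Rightarrow> (real \<Rightarrow> real) \<Rightarrow> (real \<Rightarrow> real) \<Rightarrow> complex \<Rightarrow> (real \<Rightarrow> complex) \<Rightarrow> bool" where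
  "L_0_eigenvector S va vb z f \<longleftrightarrow>
     (f, \<lambda>x. z * f x) \<in> L_0 S va vb \<and> \<not> (AE x in sl_measure S. f x = 0)"

definition L_0_eigenvalues :: "sl_expr \<Rightarrow> (real \<Rightarrow> real) \<Rightarrow> (real \<Rightarrow> real) \<Rightarrow> complex set" where
  "L_0_eigenvalues S va vb = {z. \<exists>f. L_0_eigenvector S va vb z f}"

text \<open>All eigenvalues are simple, since \<open>u\<^sub>2\<close> spans the solutions satisfying the condition
  at \<open>a\<close>, so the enumeration is without repetition. Its order is immaterial.\<close>

definition eigenvalue_enumeration ::
  "sl_expr \<Rightarrow> (real \<Rightarrow> real) \<Rightarrow> (real \<Rightarrow> real) \<Rightarrow> (nat \<Rightarrow> real) \<Rightarrow> bool" where
  "eigenvalue_enumeration S va vb lam \<longleftrightarrow>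
     bij_betw (\<lambda>n. complex_of_real (lam n)) UNIV (L_0_eigenvalues S va vb)"

text \<open>Only meaningful on the resolvent set of \<open>L\<^sub>0\<close>, which contains the upper half-plane;
  elsewhere the denominator vanishes.\<close>

definition weyl_M0 ::
  "sl_expr \<Rightarrow> (real \<Rightarrow> real) \<Rightarrow> (real \<Rightarrow> real) \<Rightarrow>
   (complex \<Rightarrow> real \<Rightarrow> complex) \<Rightarrow> (complex \<Rightarrow> real \<Rightarrow> complex) \<Rightarrow> complex \<Rightarrow> complex^2^2" where
  "weyl_M0 S ub vb u1 u2 z =
     (let d = qd0_b S vb (u2 z) in
        vector [vector [- qd0_b S vb (u1 z) / d, 1 / d],
                vector [1 / d, - qd1_b S ub (u2 z) / d]])"

definition cdot :: "complex^2 \<Rightarrow> complex^2 \<Rightarrow> complex" where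
  "cdot x y = (\<Sum>i\<in>UNIV. x $ i * cnj (y $ i))"

definition cmat_hermitian :: "complex^2^2 \<Rightarrow> bool" where
  "cmat_hermitian A \<longleftrightarrow> (\<forall>i j. A $ i $ j = cnj (A $ j $ i))"

definition cmat_psd :: "complex^2^2 \<Rightarrow> bool" where
  "cmat_psd A \<longleftrightarrow> cmat_hermitian A \<and> (\<forall>v. 0 \<le> Re (cdot (A *v v) v))"

text \<open>A matrix-valued measure on the real line may be infinite on unbounded sets, so it is
  a set function whose values matter on bounded Borel sets only.\<close>

definition matrix_measure :: "(real set \<Rightarrow> complex^2^2) \<Rightarrow> bool" where
  "matrix_measure \<mu> \<longleftrightarrow>
     (\<forall>B. B \<in> sets borel \<and> bounded B \<longrightarrow> cmat_psd (\<mu> B)) \<and>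
     (\<forall>A::nat \<Rightarrow> real set.
        range A \<subseteq> sets borel \<and> disjoint_family A \<and> bounded (\<Union>i. A i) \<longrightarrow>
        (\<lambda>i. \<mu> (A i)) sums \<mu> (\<Union>i. A i))"

text \<open>The Borel measure with value \<open>tr \<mu>(B)\<close> on bounded \<open>B\<close>; the entries of \<open>\<mu>\<close> are
  absolutely continuous with respect to it.\<close>

definition trace_measure :: "(real set \<Rightarrow> complex^2^2) \<Rightarrow> real measure" where
  "trace_measure \<mu> = measure_of UNIV (sets borel)
     (\<lambda>B. SUP n::nat. ennreal (Re (trace (\<mu> (B \<inter> {- real n..real n})))))"

definition is_matrix_density :: "(real set \<Rightarrow> complex^2^2) \<Rightarrow> (real \<Rightarrow> complex^2^2) \<Rightarrow> bool" where
  "is_matrix_density \<mu> W \<longleftrightarrow>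
     (\<forall>i j. (\<lambda>s. W s $ i $ j) \<in> borel_measurable borel) \<and>
     (\<forall>B i j. B \<in> sets borel \<and> bounded B \<longrightarrow>
        set_integrable (trace_measure \<mu>) B (\<lambda>s. W s $ i $ j) \<and>
        \<mu> B $ i $ j = (LINT s:B|trace_measure \<mu>. W s $ i $ j))"

text \<open>The Radon--Nikodym derivative \<open>d\<mu>/d tr \<mu>\<close>, unique up to \<open>tr \<mu>\<close>-null sets. Integrals
  against \<open>d\<mu>\<close> are understood as integrals of \<open>d\<mu>/d tr \<mu>\<close> against \<open>d tr \<mu>\<close>.\<close>

definition matrix_density :: "(real set \<Rightarrow> complex^2^2) \<Rightarrow> real \<Rightarrow> complex^2^2" where
  "matrix_density \<mu> = (SOME W. is_matrix_density \<mu> W)"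

definition herglotz_representation ::
  "(complex \<Rightarrow> complex^2^2) \<Rightarrow> complex^2^2 \<Rightarrow> complex^2^2 \<Rightarrow> (real set \<Rightarrow> complex^2^2) \<Rightarrow> bool" where
  "herglotz_representation M C D \<mu> \<longleftrightarrow>
     cmat_hermitian C \<and> cmat_psd D \<and> matrix_measure \<mu> \<and>
     integrable (trace_measure \<mu>) (\<lambda>s. 1 / (1 + s\<^sup>2)) \<and>
     (\<forall>z. 0 < Im z \<longrightarrow>
        (\<forall>i j. M z $ i $ j = C $ i $ j + D $ i $ j * z +
           (LINT s|trace_measure \<mu>.
              (1 / (complex_of_real s - z) - complex_of_real (s / (1 + s\<^sup>2)))
                * matrix_density \<mu> s $ i $ j)))"

definition mm_form :: "(real set \<Rightarrow> complex^2^2) \<Rightarrow> (real \<Rightarrow> complex^2) \<Rightarrow> real \<Rightarrow> real" where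
  "mm_form \<mu> f s = Re (cdot (matrix_density \<mu> s *v f s) (f s))"

definition mm_L2 :: "(real set \<Rightarrow> complex^2^2) \<Rightarrow> (real \<Rightarrow> complex^2) set" where
  "mm_L2 \<mu> = {f. (\<forall>i. (\<lambda>s. f s $ i) \<in> borel_measurable borel) \<and>
                 integrable (trace_measure \<mu>) (mm_form \<mu> f)}"

definition mm_norm :: "(real set \<Rightarrow> complex^2^2) \<Rightarrow> (real \<Rightarrow> complex^2) \<Rightarrow> real" where
  "mm_norm \<mu> f = sqrt (LINT s|trace_measure \<mu>. mm_form \<mu> f s)"

definition mm_eq :: "(real set \<Rightarrow> complex^2^2) \<Rightarrow> (real \<Rightarrow> complex^2) \<Rightarrow> (real \<Rightarrow> complex^2) \<Rightarrow> bool" where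
  "mm_eq \<mu> f g \<longleftrightarrow> mm_norm \<mu> (\<lambda>s. f s - g s) = 0"

definition mult_x :: "(real \<Rightarrow> complex^2) \<Rightarrow> real \<Rightarrow> complex^2" where
  "mult_x f = (\<lambda>x. complex_of_real x *s f x)"

definition mult_dom :: "(real set \<Rightarrow> complex^2^2) \<Rightarrow> (real \<Rightarrow> complex^2) set" where
  "mult_dom \<mu> = {f \<in> mm_L2 \<mu>. mult_x f \<in> mm_L2 \<mu>}"

definition mult_eigenvector ::
  "(real set \<Rightarrow> complex^2^2) \<Rightarrow> complex \<Rightarrow> (real \<Rightarrow> complex^2) \<Rightarrow> bool" where
  "mult_eigenvector \<mu> z f \<longleftrightarrow>
     f \<in> mult_dom \<mu> \<and> \<not> mm_eq \<mu> f (\<lambda>x. 0) \<and> mm_eq \<mu> (mult_x f) (\<lambda>x. z *s f x)"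

text \<open>Here and above, \<open>mm_norm\<close> and \<open>mm_eq\<close> are applied to (differences of) members of
  \<open>mm_L2\<close> only; the integral of a non-integrable function would be \<open>0\<close>.
  The predicate below describes a unitary map from \<open>L\<^sup>2((a,b),w)\<close> onto \<open>L\<^sup>2(\<mu>)\<close>, given on representatives, that
  transforms \<open>L\<^sub>0\<close> into multiplication by the independent variable.\<close>

definition spectral_transform ::
  "sl_expr \<Rightarrow> (real \<Rightarrow> real) \<Rightarrow> (real \<Rightarrow> real) \<Rightarrow> (real set \<Rightarrow> complex^2^2) \<Rightarrow>
   ((real \<Rightarrow> complex) \<Rightarrow> real \<Rightarrow> complex^2) \<Rightarrow> bool" where
  "spectral_transform S va vb \<mu> U \<longleftrightarrow>
     (\<forall>f \<in> sl_L2 S. U f \<in> mm_L2 \<mu>) \<and>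
     (\<forall>f \<in> sl_L2 S. \<forall>g \<in> sl_L2 S. mm_eq \<mu> (U (\<lambda>x. f x + g x)) (\<lambda>s. U f s + U g s)) \<and>
     (\<forall>f \<in> sl_L2 S. \<forall>c. mm_eq \<mu> (U (\<lambda>x. c * f x)) (\<lambda>s. c *s U f s)) \<and>
     (\<forall>f \<in> sl_L2 S. (mm_norm \<mu> (U f))\<^sup>2 = Re (sl_inner S f f)) \<and>
     (\<forall>F \<in> mm_L2 \<mu>. \<exists>f \<in> sl_L2 S. mm_eq \<mu> (U f) F) \<and>
     (\<forall>f \<in> sl_L2 S. U f \<in> mult_dom \<mu> \<longleftrightarrow>
        (\<exists>g \<in> Domain (L_0 S va vb). AE x in sl_measure S. f x = g x)) \<and>
     (\<forall>(f, g) \<in> L_0 S va vb. mm_eq \<mu> (U g) (mult_x (U f)))"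

definition mm_closed_span ::
  "(real set \<Rightarrow> complex^2^2) \<Rightarrow> (nat \<Rightarrow> real \<Rightarrow> complex^2) \<Rightarrow> (real \<Rightarrow> complex^2) set" where
  "mm_closed_span \<mu> F =
     {f \<in> mm_L2 \<mu>. \<forall>e>0. \<exists>N. \<exists>c::nat \<Rightarrow> complex.
        mm_norm \<mu> (\<lambda>x. f x - (\<Sum>n<N. c n *s F n x)) < e}"

definition eigen_f ::
  "sl_expr \<Rightarrow> (real \<Rightarrow> real) \<Rightarrow> (complex \<Rightarrow> real \<Rightarrow> complex) \<Rightarrow> real \<Rightarrow> real \<Rightarrow> complex^2" where
  "eigen_f S ub u2 l x =
     indicator {l} x *s
       vector [1, - Lim (at_right 0) (\<lambda>\<epsilon>. qd1_b S ub (u2 (Complex l \<epsilon>)))]"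

end

(*  Relative to the pair u_a, v_a every solution of (l - z) y = 0 has coefficients that solve an
    integral equation whose kernel is integrable on the whole interval, since both endpoints are
    limit circle.  Gronwall's inequality makes the boundary values at b locally Lipschitz functions
    of z, they are real for real z, and the Wronskian identity A D - B C = 1 relates
    A = u1^[0](b), B = u2^[0](b), C = u1^[1](b) and D = u2^[1](b).  The real zeros of B are the
    eigenvalues of L_0.

    Off these zeros M_0 is continuous up to the real axis with real boundary values, hence the
    measure does not charge the complement of {lambda_n}.  The atom at lambda_n is the limit of
    -i eps M_0(lambda_n + i eps); as A D = 1 there, it is a positive multiple of v v^* with
    v = (1, -D(lambda_n)).  So L^2(mu) is a weighted l^2 of the scalars <f(lambda_n), v>, where
    everything is explicit.  *)

theory Submission
  imports Defs "HOL-Probability.Distribution_Functions"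
begin

section \<open>Absolutely continuous functions\<close>

text \<open>At a singular endpoint a solution and its quasi-derivative may have no limits, so
  everything is phrased through Wronskians with solutions for \<open>l0\<close>; these differ from
  their endpoint values only by integrals of products of two square-integrable functions.

  No analyticity in z enters. The Lipschitz estimate at a fixed point does three jobs. It gives
  continuity up to the real axis. At distance zero it is a uniqueness statement, which compares a
  solution with its conjugate. Near a zero of B it bounds B(lambda_n + i eps) by a multiple of eps,
  so that -i eps / B(lambda_n + i eps) stays away from 0 and the atom cannot vanish; that this
  quotient converges comes from the Herglotz representation and not from a derivative of B.

  The spectral transform is never constructed. Any unitary map intertwining the two operators sends
  an eigenvector to an eigenvector of multiplication, and the latter is unique up to scalars because
  the atoms have rank one and sit at distinct points.\<close>

text \<open>The definition indexes families by initial segments of the naturals. A tagged division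
  is a finite set of pairs, so the index type is freed by an enumeration, and the tagged intervals
  can index themselves.\<close>

lemma abs_cont_on_finite_family:
  assumes "abs_cont_on c d f" "e > 0"
  obtains \<delta> where "\<delta> > 0"
    "\<And>(I::'i set) s t. \<lbrakk>finite I; \<And>i. i \<in> I \<Longrightarrow> c \<le> s i \<and> s i \<le> t i \<and> t i \<le> d;
        disjoint_family_on (\<lambda>i. {s i<..<t i}) I; (\<Sum>i\<in>I. t i - s i) < \<delta>\<rbrakk>
        \<Longrightarrow> (\<Sum>i\<in>I. norm (f (t i) - f (s i))) < e"
proof -
  obtain \<delta> where \<delta>: "\<delta> > 0" and *: "\<And>(n::nat) s t.
        (\<forall>i<n. c \<le> s i \<and> s i \<le> t i \<and> t i \<le> d) \<and>
        disjoint_family_on (\<lambda>i. {s i<..<t i}) {..<n} \<and>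
        (\<Sum>i<n. t i - s i) < \<delta>
        \<Longrightarrow> (\<Sum>i<n. norm (f (t i) - f (s i))) < e"
    using assms(1)[unfolded abs_cont_on_def, THEN spec, THEN mp, OF assms(2)]
    by (elim exE conjE) (rule that, assumption, blast)
  show thesis
  proof (rule that[OF \<delta>])
    fix I :: "'i set" and s t
    assume I: "finite I" and st: "\<And>i. i \<in> I \<Longrightarrow> c \<le> s i \<and> s i \<le> t i \<and> t i \<le> d"
      and dj: "disjoint_family_on (\<lambda>i. {s i<..<t i}) I" and sm: "(\<Sum>i\<in>I. t i - s i) < \<delta>"
    obtain h where h: "bij_betw h {..<card I} I"
      using ex_bij_betw_nat_finite[OF I] by (metis atLeast0LessThan)
    have "(\<Sum>i<card I. norm (f (t (h i)) - f (s (h i)))) < e"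
    proof (rule *, intro conjI)
      show "\<forall>i<card I. c \<le> s (h i) \<and> s (h i) \<le> t (h i) \<and> t (h i) \<le> d"
        using st h by (auto dest: bij_betwE)
      show "disjoint_family_on (\<lambda>i. {s (h i)<..<t (h i)}) {..<card I}"
        unfolding disjoint_family_on_def
      proof (intro ballI impI)
        fix m n assume mn: "m \<in> {..<card I}" "n \<in> {..<card I}" "m \<noteq> n"
        then have "h m \<noteq> h n" "h m \<in> I" "h n \<in> I"
          using h by (auto simp: bij_betw_def inj_on_def)
        then show "{s (h m)<..<t (h m)} \<inter> {s (h n)<..<t (h n)} = {}"
          using dj unfolding disjoint_family_on_def by blast
      qed
      show "(\<Sum>i<card I. t (h i) - s (h i)) < \<delta>"
        using sm sum.reindex_bij_betw[OF h, of "\<lambda>i. t i - s i"] by simp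
    qed
    then show "(\<Sum>i\<in>I. norm (f (t i) - f (s i))) < e"
      using sum.reindex_bij_betw[OF h, of "\<lambda>i. norm (f (t i) - f (s i))"] by simp
  qed
qed

lemma abs_cont_on_continuous_on:
  assumes "abs_cont_on c d f"
  shows "continuous_on {c..d} f"
  unfolding continuous_on_iff
proof (intro ballI allI impI)
  fix x e :: real assume x: "x \<in> {c..d}" and e: "e > 0"
  obtain \<delta> where \<delta>: "\<delta> > 0"
    "\<And>(I::unit set) s t. \<lbrakk>finite I; \<And>i. i \<in> I \<Longrightarrow> c \<le> s i \<and> s i \<le> t i \<and> t i \<le> d;
        disjoint_family_on (\<lambda>i. {s i<..<t i}) I; (\<Sum>i\<in>I. t i - s i) < \<delta>\<rbrakk>
        \<Longrightarrow> (\<Sum>i\<in>I. norm (f (t i) - f (s i))) < e"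
    by (rule abs_cont_on_finite_family[OF assms e]) blast
  have *: "norm (f v - f u) < e" if "c \<le> u" "u \<le> v" "v \<le> d" "v - u < \<delta>" for u v
    using \<delta>(2)[of "{()}" "\<lambda>_. u" "\<lambda>_. v"] that by (auto simp: disjoint_family_on_def)
  show "\<exists>\<delta>>0. \<forall>x'\<in>{c..d}. dist x' x < \<delta> \<longrightarrow> dist (f x') (f x) < e"
  proof (intro exI conjI ballI impI)
    fix y assume y: "y \<in> {c..d}" "dist y x < \<delta>"
    show "dist (f y) (f x) < e"
    proof (cases "x \<le> y")
      case True
      then show ?thesis using *[of x y] x y by (auto simp: dist_norm)
    next
      case False
      then show ?thesis using *[of y x] x y by (auto simp: dist_norm norm_minus_commute)
    qed
  qed (fact \<delta>(1))
qed

lemma abs_cont_on_cnj: "abs_cont_on c d f \<Longrightarrow> abs_cont_on c d (\<lambda>x. cnj (f x))"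
  unfolding abs_cont_on_def by (simp flip: complex_cnj_diff)

text \<open>Common source of closure under differences and products; for a product, each of
  \<open>A\<close> and \<open>B\<close> is a bound of the opposite factor on the compact
  interval.\<close>

lemma abs_cont_on_dominated:
  assumes f: "abs_cont_on c d f" and g: "abs_cont_on c d g" and AB: "A > 0" "B > 0"
    and h: "\<And>x y. x \<in> {c..d} \<Longrightarrow> y \<in> {c..d} \<Longrightarrow>
      norm (h y - h x) \<le> A * norm (f y - f x) + B * norm (g y - g x)"
  shows "abs_cont_on c d h"
  unfolding abs_cont_on_def
proof (intro allI impI)
  fix e :: real assume e0: "e > 0"
  have e1: "e / (2 * A) > 0" and e2: "e / (2 * B) > 0" using e0 AB by auto
  obtain \<delta>1 where \<delta>1: "\<delta>1 > 0"
    "\<And>(I::nat set) s t. \<lbrakk>finite I; \<And>i. i \<in> I \<Longrightarrow> c \<le> s i \<and> s i \<le> t i \<and> t i \<le> d;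
        disjoint_family_on (\<lambda>i. {s i<..<t i}) I; (\<Sum>i\<in>I. t i - s i) < \<delta>1\<rbrakk>
        \<Longrightarrow> (\<Sum>i\<in>I. norm (f (t i) - f (s i))) < e / (2 * A)"
    by (rule abs_cont_on_finite_family[OF f e1]) blast
  obtain \<delta>2 where \<delta>2: "\<delta>2 > 0"
    "\<And>(I::nat set) s t. \<lbrakk>finite I; \<And>i. i \<in> I \<Longrightarrow> c \<le> s i \<and> s i \<le> t i \<and> t i \<le> d;
        disjoint_family_on (\<lambda>i. {s i<..<t i}) I; (\<Sum>i\<in>I. t i - s i) < \<delta>2\<rbrakk>
        \<Longrightarrow> (\<Sum>i\<in>I. norm (g (t i) - g (s i))) < e / (2 * B)"
    by (rule abs_cont_on_finite_family[OF g e2]) blast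
  show "\<exists>\<delta>>0. \<forall>(n::nat) s t.
          (\<forall>i<n. c \<le> s i \<and> s i \<le> t i \<and> t i \<le> d) \<and>
          disjoint_family_on (\<lambda>i. {s i<..<t i}) {..<n} \<and> (\<Sum>i<n. t i - s i) < \<delta> \<longrightarrow>
          (\<Sum>i<n. norm (h (t i) - h (s i))) < e"
  proof (intro exI[of _ "min \<delta>1 \<delta>2"] conjI allI impI, use \<delta>1(1) \<delta>2(1) in simp, elim conjE)
    fix n :: nat and s t :: "nat \<Rightarrow> real"
    assume st: "\<forall>i<n. c \<le> s i \<and> s i \<le> t i \<and> t i \<le> d"
      and dj: "disjoint_family_on (\<lambda>i. {s i<..<t i}) {..<n}"
      and sm: "(\<Sum>i<n. t i - s i) < min \<delta>1 \<delta>2"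
    have "s i \<in> {c..d}" "t i \<in> {c..d}" if "i < n" for i using st that by force+
    then have "(\<Sum>i<n. norm (h (t i) - h (s i)))
        \<le> (\<Sum>i<n. A * norm (f (t i) - f (s i)) + B * norm (g (t i) - g (s i)))"
      by (intro sum_mono h) auto
    also have "\<dots> = A * (\<Sum>i<n. norm (f (t i) - f (s i))) + B * (\<Sum>i<n. norm (g (t i) - g (s i)))"
      by (simp add: sum.distrib sum_distrib_left)
    also have "\<dots> < A * (e / (2 * A)) + B * (e / (2 * B))"
      by (rule add_strict_mono[OF mult_strict_left_mono[OF \<delta>1(2) AB(1)]
            mult_strict_left_mono[OF \<delta>2(2) AB(2)]]) (use st dj sm in auto)
    finally show "(\<Sum>i<n. norm (h (t i) - h (s i))) < e" using AB by simp
  qed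
qed

lemma abs_cont_on_minus:
  assumes "abs_cont_on c d f" "abs_cont_on c d g"
  shows "abs_cont_on c d (\<lambda>x. f x - g x)"
proof (rule abs_cont_on_dominated[OF assms, of 1 1])
  fix x y
  have e: "f y - g y - (f x - g x) = (f y - f x) - (g y - g x)" by simp
  show "norm (f y - g y - (f x - g x)) \<le> 1 * norm (f y - f x) + 1 * norm (g y - g x)"
    unfolding e mult_1 by (rule norm_triangle_ineq4)
qed auto

lemma abs_cont_on_mult:
  assumes "abs_cont_on c d f" "abs_cont_on c d g"
  shows "abs_cont_on c d (\<lambda>x. f x * g x)"
proof -
  have "compact (f ` {c..d})" "compact (g ` {c..d})"
    using assms[THEN abs_cont_on_continuous_on] by (simp_all add: compact_continuous_image)
  then obtain F G where F: "F > 0" "\<And>x. x \<in> {c..d} \<Longrightarrow> norm (f x) \<le> F"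
    and G: "G > 0" "\<And>x. x \<in> {c..d} \<Longrightarrow> norm (g x) \<le> G"
    using compact_imp_bounded bounded_pos by (metis imageI)
  show ?thesis
  proof (rule abs_cont_on_dominated[OF assms G(1) F(1)])
    fix x y assume xy: "x \<in> {c..d}" "y \<in> {c..d}"
    have "f y * g y - f x * g x = g y * (f y - f x) + f x * (g y - g x)" by (simp add: algebra_simps)
    then have "norm (f y * g y - f x * g x) \<le> norm (g y) * norm (f y - f x) + norm (f x) * norm (g y - g x)"
      by (metis norm_mult norm_triangle_ineq)
    also have "\<dots> \<le> G * norm (f y - f x) + F * norm (g y - g x)"
      by (intro add_mono mult_right_mono F G xy) auto
    finally show "norm (f y * g y - f x * g x) \<le> G * norm (f y - f x) + F * norm (g y - g x)" .
  qed
qed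

text \<open>The Henstock gauge treats the two kinds of tags separately: outside the exceptional null set
  the derivative controls the error, and on it the gauge is forced into an open set of small
  measure, where absolute continuity applies.\<close>

lemma abs_cont_on_fundamental_theorem:
  fixes F :: "real \<Rightarrow> complex"
  assumes cd: "c \<le> d" and ac: "abs_cont_on c d F" and N: "negligible N"
    and der: "\<And>x. x \<in> {c..d} \<Longrightarrow> x \<notin> N \<Longrightarrow> (F has_vector_derivative f x) (at x)"
  shows "(f has_integral F d - F c) {c..d}"
proof -
  \<comment> \<open>With the value 0 on \<open>N\<close>, a tag in \<open>N\<close> contributes no
    derivative term but only an increment of \<open>F\<close>, which absolute continuity
    bounds.\<close>
  define g where "g x = (if x \<in> N then 0 else f x)" for x
  have "(g has_integral F d - F c) {c..d}"
    unfolding has_integral_real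
  proof (intro allI impI)
    fix e :: real assume e: "e > 0"
    \<comment> \<open>The \<open>+ 1\<close> keeps the denominator positive when
      \<open>c = d\<close>.\<close>
    define e1 where "e1 = e / (2 * (d - c + 1))"
    have e1: "e1 > 0" "e1 * (d - c) \<le> e / 2"
      using e cd by (auto simp: e1_def field_simps)
    have "\<exists>r>0. x \<in> {c..d} - N \<longrightarrow>
         (\<forall>y. norm (y-x) < r \<longrightarrow> norm (F y - F x - (y-x) *\<^sub>R f x) \<le> e1 * norm (y-x))" for x
    proof (cases "x \<in> {c..d} - N")
      case True
      then have "(F has_vector_derivative f x) (at x)" using der by auto
      then show ?thesis
        using e1(1) unfolding has_vector_derivative_def has_derivative_at_alt by blast
    qed (auto intro: exI[of _ 1])
    then obtain r where r: "\<And>x. r x > 0"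
      "\<And>x y. x \<in> {c..d} - N \<Longrightarrow> norm (y-x) < r x \<Longrightarrow> norm (F y - F x - (y-x) *\<^sub>R f x) \<le> e1 * norm (y-x)"
      by metis
    obtain \<delta> where \<delta>: "\<delta> > 0"
      "\<And>(I::(real \<times> real set) set) s t. \<lbrakk>finite I; \<And>i. i \<in> I \<Longrightarrow> c \<le> s i \<and> s i \<le> t i \<and> t i \<le> d;
        disjoint_family_on (\<lambda>i. {s i<..<t i}) I; (\<Sum>i\<in>I. t i - s i) < \<delta>\<rbrakk>
        \<Longrightarrow> (\<Sum>i\<in>I. norm (F (t i) - F (s i))) < e / 2"
      by (rule abs_cont_on_finite_family[OF ac half_gt_zero[OF e]]) blast
    have Nn: "N \<in> null_sets lebesgue" using N by (simp add: negligible_iff_null_sets)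
    obtain G where G: "open G" "N \<subseteq> G" "(G - N) \<in> lmeasurable" "emeasure lebesgue (G - N) < ennreal \<delta>"
      using sets_lebesgue_outer_open[of N \<delta>] Nn \<delta>(1) by (metis null_setsD2)
    have emG: "emeasure lebesgue G < ennreal \<delta>"
      using emeasure_Un_null_set[of "G - N" lebesgue N] G Nn
      by (simp add: Un_absorb2 fmeasurableD)
    have "\<exists>k>0. x \<in> N \<longrightarrow> ball x k \<subseteq> G" for x
      using G(1,2) openE by (metis gt_ex subsetD)
    then obtain k where k: "\<And>x. k x > 0" "\<And>x. x \<in> N \<Longrightarrow> ball x (k x) \<subseteq> G" by metis
    define \<gamma> where "\<gamma> x = ball x (if x \<in> N then k x else r x)" for x
    show "\<exists>\<gamma>. gauge \<gamma> \<and> (\<forall>\<D>. \<D> tagged_division_of {c..d} \<and> \<gamma> fine \<D> \<longrightarrow>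
            norm ((\<Sum>(x, K)\<in>\<D>. measure lborel K *\<^sub>R g x) - (F d - F c)) < e)"
    proof (intro exI[of _ \<gamma>] conjI allI impI, unfold \<gamma>_def gauge_def, use k r in simp,
        fold \<gamma>_def, elim conjE)
      fix p assume p: "p tagged_division_of {c..d}" and fine: "\<gamma> fine p"
      have finp: "finite p" using p by blast
      have sumF: "F d - F c = (\<Sum>(x,K)\<in>p. F(Sup K) - F(Inf K))"
        and sumid: "d - c = (\<Sum>(x,K)\<in>p. Sup K - Inf K)"
        using additive_tagged_division_1[where f=F] additive_tagged_division_1[where f= "\<lambda>x. x"] cd p by auto
      have K: "\<exists>u v. K = {u..v} \<and> c \<le> u \<and> u \<le> x \<and> x \<le> v \<and> v \<le> d" if "(x,K) \<in> p" for x K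
      proof -
        have "\<exists>u v. K = cbox u v" "x \<in> K" "K \<subseteq> {c..d}" using p that by blast+
        then show ?thesis by (force simp: atLeastatMost_subset_iff)
      qed
      define T where "T = {i \<in> p. fst i \<in> N}"
      have finT: "finite T" using finp by (simp add: T_def)
      define s t where "s i = Inf (snd i)" and "t i = Sup (snd i)" for i :: "real \<times> real set"
      have st: "c \<le> s i \<and> s i \<le> fst i \<and> fst i \<le> t i \<and> t i \<le> d \<and> snd i = {s i..t i}" if "i \<in> p" for i
        using K[of "fst i" "snd i"] that by (force simp: s_def t_def)
      have dj: "disjoint_family_on (\<lambda>i. {s i<..<t i}) T"
        unfolding disjoint_family_on_def
      proof (intro ballI impI)
        fix m n assume mn: "m \<in> T" "n \<in> T" "m \<noteq> n"
        then have "interior (snd m) \<inter> interior (snd n) = {}"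
          using tagged_division_ofD(5)[OF p, of "fst m" "snd m" "fst n" "snd n"]
          by (auto simp: T_def prod_eq_iff)
        moreover have "snd m = {s m..t m}" "snd n = {s n..t n}" using st mn by (auto simp: T_def)
        ultimately show "{s m<..<t m} \<inter> {s n<..<t n} = {}"
          by (metis interior_atLeastAtMost_real)
      qed
      have sub: "{s i<..<t i} \<subseteq> G" if "i \<in> T" for i
      proof -
        have "snd i \<subseteq> \<gamma> (fst i)" using fine that by (cases i) (auto simp: T_def fine_def)
        moreover have "\<gamma> (fst i) \<subseteq> G" using that k by (auto simp: T_def \<gamma>_def)
        moreover have "{s i<..<t i} \<subseteq> snd i" using st that by (auto simp: T_def)
        ultimately show ?thesis by blast
      qed
      have stT: "s i \<le> t i" if "i \<in> T" for i using st[of i] that by (auto simp: T_def)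
      then have "ennreal (\<Sum>i\<in>T. t i - s i) = (\<Sum>i\<in>T. ennreal (t i - s i))"
        by (subst sum_ennreal) auto
      also have "\<dots> = (\<Sum>i\<in>T. emeasure lebesgue {s i<..<t i})"
        using stT by (intro sum.cong) auto
      also have "\<dots> = emeasure lebesgue (\<Union>i\<in>T. {s i<..<t i})"
        by (rule sum_emeasure) (use dj finT in auto)
      also have "\<dots> \<le> emeasure lebesgue G"
        by (rule emeasure_mono) (use sub G in auto)
      also have "\<dots> < ennreal \<delta>" by (fact emG)
      finally have "ennreal (\<Sum>i\<in>T. t i - s i) < ennreal \<delta>" .
      then have "(\<Sum>i\<in>T. t i - s i) < \<delta>"
        using \<delta>(1) by (metis ennreal_leI linorder_not_less)
      then have A: "(\<Sum>i\<in>T. norm (F (t i) - F (s i))) < e / 2"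
        by (intro \<delta>(2) finT dj) (auto simp: T_def dest!: st)
      have "(\<Sum>(x, K)\<in>p. measure lborel K *\<^sub>R g x) - (F d - F c)
          = (\<Sum>i\<in>p. (t i - s i) *\<^sub>R g (fst i) - (F (t i) - F (s i)))"
      proof -
        have "(\<Sum>(x, K)\<in>p. measure lborel K *\<^sub>R g x) = (\<Sum>i\<in>p. (t i - s i) *\<^sub>R g (fst i))"
        proof (rule sum.cong[OF refl])
          fix i assume "i \<in> p"
          then have "snd i = {s i..t i}" "s i \<le> t i" using st[of i] by auto
          then show "(case i of (x,K) \<Rightarrow> measure lborel K *\<^sub>R g x) = (t i - s i) *\<^sub>R g (fst i)"
            by (simp add: case_prod_beta)
        qed
        then show ?thesis unfolding sumF sum_subtractf by (simp add: case_prod_beta s_def t_def sum_subtractf)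
      qed
      also have "norm \<dots> \<le> (\<Sum>i\<in>p. (if i \<in> T then norm (F (t i) - F (s i)) else 0) + e1 * (t i - s i))"
      proof (rule sum_norm_le)
        fix i assume i: "i \<in> p"
        note sti = st[OF i]
        show "norm ((t i - s i) *\<^sub>R g (fst i) - (F (t i) - F (s i)))
            \<le> (if i \<in> T then norm (F (t i) - F (s i)) else 0) + e1 * (t i - s i)"
        proof (cases "fst i \<in> N")
          case True
          then show ?thesis using i sti e1
            by (auto simp: T_def g_def norm_minus_commute)
        next
          case False
          have "snd i \<subseteq> \<gamma> (fst i)" using fine i by (cases i) (auto simp: fine_def)
          then have "s i \<in> \<gamma> (fst i)" "t i \<in> \<gamma> (fst i)" using sti by auto
          then have n: "norm (s i - fst i) < r (fst i)" "norm (t i - fst i) < r (fst i)"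
            using False by (auto simp: \<gamma>_def dist_norm norm_minus_commute)
          have x: "fst i \<in> {c..d} - N" using False sti by auto
          \<comment> \<open>Straddling: the tag lies between both ends of its interval, so the two
            linearisation errors add up to at most \<open>e1\<close> times the length.\<close>
          have "(t i - s i) *\<^sub>R f (fst i) - (F (t i) - F (s i))
             = (F (s i) - F (fst i) - (s i - fst i) *\<^sub>R f (fst i))
               - (F (t i) - F (fst i) - (t i - fst i) *\<^sub>R f (fst i))"
            by (simp add: algebra_simps)
          then have "norm ((t i - s i) *\<^sub>R f (fst i) - (F (t i) - F (s i)))
             \<le> norm (F (s i) - F (fst i) - (s i - fst i) *\<^sub>R f (fst i))
               + norm (F (t i) - F (fst i) - (t i - fst i) *\<^sub>R f (fst i))"
            by (metis norm_triangle_ineq4)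
          also have "\<dots> \<le> e1 * norm (s i - fst i) + e1 * norm (t i - fst i)"
            by (intro add_mono r(2) n x)
          also have "\<dots> = e1 * (t i - s i)" using sti by (simp add: algebra_simps)
          finally show ?thesis using False by (simp add: T_def g_def)
        qed
      qed
      also have "\<dots> = (\<Sum>i\<in>T. norm (F (t i) - F (s i))) + e1 * (d - c)"
      proof -
        have "(\<Sum>i\<in>p. if i \<in> T then norm (F (t i) - F (s i)) else 0) = (\<Sum>i\<in>T. norm (F (t i) - F (s i)))"
          using finp by (simp add: T_def sum.inter_filter)
        moreover have "(\<Sum>i\<in>p. e1 * (t i - s i)) = e1 * (d - c)"
          unfolding sumid sum_distrib_left by (simp add: case_prod_beta s_def t_def)
        ultimately show ?thesis by (simp add: sum.distrib)
      qed
      also have "\<dots> < e" using A e1(2) by simp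
      finally show "norm ((\<Sum>(x, K)\<in>p. measure lborel K *\<^sub>R g x) - (F d - F c)) < e" .
    qed
  qed
  then show ?thesis
    by (rule has_integral_spike[OF N, rotated]) (auto simp: g_def)
qed

section \<open>Solution pairs and the Lagrange identity\<close>

text \<open>\<open>sl_pair S z y Y\<close> encodes a solution of \<open>(\<ell> - z) y = 0\<close> together with its quasi-derivative
  \<open>Y = p y'\<close> as a first-order system; unlike \<open>qderiv\<close> it is stable under conjugation.\<close>

definition sl_pair :: "sl_expr \<Rightarrow> complex \<Rightarrow> (real \<Rightarrow> complex) \<Rightarrow> (real \<Rightarrow> complex) \<Rightarrow> bool" where
  "sl_pair S z y Y \<longleftrightarrow> AC_loc S y \<and> AC_loc S Y \<and>
     (AE x in lebesgue_on (sl_int S).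
        (y has_vector_derivative Y x / of_real (sl_p S x)) (at x) \<and>
        (Y has_vector_derivative - (z * of_real (sl_w S x) + of_real (sl_q S x)) * y x) (at x))"

text \<open>The bracket made bilinear: no conjugation, and both quasi-derivatives are explicit
  arguments. For real solutions in the second place it agrees with \<open>bracket\<close>.\<close>

definition wronskian :: "(real \<Rightarrow> complex) \<Rightarrow> (real \<Rightarrow> complex) \<Rightarrow> (real \<Rightarrow> complex) \<Rightarrow> (real \<Rightarrow> complex)
    \<Rightarrow> real \<Rightarrow> complex" where
  "wronskian y Y u U x = y x * U x - Y x * u x"

text \<open>Holds because p, q and w are real. It is the source of the reality of the boundary
  values at real parameters.\<close>

lemma sl_pair_cnj:
  assumes "sl_pair S z y Y"
  shows "sl_pair S (cnj z) (\<lambda>x. cnj (y x)) (\<lambda>x. cnj (Y x))"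
proof -
  have "AE x in lebesgue_on (sl_int S).
      (y has_vector_derivative Y x / of_real (sl_p S x)) (at x) \<and>
      (Y has_vector_derivative - (z * of_real (sl_w S x) + of_real (sl_q S x)) * y x) (at x)"
    using assms by (simp add: sl_pair_def)
  then have "AE x in lebesgue_on (sl_int S).
      ((\<lambda>x. cnj (y x)) has_vector_derivative cnj (Y x) / of_real (sl_p S x)) (at x) \<and>
      ((\<lambda>x. cnj (Y x)) has_vector_derivative
        - (cnj z * of_real (sl_w S x) + of_real (sl_q S x)) * cnj (y x)) (at x)"
  proof eventually_elim
    case (elim x)
    show ?case
      using elim[THEN conjunct1, THEN has_vector_derivative_cnj]
        elim[THEN conjunct2, THEN has_vector_derivative_cnj] by simp
  qed
  then show ?thesis
    using assms by (simp add: sl_pair_def AC_loc_def abs_cont_on_cnj)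
qed

lemma continuous_on_AC_loc:
  assumes "AC_loc S f"
  shows "continuous_on (sl_int S) f"
proof -
  have "isCont f x" if x: "x \<in> sl_int S" for x
  proof -
    have "open (sl_int S)" by (simp add: sl_int_def)
    then obtain e where e: "e > 0" "cball x e \<subseteq> sl_int S" using x open_contains_cball by metis
    then have "abs_cont_on (x - e) (x + e) f" using assms unfolding AC_loc_def cball_eq_atLeastAtMost by blast
    then have "continuous_on {x-e..x+e} f" by (rule abs_cont_on_continuous_on)
    then have "continuous_on {x-e<..<x+e} f" by (rule continuous_on_subset) auto
    then show ?thesis using e by (simp add: continuous_on_eq_continuous_at)
  qed
  then show ?thesis by (simp add: continuous_at_imp_continuous_on)
qed

lemma is_interval_sl_int: "is_interval (sl_int S)"
  unfolding is_interval_1 sl_int_def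
proof (intro ballI allI impI, elim conjE)
  fix u v x :: real
  assume "u \<in> einterval (sl_a S) (sl_b S)" "v \<in> einterval (sl_a S) (sl_b S)" "u \<le> x" "x \<le> v"
  then show "x \<in> einterval (sl_a S) (sl_b S)"
    using less_le_trans[of "sl_a S" "ereal u" "ereal x"] le_less_trans[of "ereal x" "ereal v" "sl_b S"]
    by (simp add: einterval_iff)
qed

lemma Icc_subset_sl_int: "c \<in> sl_int S \<Longrightarrow> d \<in> sl_int S \<Longrightarrow> {c..d} \<subseteq> sl_int S"
  by (rule subsetI, rule mem_is_interval_1_I[OF is_interval_sl_int, of c S d]) simp_all

lemma sl_int_lebesgue [measurable, simp]: "sl_int S \<in> sets lebesgue"
  by (simp add: sl_int_def)

section \<open>The weighted measure, the Lagrange identity and square-integrable solutions\<close>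

locale sl_limit_circle =
  fixes S :: sl_expr
  assumes coeff: "sl_coefficients S" and lca: "limit_circle_a S" and lcb: "limit_circle_b S"
begin

text \<open>The weight is only known to be integrable on compact subintervals, so its measurability
  on the whole interval is obtained as a limit along an exhaustion by them.\<close>

lemma sl_w_measurable [measurable]: "sl_w S \<in> borel_measurable (lebesgue_on (sl_int S))"
proof -
  have ab: "sl_a S < sl_b S" using coeff by (simp add: sl_coefficients_def)
  obtain l u :: "nat \<Rightarrow> real" where lu: "einterval (sl_a S) (sl_b S) = (\<Union>i. {l i .. u i})"
    "incseq u" "decseq l"
    using einterval_Icc_approximation[OF ab] by metis
  have 1: "(\<lambda>x. indicator {l i..u i} x * sl_w S x) \<in> borel_measurable lebesgue" for i
  proof -
    have "{l i..u i} \<subseteq> sl_int S" using lu by (auto simp: sl_int_def)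
    then have "sl_w S absolutely_integrable_on {l i..u i}"
      using coeff by (simp add: sl_coefficients_def)
    then show ?thesis
      unfolding set_integrable_def by (auto dest: borel_measurable_integrable)
  qed
  have "(\<lambda>x. indicator (sl_int S) x * sl_w S x) \<in> borel_measurable lebesgue"
  proof (rule borel_measurable_LIMSEQ_real[OF _ 1])
    fix x
    show "(\<lambda>i. indicator {l i..u i} x * sl_w S x) \<longlonglongrightarrow> indicator (sl_int S) x * sl_w S x"
    proof (cases "x \<in> sl_int S")
      case True
      then obtain i where i: "x \<in> {l i..u i}" using lu by (auto simp: sl_int_def)
      have "x \<in> {l j..u j}" if "j \<ge> i" for j
        using i incseqD[OF lu(2) that] decseqD[OF lu(3) that] by simp
      then have "eventually (\<lambda>j. indicator {l j..u j} x * sl_w S x = indicator (sl_int S) x * sl_w S x) sequentially"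
        using True by (intro eventually_sequentiallyI[of i]) auto
      then show ?thesis by (rule tendsto_eventually)
    next
      case False
      then have "x \<notin> {l i..u i}" for i using lu by (auto simp: sl_int_def)
      then show ?thesis using False by simp
    qed
  qed
  then show ?thesis by (simp add: borel_measurable_restrict_space_iff)
qed

lemma AE_sl_w_pos: "AE x in lebesgue_on (sl_int S). 0 < sl_w S x"
  using coeff by (auto simp: sl_coefficients_def)

lemma space_sl_measure [simp]: "space (sl_measure S) = sl_int S"
  by (simp add: sl_measure_def)

lemma sets_sl_measure [measurable_cong]: "sets (sl_measure S) = sets (lebesgue_on (sl_int S))"
  by (simp add: sl_measure_def)

lemma AE_sl_measure_neq: "AE t in sl_measure S. t \<noteq> x"
proof -
  have "AE t in lebesgue. t \<noteq> x" by (rule AE_I'[of "{x}"]) auto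
  then have "AE t in lebesgue_on (sl_int S). t \<noteq> x"
    by (subst AE_restrict_space_iff) (auto elim: eventually_mono)
  then show ?thesis unfolding sl_measure_def by (subst AE_density) (auto elim: eventually_mono)
qed

lemma continuous_measurable_sl [measurable (raw)]:
  assumes "continuous_on (sl_int S) (f :: real \<Rightarrow> complex)"
  shows "f \<in> borel_measurable (sl_measure S)"
  using continuous_imp_measurable_on_sets_lebesgue[OF assms sl_int_lebesgue]
  by (simp add: sl_measure_def)

lemma integrable_sl_measure:
  fixes f :: "real \<Rightarrow> complex"
  assumes "f \<in> borel_measurable (sl_measure S)"
  shows "integrable (sl_measure S) f \<longleftrightarrow> set_integrable lebesgue (sl_int S) (\<lambda>x. sl_w S x *\<^sub>R f x)"
    and "integral\<^sup>L (sl_measure S) f = (LINT x:sl_int S|lebesgue. sl_w S x *\<^sub>R f x)"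
proof -
  have f: "f \<in> borel_measurable (lebesgue_on (sl_int S))" using assms by (simp add: sl_measure_def)
  have w: "AE x in lebesgue_on (sl_int S). 0 \<le> sl_w S x" using AE_sl_w_pos by (auto elim: eventually_mono)
  show "integrable (sl_measure S) f \<longleftrightarrow> set_integrable lebesgue (sl_int S) (\<lambda>x. sl_w S x *\<^sub>R f x)"
    unfolding sl_measure_def set_integrable_def
    by (subst integrable_density[OF f sl_w_measurable w]) (simp add: integrable_restrict_space)
  show "integral\<^sup>L (sl_measure S) f = (LINT x:sl_int S|lebesgue. sl_w S x *\<^sub>R f x)"
    unfolding sl_measure_def set_lebesgue_integral_def
    by (subst integral_density[OF f sl_w_measurable w]) (simp add: integral_restrict_space)
qed

lemma sets_sl_measure_Int: "A \<in> sets borel \<Longrightarrow> A \<inter> sl_int S \<in> sets (sl_measure S)"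
  unfolding sets_sl_measure
  by (subst sets_restrict_space_iff) (auto simp: sl_int_def intro!: sets.Int sets_completionI_sets)

lemma indicator_sl_measurable [measurable]:
  assumes "A \<in> sets borel"
  shows "(indicator A :: real \<Rightarrow> real) \<in> borel_measurable (sl_measure S)"
proof -
  have "(\<lambda>x. x) \<in> measurable (sl_measure S) borel"
    unfolding measurable_def using sets_sl_measure_Int by (auto simp: Int_commute)
  from measurable_compose[OF this borel_measurable_indicator[OF assms]] show ?thesis .
qed

lemma set_integrable_sl_Icc:
  fixes f :: "real \<Rightarrow> complex"
  assumes f: "continuous_on (sl_int S) f" and cd: "c \<in> sl_int S" "d \<in> sl_int S"
  shows "set_integrable (sl_measure S) {c..d} f"
    and "(\<lambda>x. sl_w S x *\<^sub>R f x) absolutely_integrable_on {c..d}"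
    and "(LINT x:{c..d}|sl_measure S. f x) = integral {c..d} (\<lambda>x. sl_w S x *\<^sub>R f x)"
proof -
  note sub = Icc_subset_sl_int[OF cd]
  have fc: "continuous_on {c..d} f" using f sub continuous_on_subset by blast
  have "bounded (f ` {c..d})"
    using fc by (simp add: compact_continuous_image compact_imp_bounded)
  moreover have "f \<in> borel_measurable (lebesgue_on {c..d})"
    using fc by (simp add: continuous_imp_measurable_on_sets_lebesgue)
  moreover have "sl_w S absolutely_integrable_on {c..d}"
    using coeff sub by (simp add: sl_coefficients_def)
  moreover have bl: "bilinear (\<lambda>(x::complex) (r::real). r *\<^sub>R x)"
    unfolding bilinear_conv_bounded_bilinear by (rule bounded_bilinear.flip[OF bounded_bilinear_scaleR])
  ultimately show 1: "(\<lambda>x. sl_w S x *\<^sub>R f x) absolutely_integrable_on {c..d}"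
    using absolutely_integrable_bounded_measurable_product[OF bl, of f "{c..d}" "sl_w S"] by simp
  have m: "(\<lambda>x. indicator {c..d} x *\<^sub>R f x) \<in> borel_measurable (sl_measure S)"
    using continuous_measurable_sl[OF f] by measurable
  have e: "indicator (sl_int S) x *\<^sub>R sl_w S x *\<^sub>R indicator {c..d} x *\<^sub>R f x
      = indicator {c..d} x *\<^sub>R sl_w S x *\<^sub>R f x" for x
    using sub by (auto simp: indicator_def)
  show "set_integrable (sl_measure S) {c..d} f"
    using 1 unfolding set_integrable_def[of "sl_measure S"] integrable_sl_measure(1)[OF m]
    unfolding set_integrable_def e .
  have "(LINT x:{c..d}|sl_measure S. f x) = (LINT x:{c..d}|lebesgue. sl_w S x *\<^sub>R f x)"
    unfolding set_lebesgue_integral_def[of "sl_measure S"] integrable_sl_measure(2)[OF m]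
    unfolding set_lebesgue_integral_def e ..
  then show "(LINT x:{c..d}|sl_measure S. f x) = integral {c..d} (\<lambda>x. sl_w S x *\<^sub>R f x)"
    using set_lebesgue_integral_eq_integral(2)[OF 1] by simp
qed

lemma sl_pair_continuous:
  assumes "sl_pair S z y Y"
  shows "continuous_on (sl_int S) y" "continuous_on (sl_int S) Y"
  using assms by (auto simp: sl_pair_def intro: continuous_on_AC_loc)

text \<open>Positivity of p and w almost everywhere allows both defining relations to be solved for
  the derivatives.\<close>

lemma sl_pair_qderiv:
  assumes "sl_solution S z y"
  shows "sl_pair S z y (qderiv S y)"
proof -
  have sm: "sl_maps S y (\<lambda>x. z * y x)" using assms by (simp add: sl_solution_def)
  then have h: "has_qderiv S y (qderiv S y)"
    unfolding sl_maps_def qderiv_def by (metis someI_ex)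
  have pw: "AE x in lebesgue_on (sl_int S). 0 < sl_p S x \<and> 0 < sl_w S x"
    using coeff by (simp add: sl_coefficients_def)
  have "AE x in lebesgue_on (sl_int S).
        \<exists>D. (y has_vector_derivative D) (at x) \<and> qderiv S y x = of_real (sl_p S x) * D"
    using h by (simp add: has_qderiv_def)
  moreover have "AE x in lebesgue_on (sl_int S).
        \<exists>D. (qderiv S y has_vector_derivative D) (at x) \<and>
            z * y x = - (1 / of_real (sl_w S x)) * (D + of_real (sl_q S x) * y x)"
    using sm by (simp add: sl_maps_def)
  ultimately have "AE x in lebesgue_on (sl_int S).
        (y has_vector_derivative qderiv S y x / of_real (sl_p S x)) (at x) \<and>
        (qderiv S y has_vector_derivative
          - (z * of_real (sl_w S x) + of_real (sl_q S x)) * y x) (at x)"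
    using pw
  proof eventually_elim
    case (elim x)
    then obtain D E where D: "(y has_vector_derivative D) (at x)" "qderiv S y x = of_real (sl_p S x) * D"
      and E: "(qderiv S y has_vector_derivative E) (at x)"
          "z * y x = - (1 / of_real (sl_w S x)) * (E + of_real (sl_q S x) * y x)" by blast
    have "D = qderiv S y x / of_real (sl_p S x)" using D(2) elim by simp
    moreover have "E = - (z * of_real (sl_w S x) + of_real (sl_q S x)) * y x"
    proof -
      have "E + of_real (sl_q S x) * y x = - (of_real (sl_w S x) * (z * y x))"
        using elim unfolding E(2) by simp
      then have "E = - (of_real (sl_w S x) * (z * y x)) - of_real (sl_q S x) * y x"
        by (simp only: eq_diff_eq)
      then show ?thesis by algebra
    qed
    ultimately show ?case using D(1) E(1) by simp
  qed
  then show ?thesis using h by (simp add: sl_pair_def has_qderiv_def)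
qed

text \<open>The set where \<open>f\<close> does not vanish is open, and a nonempty open set is not
  negligible.\<close>

lemma continuous_AE_zero:
  fixes f :: "real \<Rightarrow> complex"
  assumes c: "continuous_on (sl_int S) f" and ae: "AE x in lebesgue_on (sl_int S). f x = 0"
    and x: "x \<in> sl_int S"
  shows "f x = 0"
proof (rule ccontr)
  assume ne: "f x \<noteq> 0"
  have op: "open (sl_int S)" by (simp add: sl_int_def)
  have "open (f -` (- {0}) \<inter> sl_int S)"
    using c op by (metis Int_commute continuous_on_open_vimage open_Compl closed_singleton)
  then have U: "open {x \<in> sl_int S. f x \<noteq> 0}"
    by (rule back_subst[where P="open"]) auto
  have "AE x in lebesgue. x \<in> sl_int S \<longrightarrow> f x = 0"
    using ae by (simp add: AE_restrict_space_iff)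
  then have "AE x in lebesgue. x \<notin> {x \<in> sl_int S. f x \<noteq> 0}"
    by (auto elim: eventually_mono)
  then have "{x \<in> sl_int S. f x \<noteq> 0} \<in> null_sets lebesgue"
    using U by (subst AE_iff_null_sets) (auto elim: eventually_mono)
  then have "negligible {x \<in> sl_int S. f x \<noteq> 0}"
    by (simp add: negligible_iff_null_sets)
  then have "{x \<in> sl_int S. f x \<noteq> 0} = {}"
    using U open_not_negligible by blast
  then show False using ne x by blast
qed

text \<open>Almost everywhere the quasi-derivative is p times the derivative; continuity upgrades
  this to every point. It identifies the quasi-derivative of a real solution with its
  conjugate.\<close>

lemma sl_pair_unique:
  assumes "sl_pair S z y Y" "sl_pair S z' y' Y'" "\<And>x. x \<in> sl_int S \<Longrightarrow> y x = y' x" "x \<in> sl_int S"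
  shows "Y x = Y' x"
proof -
  have c: "continuous_on (sl_int S) (\<lambda>x. Y x - Y' x)"
    using sl_pair_continuous(2) assms(1,2) by (intro continuous_on_diff) auto
  have op: "open (sl_int S)" by (simp add: sl_int_def)
  have "AE x in lebesgue_on (sl_int S). 0 < sl_p S x"
    using coeff by (auto simp: sl_coefficients_def)
  moreover have "AE x in lebesgue_on (sl_int S).
      (y has_vector_derivative Y x / of_real (sl_p S x)) (at x)"
    "AE x in lebesgue_on (sl_int S).
      (y' has_vector_derivative Y' x / of_real (sl_p S x)) (at x)"
    using assms(1,2) by (auto simp: sl_pair_def)
  moreover have "AE x in lebesgue_on (sl_int S). x \<in> sl_int S"
    by (rule AE_I2) simp
  ultimately have "AE x in lebesgue_on (sl_int S). Y x - Y' x = 0"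
  proof eventually_elim
    case (elim x)
    have "(y has_vector_derivative Y' x / of_real (sl_p S x)) (at x)"
      by (rule has_vector_derivative_transform_within_open[OF elim(3) op elim(4)]) (simp add: assms(3))
    then have "Y x / of_real (sl_p S x) = Y' x / of_real (sl_p S x)"
      using elim(2) vector_derivative_unique_at by blast
    then show ?case using elim by simp
  qed
  from continuous_AE_zero[OF c this assms(4)] show ?thesis by simp
qed

text \<open>In the derivative of the Wronskian the terms with 1/p and with q cancel, and only the
  difference of the parameters survives. Absolute continuity of the Wronskian then gives the
  integrated form.\<close>

lemma lagrange_identity:
  assumes y: "sl_pair S z1 y Y" and u: "sl_pair S z2 u U"
    and cd: "c \<in> sl_int S" "d \<in> sl_int S" "c \<le> d"
  shows "wronskian y Y u U d - wronskian y Y u U c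
      = (z1 - z2) * (LINT x:{c..d}|sl_measure S. y x * u x)"
proof -
  note sub = Icc_subset_sl_int[OF cd(1,2)]
  have ac: "abs_cont_on c d y" "abs_cont_on c d Y" "abs_cont_on c d u" "abs_cont_on c d U"
    using y u sub by (auto simp: sl_pair_def AC_loc_def)
  have acW: "abs_cont_on c d (wronskian y Y u U)"
    unfolding wronskian_def[abs_def] by (intro abs_cont_on_minus abs_cont_on_mult ac)
  have "AE x in lebesgue_on (sl_int S). 0 < sl_p S x"
    using coeff by (auto simp: sl_coefficients_def)
  moreover have "AE x in lebesgue_on (sl_int S).
      (y has_vector_derivative Y x / of_real (sl_p S x)) (at x) \<and>
        (Y has_vector_derivative - (z1 * of_real (sl_w S x) + of_real (sl_q S x)) * y x) (at x)"
    "AE x in lebesgue_on (sl_int S).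
      (u has_vector_derivative U x / of_real (sl_p S x)) (at x) \<and>
        (U has_vector_derivative - (z2 * of_real (sl_w S x) + of_real (sl_q S x)) * u x) (at x)"
    using y u by (auto simp: sl_pair_def)
  ultimately have "AE x in lebesgue_on (sl_int S).
      (wronskian y Y u U has_vector_derivative (z1 - z2) * (sl_w S x *\<^sub>R (y x * u x))) (at x)"
  proof eventually_elim
    case (elim x)
    have "(wronskian y Y u U has_vector_derivative
       (y x * (- (z2 * of_real (sl_w S x) + of_real (sl_q S x)) * u x)
          + Y x / of_real (sl_p S x) * U x)
       - (Y x * (U x / of_real (sl_p S x))
          + - (z1 * of_real (sl_w S x) + of_real (sl_q S x)) * y x * u x)) (at x)"
      unfolding wronskian_def[abs_def]
      by (intro has_vector_derivative_diff has_vector_derivative_mult) (use elim in auto)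
    then show ?case by (rule back_subst[of "\<lambda>D. (_ has_vector_derivative D) _"])
        (simp add: scaleR_conv_of_real algebra_simps)
  qed
  then have "AE x in lebesgue. x \<in> sl_int S \<longrightarrow>
      (wronskian y Y u U has_vector_derivative (z1 - z2) * (sl_w S x *\<^sub>R (y x * u x))) (at x)"
    by (simp add: AE_restrict_space_iff)
  then obtain N where N: "N \<in> null_sets lebesgue" "{x. \<not> (x \<in> sl_int S \<longrightarrow>
      (wronskian y Y u U has_vector_derivative (z1 - z2) * (sl_w S x *\<^sub>R (y x * u x))) (at x))} \<subseteq> N"
    unfolding eventually_ae_filter by auto
  have "((\<lambda>x. (z1 - z2) * (sl_w S x *\<^sub>R (y x * u x))) has_integral
      wronskian y Y u U d - wronskian y Y u U c) {c..d}"
    by (rule abs_cont_on_fundamental_theorem[OF cd(3) acW, of N])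
      (use N sub in \<open>auto simp: negligible_iff_null_sets\<close>)
  moreover have "((\<lambda>x. (z1 - z2) * (sl_w S x *\<^sub>R (y x * u x))) has_integral
      (z1 - z2) * integral {c..d} (\<lambda>x. sl_w S x *\<^sub>R (y x * u x))) {c..d}"
    by (intro has_integral_mult_right integrable_integral set_lebesgue_integral_eq_integral(1)
        set_integrable_sl_Icc(2) continuous_intros sl_pair_continuous(1)[OF y] sl_pair_continuous(1)[OF u] cd)
  ultimately have "wronskian y Y u U d - wronskian y Y u U c
      = (z1 - z2) * integral {c..d} (\<lambda>x. sl_w S x *\<^sub>R (y x * u x))"
    by (rule has_integral_unique)
  also have "integral {c..d} (\<lambda>x. sl_w S x *\<^sub>R (y x * u x)) = (LINT x:{c..d}|sl_measure S. y x * u x)"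
    by (intro set_integrable_sl_Icc(3)[symmetric] continuous_intros sl_pair_continuous(1)[OF y]
        sl_pair_continuous(1)[OF u] cd)
  finally show ?thesis .
qed

lemma sl_solution_L2:
  assumes "sl_solution S z y"
  shows "y \<in> sl_L2 S"
proof -
  note pr = sl_pair_qderiv[OF assms]
  have c: "continuous_on (sl_int S) y" using sl_pair_continuous[OF pr] by simp
  obtain c1 where c1: "c1 \<in> sl_int S" "set_integrable (sl_measure S) {..c1} (\<lambda>x. (norm (y x))\<^sup>2)"
    using lca assms unfolding limit_circle_a_def by blast
  obtain c2 where c2: "c2 \<in> sl_int S" "set_integrable (sl_measure S) {c2..} (\<lambda>x. (norm (y x))\<^sup>2)"
    using lcb assms unfolding limit_circle_b_def by blast
  have ym[measurable]: "y \<in> borel_measurable (sl_measure S)" using c by (rule continuous_measurable_sl)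
  have "set_integrable (sl_measure S) {c1..c2} (\<lambda>x. complex_of_real ((norm (y x))\<^sup>2))"
    by (intro set_integrable_sl_Icc continuous_intros c c1 c2)
  then have 3: "set_integrable (sl_measure S) {c1..c2} (\<lambda>x. (norm (y x))\<^sup>2)"
    unfolding set_integrable_def by (subst (asm) integrable_norm_iff[symmetric])
      (auto simp: norm_mult norm_power split: split_indicator elim!: back_subst[of "integrable _"])
  \<comment> \<open>The three sets cover the line also if \<open>c2 < c1\<close>, when the middle
    one is empty; overlaps only enlarge the dominating function.\<close>
  have "integrable (sl_measure S) (\<lambda>x. indicator {..c1} x *\<^sub>R (norm (y x))\<^sup>2 + indicator {c1..c2} x *\<^sub>R (norm (y x))\<^sup>2
      + indicator {c2..} x *\<^sub>R (norm (y x))\<^sup>2)"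
    using c1(2) 3 c2(2) unfolding set_integrable_def by (intro Bochner_Integration.integrable_add)
  then have "integrable (sl_measure S) (\<lambda>x. (norm (y x))\<^sup>2)"
    by (rule Bochner_Integration.integrable_bound) (auto split: split_indicator)
  then show ?thesis by (simp add: sl_L2_def ym)
qed

end

section \<open>Endpoint limits\<close>

text \<open>The cdf cuts the line into finitely many pieces of mass at most \<open>1/(2L)\<close>; on each piece the
  part of the integral over that piece is absorbed into the left-hand side.\<close>

lemma gronwall_finite_measure:
  fixes m :: "real measure" and L :: real
  assumes m: "finite_borel_measure m" and atomless: "\<And>x. measure m {x} = 0" and L: "L > 0"
  obtains G where "G \<ge> 0"
    "\<And>g K x. g \<in> borel_measurable borel \<Longrightarrow> (\<And>x. 0 \<le> g x) \<Longrightarrow> bounded (range g) \<Longrightarrow> 0 \<le> K \<Longrightarrow>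
       (\<And>x. g x \<le> K + L * (LINT t:{..x}|m. g t)) \<Longrightarrow> g x \<le> K * (G::real)"
proof -
  interpret finite_borel_measure m by (rule m)
  have [measurable_cong]: "sets m = sets borel" by (rule M_is_borel)
  define h where "h = 1 / (2 * L)"
  have h: "h > 0" using L by (simp add: h_def)
  define R where "R = measure m UNIV"
  have R: "measure m A \<le> R" "R \<ge> 0" for A
    using bounded_measure[of A] by (auto simp: R_def borel_UNIV)
  have cdfR: "cdf m x \<le> R" for x by (simp add: cdf_def R)
  \<comment> \<open>Since \<open>L * h = 1/2\<close>, each piece yields
    \<open>s \<le> K + L * K * G k * R + s / 2\<close>, and solving for \<open>s\<close> gives the
    factor \<open>2 + 2 * L * R * G k\<close>. The summand \<open>r\<close> makes the sequence
    increasing.\<close>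
  define G :: "nat \<Rightarrow> real" where "G = rec_nat 1 (\<lambda>_ r. 2 + 2 * L * R * r + r)"
  have G0: "G 0 = 1" and GS: "G (Suc k) = 2 + 2 * L * R * G k + G k" for k
    by (simp_all add: G_def)
  have Gp: "G k \<ge> 0" for k by (induction k) (use L R in \<open>auto simp: G0 GS\<close>)
  have intm: "integrable m (\<lambda>u. indicator A u * c)" if "A \<in> sets borel" for A and c :: real
    using that by (intro integrable_mult_left) (auto simp: emeasure_eq_measure M_is_borel)
  have key: "g x \<le> K * G k"
    if g: "g \<in> borel_measurable borel" "\<And>x. 0 \<le> g x" "bounded (range g)" and K: "0 \<le> K"
      and ineq: "\<And>x. g x \<le> K + L * (LINT t:{..x}|m. g t)" and x: "cdf m x \<le> real k * h"
    for g K x k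
    using x
  proof (induction k arbitrary: x)
    case 0
    then have "measure m {..x} = 0" using measure_nonneg[of m "{..x}"] by (simp add: cdf_def)
    then have "AE t in m. t \<notin> {..x}"
      by (intro AE_not_in) (auto simp: null_sets_def emeasure_eq_measure M_is_borel)
    then have "(LINT t:{..x}|m. g t) = (LINT t|m. 0)"
      unfolding set_lebesgue_integral_def using g(1)
      by (intro integral_cong_AE) (auto elim: eventually_mono)
    then show ?case using ineq[of x] by (simp add: G0)
  next
    case (Suc k)
    define T where "T = {t. cdf m t \<le> real (Suc k) * h}"
    \<comment> \<open>Boundedness of \<open>g\<close> makes this supremum finite, which is what
      permits \<open>s / 2\<close> to be subtracted from both sides.\<close>
    define s where "s = Sup (g ` T)"
    have bdd: "bdd_above (g ` T)" using g(3) by (meson bounded_imp_bdd_above bounded_subset image_mono top_greatest)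
    have gs: "g t \<le> s" if "t \<in> T" for t unfolding s_def using that bdd by (intro cSup_upper) auto
    have xT: "x \<in> T" using Suc.prems by (simp add: T_def)
    have s0: "s \<ge> 0" using gs[OF xT] g(2)[of x] by linarith
    have gint: "integrable m (\<lambda>u. indicator {..t} u * g u)" for t
    proof -
      obtain B where B: "\<And>u. \<bar>g u\<bar> \<le> B" using g(3) by (auto simp: bounded_iff)
      have "B \<ge> 0" using B[of 0] by linarith
      then show ?thesis using g(1) B
        by (intro integrable_const_bound[of _ B]) (auto split: split_indicator)
    qed
    have T_down: "u \<in> T" if "t \<in> T" "u \<le> t" for t u
      using that cdf_nondecreasing[OF that(2)] by (auto simp: T_def)
    have "g t \<le> K + L * K * G k * R + s / 2" if t: "t \<in> T" for t
    proof -
      have "(LINT u:{..t}|m. g u) \<le> K * G k * R + s * h"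
      proof (cases "cdf m t \<le> real k * h")
        case True
        have "(LINT u|m. indicator {..t} u * g u) \<le> (LINT u|m. indicator {..t} u * (K * G k))"
        proof (rule integral_mono[OF gint intm])
          fix u show "indicator {..t} u * g u \<le> indicator {..t} u * (K * G k)"
            using Suc.IH[of u] cdf_nondecreasing[of u t] True by (auto split: split_indicator)
        qed auto
        also have "\<dots> = measure m {..t} * (K * G k)" by (simp add: M_is_borel)
        also have "\<dots> \<le> R * (K * G k)" by (intro mult_right_mono R) (use K Gp in auto)
        finally have "(LINT u:{..t}|m. g u) \<le> K * G k * R" by (simp add: set_lebesgue_integral_def mult_ac)
        moreover have "0 \<le> s * h" using s0 h by simp
        ultimately show ?thesis by linarith
      next
        case False
        show ?thesis
        \<comment> \<open>The level 0 may be approached only at minus infinity, so it need not be a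
          value of the cdf. For \<open>k = 0\<close> no splitting point is required: all of
          \<open>{..t}\<close> has mass at most \<open>h\<close>.\<close>
        proof (cases "k = 0")
          case True
          have "(LINT u|m. indicator {..t} u * g u) \<le> (LINT u|m. indicator {..t} u * s)"
            by (rule integral_mono[OF gint intm]) (use gs T_down t in \<open>auto split: split_indicator\<close>)
          also have "\<dots> = measure m {..t} * s" by (simp add: M_is_borel)
          also have "\<dots> \<le> h * s" using t True s0 by (intro mult_right_mono) (auto simp: T_def cdf_def)
          finally have "(LINT u:{..t}|m. g u) \<le> s * h" by (simp add: set_lebesgue_integral_def mult_ac)
          moreover have "0 \<le> K * G k * R" using K Gp R by auto
          ultimately show ?thesis by linarith
        next
          case k: False
          then have kh: "real k * h > 0" using h by simp
          have "eventually (\<lambda>p. cdf m p < real k * h) at_bot"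
            using cdf_lim_at_bot kh by (rule order_tendstoD)
          then obtain p where p: "p \<le> t" "cdf m p < real k * h"
            unfolding eventually_at_bot_linorder by (metis linear order_refl)
          have "continuous_on {p..t} (cdf m)"
            using isCont_cdf atomless by (intro continuous_at_imp_continuous_on) auto
          \<comment> \<open>Without atoms the cdf is continuous, so the level \<open>k * h\<close>
            is attained. Left of \<open>t0\<close> the induction hypothesis applies; the rest has
            mass at most \<open>h\<close>.\<close>
          then obtain t0 where t0: "p \<le> t0" "t0 \<le> t" "cdf m t0 = real k * h"
            using IVT'[of "cdf m" p "real k * h" t] p False by auto
          have t0t: "t0 < t" using t0 False by (cases "t0 = t") auto
          have "(LINT u|m. indicator {..t} u * g u)
              \<le> (LINT u|m. indicator {..t0} u * (K * G k) + indicator {t0<..t} u * s)"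
          proof (rule integral_mono[OF gint])
            show "integrable m (\<lambda>u. indicator {..t0} u * (K * G k) + indicator {t0<..t} u * s)"
              by (intro Bochner_Integration.integrable_add intm) auto
            fix u
            show "indicator {..t} u * g u \<le> indicator {..t0} u * (K * G k) + indicator {t0<..t} u * s"
              using Suc.IH[of u] cdf_nondecreasing[of u t0] t0 gs[of u] T_down[OF t, of u]
              by (auto split: split_indicator)
          qed
          also have "\<dots> = measure m {..t0} * (K * G k) + measure m {t0<..t} * s"
            by (subst Bochner_Integration.integral_add[OF intm intm]) (simp_all add: M_is_borel)
          also have "\<dots> \<le> R * (K * G k) + h * s"
          proof (intro add_mono mult_right_mono R)
            have "measure m {t0<..t} = cdf m t - cdf m t0" by (rule cdf_diff_eq[symmetric, OF t0t])
            also have "\<dots> \<le> h" using t t0 by (simp add: T_def algebra_simps)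
            finally show "measure m {t0<..t} \<le> h" .
          qed (use K Gp s0 in auto)
          finally show ?thesis by (simp add: set_lebesgue_integral_def mult_ac)
        qed
      qed
      then have "L * (LINT u:{..t}|m. g u) \<le> L * (K * G k * R + s * h)" using L by simp
      also have "\<dots> = L * K * G k * R + s / 2" using L by (simp add: h_def field_simps)
      finally show ?thesis using ineq[of t] by linarith
    qed
    then have "s \<le> K + L * K * G k * R + s / 2"
      unfolding s_def using xT by (intro cSup_least) (auto simp: s_def)
    then have "s \<le> K * (2 + 2 * L * R * G k)" by (simp add: algebra_simps)
    also have "\<dots> \<le> K * G (Suc k)" using K Gp by (intro mult_left_mono) (auto simp: GS)
    finally show ?case using gs[OF xT] by linarith
  qed
  obtain n :: nat where n: "R / h \<le> real n" using real_arch_simple by blast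
  then have "R \<le> real n * h" using h by (simp add: field_simps)
  then have "cdf m x \<le> real n * h" for x using cdfR[of x] by linarith
  then show thesis by (intro that[of "G n"] Gp key) auto
qed

context sl_limit_circle
begin

abbreviation at_a :: "ereal filter" where "at_a \<equiv> at_right (sl_a S)"
abbreviation at_b :: "ereal filter" where "at_b \<equiv> at_left (sl_b S)"

lemma sl_a_less_b: "sl_a S < sl_b S"
  using coeff by (simp add: sl_coefficients_def)

lemma at_a_neq_bot [simp]: "at_a \<noteq> bot"
proof
  assume "at_a = bot"
  then have "eventually (\<lambda>_. False) at_a" by simp
  then show False unfolding eventually_at_right[OF sl_a_less_b] by (metis dense)
qed

lemma at_b_neq_bot [simp]: "at_b \<noteq> bot"
proof
  assume "at_b = bot"
  then have "eventually (\<lambda>_. False) at_b" by simp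
  then show False unfolding eventually_at_left[OF sl_a_less_b] by (metis dense)
qed

lemma real_of_ereal_mem_sl_int:
  assumes "sl_a S < x" "x < sl_b S"
  shows "real_of_ereal x \<in> sl_int S" "ereal (real_of_ereal x) = x"
  using assms by (cases x; auto simp: sl_int_def einterval_iff)+

lemma eventually_at_a: "eventually (\<lambda>x. real_of_ereal x \<in> sl_int S) at_a"
  unfolding eventually_at_right[OF sl_a_less_b]
  using sl_a_less_b real_of_ereal_mem_sl_int by blast

lemma eventually_at_b: "eventually (\<lambda>x. real_of_ereal x \<in> sl_int S) at_b"
  unfolding eventually_at_left[OF sl_a_less_b]
  using sl_a_less_b real_of_ereal_mem_sl_int by blast

lemma sl_int_nonempty: obtains c where "c \<in> sl_int S"
  using einterval_nonempty[OF sl_a_less_b] by (auto simp: sl_int_def)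

lemma set_integrable_sl:
  fixes h :: "real \<Rightarrow> complex"
  assumes "integrable (sl_measure S) h" "A \<in> sets borel"
  shows "set_integrable (sl_measure S) A h"
  using assms(1) unfolding set_integrable_def
  by (rule Bochner_Integration.integrable_bound)
    (use assms borel_measurable_integrable[OF assms(1)] in \<open>auto split: split_indicator
      intro!: borel_measurable_scaleR indicator_sl_measurable\<close>)

text \<open>Dominated convergence serving both endpoints: \<open>A\<close> is empty at the left one
  and the whole line at the right one.\<close>

lemma tendsto_set_integral_atMost:
  fixes h :: "real \<Rightarrow> complex"
  assumes h: "integrable (sl_measure S) h" and A: "A \<in> sets borel"
    and ev: "\<And>t. t \<in> sl_int S \<Longrightarrow> eventually (\<lambda>i. t \<le> x i \<longleftrightarrow> t \<in> A) sequentially"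
  shows "(\<lambda>i. LINT t:{..x i}|sl_measure S. h t) \<longlonglongrightarrow> (LINT t:A|sl_measure S. h t)"
  unfolding set_lebesgue_integral_def
proof (rule integral_dominated_convergence[where w="\<lambda>t. norm (h t)"])
  show "AE t in sl_measure S. (\<lambda>i. indicator {..x i} t *\<^sub>R h t) \<longlonglongrightarrow> indicator A t *\<^sub>R h t"
  proof (rule AE_I2)
    fix t assume "t \<in> space (sl_measure S)"
    then have "eventually (\<lambda>i. t \<le> x i \<longleftrightarrow> t \<in> A) sequentially" using ev by simp
    then have "eventually (\<lambda>i. indicator {..x i} t *\<^sub>R h t = indicator A t *\<^sub>R h t) sequentially"
      by eventually_elim (simp add: indicator_def)
    then show "(\<lambda>i. indicator {..x i} t *\<^sub>R h t) \<longlonglongrightarrow> indicator A t *\<^sub>R h t"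
      by (rule tendsto_eventually)
  qed
  show "(\<lambda>t. indicator {..x i} t *\<^sub>R h t) \<in> borel_measurable (sl_measure S)" for i
    using set_integrable_sl[OF h, of "{..x i}"] unfolding set_integrable_def by auto
  show "(\<lambda>t. indicator A t *\<^sub>R h t) \<in> borel_measurable (sl_measure S)"
    using set_integrable_sl[OF h A] unfolding set_integrable_def by auto
qed (use h in \<open>auto split: split_indicator\<close>)

lemma tendsto_integral_at_a:
  fixes h :: "real \<Rightarrow> complex"
  assumes h: "integrable (sl_measure S) h"
  shows "((\<lambda>x. LINT t:{..real_of_ereal x}|sl_measure S. h t) \<longlongrightarrow> 0) at_a"
  unfolding tendsto_at_iff_sequentially
proof (intro allI impI)
  fix X :: "nat \<Rightarrow> ereal" assume X: "\<forall>i. X i \<in> {sl_a S<..} - {sl_a S}" "X \<longlonglongrightarrow> sl_a S"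
  have "(\<lambda>i. LINT t:{..real_of_ereal (X i)}|sl_measure S. h t) \<longlonglongrightarrow> (LINT t:{}|sl_measure S. h t)"
  proof (rule tendsto_set_integral_atMost[OF h])
    fix t assume "t \<in> sl_int S"
    then have "sl_a S < ereal t" by (simp add: sl_int_def einterval_iff)
    then have "eventually (\<lambda>i. X i < ereal t) sequentially" "eventually (\<lambda>i. X i < sl_b S) sequentially"
      using X(2) sl_a_less_b by (auto intro: order_tendstoD)
    then show "eventually (\<lambda>i. t \<le> real_of_ereal (X i) \<longleftrightarrow> t \<in> {}) sequentially"
    proof eventually_elim
      case (elim i)
      have "ereal (real_of_ereal (X i)) = X i"
        using X(1) elim(2) by (intro real_of_ereal_mem_sl_int) auto
      then show ?case using elim(1) by (metis empty_iff ereal_less_eq(3) not_less)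
    qed
  qed simp
  then show "((\<lambda>x. LINT t:{..real_of_ereal x}|sl_measure S. h t) \<circ> X) \<longlonglongrightarrow> 0"
    by (simp add: set_lebesgue_integral_def o_def)
qed

lemma tendsto_integral_at_b:
  fixes h :: "real \<Rightarrow> complex"
  assumes h: "integrable (sl_measure S) h"
  shows "((\<lambda>x. LINT t:{..real_of_ereal x}|sl_measure S. h t) \<longlongrightarrow> (LINT t|sl_measure S. h t)) at_b"
  unfolding tendsto_at_iff_sequentially
proof (intro allI impI)
  fix X :: "nat \<Rightarrow> ereal" assume X: "\<forall>i. X i \<in> {..<sl_b S} - {sl_b S}" "X \<longlonglongrightarrow> sl_b S"
  have "(\<lambda>i. LINT t:{..real_of_ereal (X i)}|sl_measure S. h t) \<longlonglongrightarrow> (LINT t:UNIV|sl_measure S. h t)"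
  proof (rule tendsto_set_integral_atMost[OF h])
    fix t assume "t \<in> sl_int S"
    then have "ereal t < sl_b S" by (simp add: sl_int_def einterval_iff)
    then have "eventually (\<lambda>i. X i > ereal t) sequentially" "eventually (\<lambda>i. X i > sl_a S) sequentially"
      using X(2) sl_a_less_b by (auto intro: order_tendstoD)
    then show "eventually (\<lambda>i. t \<le> real_of_ereal (X i) \<longleftrightarrow> t \<in> UNIV) sequentially"
    proof eventually_elim
      case (elim i)
      have "ereal (real_of_ereal (X i)) = X i"
        using X(1) elim(2) by (intro real_of_ereal_mem_sl_int) auto
      then show ?case using elim(1) by (metis UNIV_I ereal_less_eq(3) less_imp_le)
    qed
  qed simp
  then show "((\<lambda>x. LINT t:{..real_of_ereal x}|sl_measure S. h t) \<circ> X) \<longlonglongrightarrow> (LINT t|sl_measure S. h t)"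
    by (simp add: set_lebesgue_integral_def o_def)
qed

lemma sl_L2_mult_integrable:
  assumes "f \<in> sl_L2 S" "g \<in> sl_L2 S"
  shows "integrable (sl_measure S) (\<lambda>x. f x * g x)"
proof (rule Bochner_Integration.integrable_bound)
  show "integrable (sl_measure S) (\<lambda>x. (norm (f x))\<^sup>2 + (norm (g x))\<^sup>2)"
    using assms by (auto simp: sl_L2_def)
  show "(\<lambda>x. f x * g x) \<in> borel_measurable (sl_measure S)"
    using assms by (auto simp: sl_L2_def)
  have "norm (f x * g x) \<le> norm ((norm (f x))\<^sup>2 + (norm (g x))\<^sup>2)" for x
  proof -
    have "2 * (norm (f x) * norm (g x)) \<le> (norm (f x))\<^sup>2 + (norm (g x))\<^sup>2"
      using sum_squares_bound[of "norm (f x)" "norm (g x)"] by simp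
    moreover have "0 \<le> norm (f x) * norm (g x)" by simp
    ultimately show ?thesis unfolding norm_mult real_norm_def by linarith
  qed
  then show "AE x in sl_measure S. norm (f x * g x) \<le> norm ((norm (f x))\<^sup>2 + (norm (g x))\<^sup>2)"
    by simp
qed

definition wlim_a where
  "wlim_a y Y u U = Lim at_a (wronskian y Y u U \<circ> real_of_ereal)"
definition wlim_b where
  "wlim_b y Y u U = Lim at_b (wronskian y Y u U \<circ> real_of_ereal)"

text \<open>The integrand of the Lagrange identity is a product of two square-integrable functions,
  hence integrable up to both endpoints. The limit at \<open>a\<close> is therefore explicit: the
  value at an interior point minus the integral up to that point.\<close>

lemma wronskian_limits:
  assumes y: "sl_pair S z1 y Y" "y \<in> sl_L2 S" and u: "sl_pair S z2 u U" "u \<in> sl_L2 S"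
  shows wronskian_tendsto_a: "((wronskian y Y u U \<circ> real_of_ereal) \<longlongrightarrow> wlim_a y Y u U) at_a"
    and wronskian_tendsto_b: "((wronskian y Y u U \<circ> real_of_ereal) \<longlongrightarrow> wlim_b y Y u U) at_b"
    and wronskian_eq: "\<And>x. x \<in> sl_int S \<Longrightarrow>
       wronskian y Y u U x = wlim_a y Y u U + (z1 - z2) * (LINT t:{..x}|sl_measure S. y t * u t)"
    and wlim_b_eq: "wlim_b y Y u U = wlim_a y Y u U + (z1 - z2) * (LINT t|sl_measure S. y t * u t)"
proof -
  let ?h = "\<lambda>t. y t * u t" and ?W = "wronskian y Y u U"
  have h: "integrable (sl_measure S) ?h" using sl_L2_mult_integrable assms by blast
  obtain c where c: "c \<in> sl_int S" by (rule sl_int_nonempty)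
  define Wa where "Wa = ?W c - (z1 - z2) * (LINT t:{..c}|sl_measure S. ?h t)"
  have split: "(LINT t:{..d}|sl_measure S. ?h t) = (LINT t:{..c}|sl_measure S. ?h t) + (LINT t:{c..d}|sl_measure S. ?h t)"
    if "c \<le> d" for c d
  proof -
    \<comment> \<open>The two pieces share the point \<open>c\<close>, which is a null set.\<close>
    have "AE t in sl_measure S. t \<noteq> c" by (rule AE_sl_measure_neq)
    then have "(LINT t|sl_measure S. indicator {..d} t *\<^sub>R ?h t)
        = (LINT t|sl_measure S. indicator {..c} t *\<^sub>R ?h t + indicator {c..d} t *\<^sub>R ?h t)"
      using set_integrable_sl[OF h, unfolded set_integrable_def, THEN borel_measurable_integrable] that
      by (intro integral_cong_AE borel_measurable_add)
        (auto elim!: eventually_mono split: split_indicator)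
    also have "\<dots> = (LINT t|sl_measure S. indicator {..c} t *\<^sub>R ?h t)
        + (LINT t|sl_measure S. indicator {c..d} t *\<^sub>R ?h t)"
      by (intro Bochner_Integration.integral_add set_integrable_sl[OF h, unfolded set_integrable_def]) auto
    finally show ?thesis by (simp add: set_lebesgue_integral_def)
  qed
  have eq: "?W x = Wa + (z1 - z2) * (LINT t:{..x}|sl_measure S. ?h t)" if x: "x \<in> sl_int S" for x
  proof (cases "c \<le> x")
    case True
    show ?thesis using lagrange_identity[OF y(1) u(1) c x True] split[OF True]
      by (simp add: Wa_def algebra_simps)
  next
    case False
    then have "x \<le> c" by simp
    show ?thesis using lagrange_identity[OF y(1) u(1) x c \<open>x \<le> c\<close>] split[OF \<open>x \<le> c\<close>]
      by (simp add: Wa_def algebra_simps)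
  qed
  have ev: "eventually (\<lambda>x. Wa + (z1 - z2) * (LINT t:{..real_of_ereal x}|sl_measure S. ?h t)
      = (?W \<circ> real_of_ereal) x) at_a"
    "eventually (\<lambda>x. Wa + (z1 - z2) * (LINT t:{..real_of_ereal x}|sl_measure S. ?h t)
      = (?W \<circ> real_of_ereal) x) at_b"
    using eventually_at_a eventually_at_b eq by (auto elim!: eventually_mono)
  have "((\<lambda>x. Wa + (z1 - z2) * (LINT t:{..real_of_ereal x}|sl_measure S. ?h t)) \<longlongrightarrow> Wa + (z1 - z2) * 0) at_a"
    by (intro tendsto_intros tendsto_integral_at_a h)
  then have la: "((?W \<circ> real_of_ereal) \<longlongrightarrow> Wa) at_a"
    using tendsto_cong[OF ev(1)] by (simp add: o_def)
  have "((\<lambda>x. Wa + (z1 - z2) * (LINT t:{..real_of_ereal x}|sl_measure S. ?h t))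
      \<longlongrightarrow> Wa + (z1 - z2) * (LINT t|sl_measure S. ?h t)) at_b"
    by (intro tendsto_intros tendsto_integral_at_b h)
  then have lb: "((?W \<circ> real_of_ereal) \<longlongrightarrow> Wa + (z1 - z2) * (LINT t|sl_measure S. ?h t)) at_b"
    using tendsto_cong[OF ev(2)] by (simp add: o_def)
  have wa: "wlim_a y Y u U = Wa" unfolding wlim_a_def by (rule tendsto_Lim[OF _ la]) simp
  have wb: "wlim_b y Y u U = Wa + (z1 - z2) * (LINT t|sl_measure S. ?h t)"
    unfolding wlim_b_def by (rule tendsto_Lim[OF _ lb]) simp
  show "((?W \<circ> real_of_ereal) \<longlongrightarrow> wlim_a y Y u U) at_a" using la wa by simp
  show "((?W \<circ> real_of_ereal) \<longlongrightarrow> wlim_b y Y u U) at_b" using lb wb by simp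
  show "\<And>x. x \<in> sl_int S \<Longrightarrow> ?W x = wlim_a y Y u U + (z1 - z2) * (LINT t:{..x}|sl_measure S. ?h t)"
    using eq wa by simp
  show "wlim_b y Y u U = wlim_a y Y u U + (z1 - z2) * (LINT t|sl_measure S. ?h t)"
    using wa wb by simp
qed

abbreviation cnj_qderiv where "cnj_qderiv v \<equiv> \<lambda>x. cnj (qderiv S (cplx_fun v) x)"

text \<open>Outside the interval the chosen \<open>qderiv\<close> is arbitrary, so the conjugation
  inside \<open>bracket\<close> cannot be dropped as a function. On the interval it can, by
  uniqueness of the quasi-derivative.\<close>

lemma sl_pair_real_solution:
  assumes "sl_solution S (complex_of_real l) (cplx_fun u)"
  shows "sl_pair S (complex_of_real l) (cplx_fun u) (\<lambda>x. cnj (qderiv S (cplx_fun u) x))"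
    and "x \<in> sl_int S \<Longrightarrow> cnj (qderiv S (cplx_fun u) x) = qderiv S (cplx_fun u) x"
proof -
  have p: "sl_pair S (complex_of_real l) (cplx_fun u) (qderiv S (cplx_fun u))"
    using assms by (rule sl_pair_qderiv)
  have "(\<lambda>x. cnj (cplx_fun u x)) = cplx_fun u" by (simp add: cplx_fun_def)
  then show c: "sl_pair S (complex_of_real l) (cplx_fun u) (\<lambda>x. cnj (qderiv S (cplx_fun u) x))"
    using sl_pair_cnj[OF p] by simp
  show "x \<in> sl_int S \<Longrightarrow> cnj (qderiv S (cplx_fun u) x) = qderiv S (cplx_fun u) x"
    using sl_pair_unique[OF c p] by simp
qed

lemma bracket_wronskian:
  "bracket S f (cplx_fun v) = wronskian f (qderiv S f) (cplx_fun v) (cnj_qderiv v)"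
  by (rule ext) (simp add: bracket_def wronskian_def cplx_fun_def)

lemma bracket_wlim:
  "bracket_a S f (cplx_fun v) = wlim_a f (qderiv S f) (cplx_fun v) (cnj_qderiv v)"
  "bracket_b S f (cplx_fun v) = wlim_b f (qderiv S f) (cplx_fun v) (cnj_qderiv v)"
  by (simp_all add: bracket_a_def bracket_b_def wlim_a_def wlim_b_def bracket_wronskian)

end

section \<open>Boundary values\<close>

text \<open>The three-term relation between the 2x2 minors of four columns. With a boundary pair for
  \<open>u\<close> and \<open>v\<close>, whose Wronskian is 1, it expresses any Wronskian by
  quantities that converge at the endpoint.\<close>

lemma wronskian_Pluecker:
  "wronskian y Y t T x * wronskian u U v V x
     = wronskian y Y u U x * wronskian t T v V x - wronskian y Y v V x * wronskian t T u U x"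
  by (simp add: wronskian_def algebra_simps)

text \<open>Cramer's rule with determinant 1; this is variation of constants relative to
  \<open>u\<close> and \<open>v\<close>.\<close>

lemma wronskian_expand:
  assumes "wronskian u U v V x = 1"
  shows "y x = wronskian y Y v V x * u x - wronskian y Y u U x * v x"
    and "Y x = wronskian y Y v V x * U x - wronskian y Y u U x * V x"
proof -
  have "y x = y x * wronskian u U v V x" "Y x = Y x * wronskian u U v V x" using assms by simp_all
  then show "y x = wronskian y Y v V x * u x - wronskian y Y u U x * v x"
    and "Y x = wronskian y Y v V x * U x - wronskian y Y u U x * V x"
    by (simp_all add: wronskian_def algebra_simps)
qed

locale sl_bvp = sl_limit_circle +
  fixes l0 :: real and ua va ub vb :: "real \<Rightarrow> real"
  assumes bpa: "boundary_pair_a S l0 ua va" and bpb: "boundary_pair_b S l0 ub vb"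
begin

abbreviation u\<^sub>a where "u\<^sub>a \<equiv> cplx_fun ua"
abbreviation v\<^sub>a where "v\<^sub>a \<equiv> cplx_fun va"
abbreviation u\<^sub>b where "u\<^sub>b \<equiv> cplx_fun ub"
abbreviation v\<^sub>b where "v\<^sub>b \<equiv> cplx_fun vb"
abbreviation U\<^sub>a where "U\<^sub>a \<equiv> \<lambda>x. cnj (qderiv S u\<^sub>a x)"
abbreviation V\<^sub>a where "V\<^sub>a \<equiv> \<lambda>x. cnj (qderiv S v\<^sub>a x)"
abbreviation U\<^sub>b where "U\<^sub>b \<equiv> \<lambda>x. cnj (qderiv S u\<^sub>b x)"
abbreviation V\<^sub>b where "V\<^sub>b \<equiv> \<lambda>x. cnj (qderiv S v\<^sub>b x)"

lemma boundary_solutions: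
  "sl_solution S (complex_of_real l0) u\<^sub>a" "sl_solution S (complex_of_real l0) v\<^sub>a"
  "sl_solution S (complex_of_real l0) u\<^sub>b" "sl_solution S (complex_of_real l0) v\<^sub>b"
  using bpa bpb by (auto simp: boundary_pair_a_def boundary_pair_b_def)

lemmas boundary_pairs = boundary_solutions[THEN sl_pair_real_solution(1)]
lemmas boundary_L2 = boundary_solutions[THEN sl_solution_L2]

text \<open>Both functions solve the equation for \<open>l0\<close>, so the Wronskian is constant
  and equals its normalised limit.\<close>

lemma wronskian_a:
  assumes x: "x \<in> sl_int S"
  shows "wronskian u\<^sub>a U\<^sub>a v\<^sub>a V\<^sub>a x = 1"
proof -
  have "wlim_a u\<^sub>a (qderiv S u\<^sub>a) v\<^sub>a V\<^sub>a = 1"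
    using bpa by (simp add: boundary_pair_a_def bracket_wlim)
  then have "wronskian u\<^sub>a (qderiv S u\<^sub>a) v\<^sub>a V\<^sub>a x = 1"
    using wronskian_eq[OF sl_pair_qderiv[OF boundary_solutions(1)] boundary_L2(1) boundary_pairs(2) boundary_L2(2) x]
    by simp
  then show ?thesis
    using sl_pair_real_solution(2)[OF boundary_solutions(1) x] by (simp add: wronskian_def)
qed

lemma wronskian_b:
  assumes x: "x \<in> sl_int S"
  shows "wronskian u\<^sub>b U\<^sub>b v\<^sub>b V\<^sub>b x = 1"
proof -
  have "wlim_b u\<^sub>b (qderiv S u\<^sub>b) v\<^sub>b V\<^sub>b = 1"
    using bpb by (simp add: boundary_pair_b_def bracket_wlim)
  then have "wronskian u\<^sub>b (qderiv S u\<^sub>b) v\<^sub>b V\<^sub>b x = 1"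
    using wronskian_eq[OF sl_pair_qderiv[OF boundary_solutions(3)] boundary_L2(3) boundary_pairs(4) boundary_L2(4) x]
      wlim_b_eq[OF sl_pair_qderiv[OF boundary_solutions(3)] boundary_L2(3) boundary_pairs(4) boundary_L2(4)]
    by simp
  then show ?thesis
    using sl_pair_real_solution(2)[OF boundary_solutions(3) x] by (simp add: wronskian_def)
qed

text \<open>The quasi-derivative is an explicit argument, so that boundary values can also be taken
  of a conjugated pair, where \<open>qderiv\<close> would choose anew.\<close>

definition a0 where "a0 y Y = wlim_a y Y v\<^sub>a V\<^sub>a"
definition a1 where "a1 y Y = - wlim_a y Y u\<^sub>a U\<^sub>a"
definition b0 where "b0 y Y = wlim_b y Y v\<^sub>b V\<^sub>b"
definition b1 where "b1 y Y = - wlim_b y Y u\<^sub>b U\<^sub>b"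

lemma qd_eq:
  "qd0_a S va y = a0 y (qderiv S y)" "qd1_a S ua y = a1 y (qderiv S y)"
  "qd0_b S vb y = b0 y (qderiv S y)" "qd1_b S ub y = b1 y (qderiv S y)"
  by (simp_all add: qd0_a_def qd1_a_def qd0_b_def qd1_b_def a0_def a1_def b0_def b1_def bracket_wlim)

text \<open>A Wronskian of two solutions for the same parameter is constant, so it equals its limit
  at either endpoint, and the Pluecker relation evaluates that limit. Equating both endpoints gives
  the determinant identity of the fundamental system.\<close>

lemma wronskian_same_parameter:
  assumes "sl_pair S z y Y" "y \<in> sl_L2 S" "sl_pair S z t T" "t \<in> sl_L2 S" "x \<in> sl_int S"
  shows "wronskian y Y t T x = a0 y Y * a1 t T - a1 y Y * a0 t T"
    and "wronskian y Y t T x = b0 y Y * b1 t T - b1 y Y * b0 t T"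
proof -
  let ?w = "wronskian y Y t T x"
  have const: "wronskian y Y t T x' = ?w" if "x' \<in> sl_int S" for x'
    using wronskian_eq[OF assms(1-4)] that assms(5) by simp
  have lim: "?w = l2 * l3 - l1 * l4"
    if "F \<noteq> bot" "eventually (\<lambda>x. real_of_ereal x \<in> sl_int S) F"
      "\<And>x. x \<in> sl_int S \<Longrightarrow> wronskian u U v V x = 1"
      "((wronskian y Y v V \<circ> real_of_ereal) \<longlongrightarrow> l1) F" "((wronskian y Y u U \<circ> real_of_ereal) \<longlongrightarrow> l2) F"
      "((wronskian t T v V \<circ> real_of_ereal) \<longlongrightarrow> l3) F" "((wronskian t T u U \<circ> real_of_ereal) \<longlongrightarrow> l4) F"
    for F u U v V l1 l2 l3 l4
  proof (rule tendsto_unique[OF that(1) tendsto_eventually])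
    show "((\<lambda>x. (wronskian y Y u U \<circ> real_of_ereal) x * (wronskian t T v V \<circ> real_of_ereal) x
      - (wronskian y Y v V \<circ> real_of_ereal) x * (wronskian t T u U \<circ> real_of_ereal) x) \<longlongrightarrow> l2 * l3 - l1 * l4) F"
      by (intro tendsto_diff tendsto_mult that)
    show "eventually (\<lambda>x. (wronskian y Y u U \<circ> real_of_ereal) x * (wronskian t T v V \<circ> real_of_ereal) x
      - (wronskian y Y v V \<circ> real_of_ereal) x * (wronskian t T u U \<circ> real_of_ereal) x = ?w) F"
      using that(2)
    proof eventually_elim
      case (elim x)
      then show ?case
        using wronskian_Pluecker[of y Y t T "real_of_ereal x" u U v V] that(3) const by simp
    qed
  qed
  show "?w = a0 y Y * a1 t T - a1 y Y * a0 t T"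
    using lim[OF at_a_neq_bot eventually_at_a wronskian_a
        wronskian_tendsto_a[OF assms(1,2) boundary_pairs(2) boundary_L2(2)]
        wronskian_tendsto_a[OF assms(1,2) boundary_pairs(1) boundary_L2(1)]
        wronskian_tendsto_a[OF assms(3,4) boundary_pairs(2) boundary_L2(2)]
        wronskian_tendsto_a[OF assms(3,4) boundary_pairs(1) boundary_L2(1)]]
    by (simp add: a0_def a1_def)
  show "?w = b0 y Y * b1 t T - b1 y Y * b0 t T"
    using lim[OF at_b_neq_bot eventually_at_b wronskian_b
        wronskian_tendsto_b[OF assms(1,2) boundary_pairs(4) boundary_L2(4)]
        wronskian_tendsto_b[OF assms(1,2) boundary_pairs(3) boundary_L2(3)]
        wronskian_tendsto_b[OF assms(3,4) boundary_pairs(4) boundary_L2(4)]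
        wronskian_tendsto_b[OF assms(3,4) boundary_pairs(3) boundary_L2(3)]]
    by (simp add: b0_def b1_def)
qed

lemma
  assumes "sl_pair S z y Y" "y \<in> sl_L2 S"
  shows a0_cnj: "a0 (\<lambda>x. cnj (y x)) (\<lambda>x. cnj (Y x)) = cnj (a0 y Y)"
    and a1_cnj: "a1 (\<lambda>x. cnj (y x)) (\<lambda>x. cnj (Y x)) = cnj (a1 y Y)"
    and b0_cnj: "b0 (\<lambda>x. cnj (y x)) (\<lambda>x. cnj (Y x)) = cnj (b0 y Y)"
    and b1_cnj: "b1 (\<lambda>x. cnj (y x)) (\<lambda>x. cnj (Y x)) = cnj (b1 y Y)"
proof -
  have w: "wronskian (\<lambda>x. cnj (y x)) (\<lambda>x. cnj (Y x)) (cplx_fun v) (cnj_qderiv v) x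
      = cnj (wronskian y Y (cplx_fun v) (cnj_qderiv v) x)"
    if "sl_solution S (complex_of_real l0) (cplx_fun v)" "x \<in> sl_int S" for v x
    using sl_pair_real_solution(2)[OF that] by (simp add: wronskian_def cplx_fun_def)
  have lim: "Lim F (wronskian (\<lambda>x. cnj (y x)) (\<lambda>x. cnj (Y x)) (cplx_fun v)
      (cnj_qderiv v) \<circ> real_of_ereal) = cnj l"
    if v: "sl_solution S (complex_of_real l0) (cplx_fun v)" and F: "F \<noteq> bot"
      and ev: "eventually (\<lambda>x. real_of_ereal x \<in> sl_int S) F"
      and l: "((wronskian y Y (cplx_fun v) (cnj_qderiv v) \<circ> real_of_ereal) \<longlongrightarrow> l) F"
    for v F l
  proof (rule tendsto_Lim[OF F])
    have "((\<lambda>x. cnj ((wronskian y Y (cplx_fun v) (cnj_qderiv v) \<circ> real_of_ereal) x))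
        \<longlongrightarrow> cnj l) F"
      by (intro tendsto_cnj l)
    then show "((wronskian (\<lambda>x. cnj (y x)) (\<lambda>x. cnj (Y x)) (cplx_fun v) (cnj_qderiv v)
        \<circ> real_of_ereal) \<longlongrightarrow> cnj l) F"
      by (rule Lim_transform_eventually) (use ev in eventually_elim, simp add: w[OF v])
  qed
  have A: "wlim_a (\<lambda>x. cnj (y x)) (\<lambda>x. cnj (Y x)) (cplx_fun v) (cnj_qderiv v)
     = cnj (wlim_a y Y (cplx_fun v) (cnj_qderiv v))"
    and B: "wlim_b (\<lambda>x. cnj (y x)) (\<lambda>x. cnj (Y x)) (cplx_fun v) (cnj_qderiv v)
     = cnj (wlim_b y Y (cplx_fun v) (cnj_qderiv v))"
    if v: "sl_solution S (complex_of_real l0) (cplx_fun v)" for v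
    using lim[OF v at_a_neq_bot eventually_at_a wronskian_tendsto_a]
      lim[OF v at_b_neq_bot eventually_at_b wronskian_tendsto_b]
      assms sl_pair_real_solution(1)[OF v] sl_solution_L2[OF v]
    by (simp_all add: wlim_a_def[of "\<lambda>x. cnj (y x)"] wlim_b_def[of "\<lambda>x. cnj (y x)"])
  show "a0 (\<lambda>x. cnj (y x)) (\<lambda>x. cnj (Y x)) = cnj (a0 y Y)"
    "a1 (\<lambda>x. cnj (y x)) (\<lambda>x. cnj (Y x)) = cnj (a1 y Y)"
    "b0 (\<lambda>x. cnj (y x)) (\<lambda>x. cnj (Y x)) = cnj (b0 y Y)"
    "b1 (\<lambda>x. cnj (y x)) (\<lambda>x. cnj (Y x)) = cnj (b1 y Y)"
    by (simp_all add: a0_def a1_def b0_def b1_def A B boundary_solutions)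
qed

text \<open>Writing \<open>y = c\<^sub>1 u\<^sub>a + c\<^sub>2 v\<^sub>a\<close> with \<open>c\<^sub>1 = W(y, v\<^sub>a)\<close>, \<open>c\<^sub>2 = - W(y, u\<^sub>a)\<close> turns the equation into
  an integral equation for \<open>(c\<^sub>1, c\<^sub>2)\<close> whose kernel is integrable up to both endpoints, so Gronwall's
  inequality applies on the whole interval.\<close>

lemma coefficient_stability:
  assumes p0: "sl_pair S z0 y0 Y0" "y0 \<in> sl_L2 S"
  obtains C where "C \<ge> 0" "\<And>z y Y x. sl_pair S z y Y \<Longrightarrow> y \<in> sl_L2 S \<Longrightarrow> a0 y Y = a0 y0 Y0 \<Longrightarrow>
      a1 y Y = a1 y0 Y0 \<Longrightarrow> cmod (z - z0) \<le> 1 \<Longrightarrow> x \<in> sl_int S \<Longrightarrow>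
      cmod (wronskian y Y v\<^sub>a V\<^sub>a x - wronskian y0 Y0 v\<^sub>a V\<^sub>a x) +
      cmod (wronskian y Y u\<^sub>a U\<^sub>a x - wronskian y0 Y0 u\<^sub>a U\<^sub>a x) \<le> C * cmod (z - z0)"
proof -
  let ?M = "sl_measure S"
  \<comment> \<open>Every kernel of the integral equation is a product of two of the functions
    \<open>u\<^sub>a\<close>, \<open>v\<^sub>a\<close>, hence bounded by the integrable function
    \<open>(\<rho> x)\<^sup>2\<close>.\<close>
  define \<rho> where "\<rho> x = cmod (u\<^sub>a x) + cmod (v\<^sub>a x)" for x
  have uv[measurable]: "u\<^sub>a \<in> borel_measurable ?M" "v\<^sub>a \<in> borel_measurable ?M"
    using boundary_L2 by (auto simp: sl_L2_def)
  have \<rho>m[measurable]: "\<rho> \<in> borel_measurable ?M" unfolding \<rho>_def[abs_def] by measurable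
  have \<rho>0: "\<rho> x \<ge> 0" for x by (simp add: \<rho>_def)
  have \<rho>L2: "(\<lambda>x. complex_of_real (\<rho> x)) \<in> sl_L2 S"
  proof -
    have "integrable ?M (\<lambda>x. (\<rho> x)\<^sup>2)"
    proof (rule Bochner_Integration.integrable_bound)
      show "integrable ?M (\<lambda>x. 2 * (cmod (u\<^sub>a x))\<^sup>2 + 2 * (cmod (v\<^sub>a x))\<^sup>2)"
        using boundary_L2 by (auto simp: sl_L2_def)
      have "(\<rho> x)\<^sup>2 \<le> 2 * (cmod (u\<^sub>a x))\<^sup>2 + 2 * (cmod (v\<^sub>a x))\<^sup>2" for x
        using sum_squares_bound[of "cmod (u\<^sub>a x)" "cmod (v\<^sub>a x)"] by (simp add: \<rho>_def power2_sum)
      then show "AE x in ?M. norm ((\<rho> x)\<^sup>2) \<le> norm (2 * (cmod (u\<^sub>a x))\<^sup>2 + 2 * (cmod (v\<^sub>a x))\<^sup>2)"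
        by simp
    qed simp
    then show ?thesis by (simp add: sl_L2_def)
  qed
  have \<rho>2: "integrable ?M (\<lambda>x. (\<rho> x)\<^sup>2)" using \<rho>L2 by (simp add: sl_L2_def)
  have idm: "(\<lambda>x. x) \<in> measurable ?M borel"
    unfolding measurable_def using sets_sl_measure_Int by (auto simp: Int_commute)
  \<comment> \<open>The measure with density \<open>(\<rho> x)\<^sup>2\<close> moved to the Borel
    sets of the whole line, the setting of Gronwall's inequality.\<close>
  define m where "m = distr (density ?M (\<lambda>x. ennreal ((\<rho> x)\<^sup>2))) borel (\<lambda>x. x)"
  have [measurable]: "(\<lambda>x. x) \<in> measurable (density ?M (\<lambda>x. ennreal ((\<rho> x)\<^sup>2))) borel"
    using idm by simp
  have em: "emeasure m A = (\<integral>\<^sup>+x. ennreal ((\<rho> x)\<^sup>2) * indicator A x \<partial>?M)" if "A \<in> sets borel" for A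
  proof -
    have "emeasure m A = emeasure (density ?M (\<lambda>x. ennreal ((\<rho> x)\<^sup>2))) (A \<inter> sl_int S)"
      using that unfolding m_def by (subst emeasure_distr) auto
    also have "\<dots> = (\<integral>\<^sup>+x. ennreal ((\<rho> x)\<^sup>2) * indicator (A \<inter> sl_int S) x \<partial>?M)"
      by (subst emeasure_density) (auto simp: sets_sl_measure_Int that)
    also have "\<dots> = (\<integral>\<^sup>+x. ennreal ((\<rho> x)\<^sup>2) * indicator A x \<partial>?M)"
      by (intro nn_integral_cong) (auto split: split_indicator)
    finally show ?thesis .
  qed
  have fin: "finite_borel_measure m"
  proof (intro finite_borel_measure.intro finite_measureI finite_borel_measure_axioms.intro)
    have "emeasure m (space m) = (\<integral>\<^sup>+x. ennreal ((\<rho> x)\<^sup>2) \<partial>?M)"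
      using em[of UNIV] by (simp add: m_def)
    also have "\<dots> < \<infinity>" using \<rho>2 by (simp add: integrable_iff_bounded)
    finally show "emeasure m (space m) \<noteq> \<infinity>" by simp
    show "sets m = sets borel" by (simp add: m_def)
  qed
  have atomless: "measure m {x} = 0" for x
  proof -
    have "AE t in ?M. t \<noteq> x" by (rule AE_sl_measure_neq)
    then have "emeasure m {x} = (\<integral>\<^sup>+x. 0 \<partial>?M)"
      unfolding em[OF borel_singleton[OF sets.empty_sets]]
      by (intro nn_integral_cong_AE) (auto elim!: eventually_mono)
    then show ?thesis by (simp add: measure_def)
  qed
  \<comment> \<open>Bounds the distance from \<open>z\<close> to \<open>l0\<close> for all
    \<open>z\<close> in the unit disc about \<open>z0\<close>, so that the Gronwall constant does
    not depend on \<open>z\<close>.\<close>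
  define L where "L = cmod (z0 - complex_of_real l0) + 1"
  have L: "L > 0" by (simp add: L_def add_nonneg_pos)
  obtain G where G: "G \<ge> 0"
    "\<And>g K x. g \<in> borel_measurable borel \<Longrightarrow> (\<And>x. 0 \<le> g x) \<Longrightarrow> bounded (range g) \<Longrightarrow> 0 \<le> K \<Longrightarrow>
       (\<And>x. g x \<le> K + L * (LINT t:{..x}|m. g t)) \<Longrightarrow> g x \<le> K * G"
    using gronwall_finite_measure[OF fin atomless L] by metis
  have y0int: "integrable ?M (\<lambda>x. cmod (y0 x) * \<rho> x)"
    using integrable_norm[OF sl_L2_mult_integrable[OF p0(2) \<rho>L2]] \<rho>0 by (simp add: norm_mult)
  define J where "J = (LINT x|?M. cmod (y0 x) * \<rho> x)"
  have J: "J \<ge> 0" unfolding J_def by (rule integral_nonneg_AE) (auto simp: \<rho>0)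
  show thesis
  proof (rule that[of "J * G"])
    show "J * G \<ge> 0" using J G by simp
    fix z y Y x
    assume p: "sl_pair S z y Y" "y \<in> sl_L2 S" and e: "a0 y Y = a0 y0 Y0" "a1 y Y = a1 y0 Y0"
      and z: "cmod (z - z0) \<le> 1" and x: "x \<in> sl_int S"
    define d1 d2 where "d1 x = wronskian y Y v\<^sub>a V\<^sub>a x - wronskian y0 Y0 v\<^sub>a V\<^sub>a x"
      and "d2 x = wronskian y Y u\<^sub>a U\<^sub>a x - wronskian y0 Y0 u\<^sub>a U\<^sub>a x" for x
    \<comment> \<open>Extended by zero because the Gronwall inequality is required at every real
      point.\<close>
    define g where "g x = (if x \<in> sl_int S then cmod (d1 x) + cmod (d2 x) else 0)" for x
    \<comment> \<open>Equal to \<open>(z - l0) * y x - (z0 - l0) * y0 x\<close>. In this form the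
      first summand feeds back into \<open>g\<close>, while the second is the perturbation that
      supplies the factor \<open>z - z0\<close>.\<close>
    define k where "k x = (z - l0) * (y x - y0 x) + (z - z0) * y0 x" for x
    have zL: "cmod (z - l0) \<le> L"
      using norm_triangle_ineq[of "z - z0" "z0 - l0"] z by (simp add: L_def)
    have cont: "continuous_on (sl_int S) d1" "continuous_on (sl_int S) d2"
      unfolding d1_def[abs_def] d2_def[abs_def] wronskian_def
      by (intro continuous_intros sl_pair_continuous[OF p(1)] sl_pair_continuous[OF p0(1)]
        sl_pair_continuous[OF boundary_pairs(1)] sl_pair_continuous[OF boundary_pairs(2)])+
    have "sl_int S \<in> sets borel" by (simp add: sl_int_def)
    then have gm: "g \<in> borel_measurable borel"
      unfolding g_def[abs_def]
      by (rule borel_measurable_continuous_on_if) (intro continuous_intros cont)+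
    have ydiff: "y t - y0 t = d1 t * u\<^sub>a t - d2 t * v\<^sub>a t" if "t \<in> sl_int S" for t
      using wronskian_expand(1)[OF wronskian_a[OF that], of y Y] wronskian_expand(1)[OF wronskian_a[OF that], of y0 Y0]
      unfolding d1_def d2_def by algebra
    have kint: "integrable ?M (\<lambda>t. k t * v t)" if "v \<in> sl_L2 S" for v
    proof -
      have "integrable ?M (\<lambda>t. (z - l0) * (y t * v t - y0 t * v t) + (z - z0) * (y0 t * v t))"
        using sl_L2_mult_integrable[OF p(2) that] sl_L2_mult_integrable[OF p0(2) that]
        by (intro Bochner_Integration.integrable_add integrable_mult_right Bochner_Integration.integrable_diff)
      then show ?thesis by (rule back_subst[of "integrable _"]) (auto simp: k_def algebra_simps)
    qed
    \<comment> \<open>The Lagrange identity for both solutions against the same \<open>v\<close>;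
      the equal limits at \<open>a\<close> cancel.\<close>
    have diff: "wronskian y Y v V x - wronskian y0 Y0 v V x = (LINT t:{..x}|?M. k t * v t)"
      if v: "sl_pair S l0 v V" "v \<in> sl_L2 S" and "wlim_a y Y v V = wlim_a y0 Y0 v V" "x \<in> sl_int S" for v V x
    proof -
      note i = set_integrable_sl[OF sl_L2_mult_integrable[OF p(2) v(2)], of "{..x}"]
        and i0 = set_integrable_sl[OF sl_L2_mult_integrable[OF p0(2) v(2)], of "{..x}"]
      have "wronskian y Y v V x - wronskian y0 Y0 v V x
          = (z - l0) * (LINT t:{..x}|?M. y t * v t) - (z0 - l0) * (LINT t:{..x}|?M. y0 t * v t)"
        using wronskian_eq[OF p v that(4)] wronskian_eq[OF p0 v that(4)] that(3) by simp
      also have "\<dots> = (LINT t:{..x}|?M. (z - l0) * (y t * v t) - (z0 - l0) * (y0 t * v t))"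
        by (subst set_integral_diff) (use i i0 in auto)
      also have "\<dots> = (LINT t:{..x}|?M. k t * v t)"
        by (simp add: k_def algebra_simps)
      finally show ?thesis .
    qed
    have d1: "d1 x = (LINT t:{..x}|?M. k t * v\<^sub>a t)" if "x \<in> sl_int S" for x
      unfolding d1_def using e that by (intro diff boundary_pairs boundary_L2) (auto simp: a0_def)
    have d2: "d2 x = (LINT t:{..x}|?M. k t * u\<^sub>a t)" if "x \<in> sl_int S" for x
      unfolding d2_def using e that by (intro diff boundary_pairs boundary_L2) (auto simp: a1_def)
    have bnd: "cmod (LINT t:{..x}|?M. k t * v t) \<le> (LINT t:{..x}|?M. cmod (k t) * cmod (v t))"
      if "v \<in> sl_L2 S" for v x
      using set_integral_norm_bound[OF set_integrable_sl[OF kint[OF that], of "{..x}"]] by (simp add: norm_mult)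
    have kn: "integrable ?M (\<lambda>t. cmod (k t) * cmod (v t))" if "v \<in> sl_L2 S" for v
      using integrable_norm[OF kint[OF that]] by (simp add: norm_mult)
    have ind: "set_integrable ?M A h" if "integrable ?M h" "A \<in> sets borel" for A and h :: "real \<Rightarrow> real"
      using that(1) unfolding set_integrable_def
      by (rule Bochner_Integration.integrable_bound)
       (use that borel_measurable_integrable[OF that(1)] in \<open>auto split: split_indicator
         intro!: borel_measurable_scaleR indicator_sl_measurable\<close>)
    have gk: "g x \<le> (LINT t:{..x}|?M. cmod (k t) * \<rho> t)" for x
    proof (cases "x \<in> sl_int S")
      case True
      have "g x \<le> (LINT t:{..x}|?M. cmod (k t) * cmod (v\<^sub>a t)) + (LINT t:{..x}|?M. cmod (k t) * cmod (u\<^sub>a t))"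
        unfolding g_def using True by (simp add: d1 d2 add_mono bnd boundary_L2)
      also have "\<dots> = (LINT t:{..x}|?M. cmod (k t) * cmod (v\<^sub>a t) + cmod (k t) * cmod (u\<^sub>a t))"
        by (rule set_integral_add(2)[symmetric]) (intro ind kn boundary_L2; simp)+
      finally show ?thesis by (simp add: \<rho>_def algebra_simps)
    next
      case False
      then show ?thesis by (simp add: g_def set_lebesgue_integral_def \<rho>0 integral_nonneg_AE)
    qed
    have krho: "integrable ?M (\<lambda>t. cmod (k t) * \<rho> t)"
      using integrable_norm[OF kint[OF \<rho>L2]] \<rho>0 by (simp add: norm_mult)
    have gb: "g x \<le> (LINT t|?M. cmod (k t) * \<rho> t)" for x
    proof -
      have "(LINT t:{..x}|?M. cmod (k t) * \<rho> t) \<le> (LINT t|?M. cmod (k t) * \<rho> t)"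
        unfolding set_lebesgue_integral_def
        by (rule integral_mono[OF ind[OF krho, unfolded set_integrable_def] krho])
          (auto simp: \<rho>0 split: split_indicator)
      then show ?thesis using gk[of x] by linarith
    qed
    have g0: "0 \<le> g x" for x by (simp add: g_def)
    have gbd: "bounded (range g)" unfolding bounded_iff using gb g0 by (metis abs_of_nonneg rangeE real_norm_def)
    have gint: "(LINT t:{..x}|m. g t) = (LINT t:{..x}|?M. g t * (\<rho> t)\<^sup>2)" for x
    proof -
      have mm: "(\<lambda>t. indicator {..x} t *\<^sub>R g t) \<in> borel_measurable borel" using gm by measurable
      have "(LINT t|m. indicator {..x} t *\<^sub>R g t)
          = (LINT t|density ?M (\<lambda>x. ennreal ((\<rho> x)\<^sup>2)). indicator {..x} t *\<^sub>R g t)"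
        unfolding m_def by (subst integral_distr) (use mm in auto)
      also have "\<dots> = (LINT t|?M. (\<rho> t)\<^sup>2 *\<^sub>R (indicator {..x} t *\<^sub>R g t))"
        by (subst integral_density) (use measurable_compose[OF idm mm] in auto)
      finally show ?thesis by (simp add: set_lebesgue_integral_def mult_ac)
    qed
    have grint: "integrable ?M (\<lambda>t. g t * (\<rho> t)\<^sup>2)"
    proof (rule Bochner_Integration.integrable_bound)
      show "integrable ?M (\<lambda>t. (LINT t|?M. cmod (k t) * \<rho> t) * (\<rho> t)\<^sup>2)" using \<rho>2 by simp
      show "(\<lambda>t. g t * (\<rho> t)\<^sup>2) \<in> borel_measurable ?M"
        using measurable_compose[OF idm gm] by measurable
      show "AE t in ?M. norm (g t * (\<rho> t)\<^sup>2) \<le> norm ((LINT t|?M. cmod (k t) * \<rho> t) * (\<rho> t)\<^sup>2)"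
      proof (rule AE_I2)
        fix t
        have "g t * (\<rho> t)\<^sup>2 \<le> (LINT t|?M. cmod (k t) * \<rho> t) * (\<rho> t)\<^sup>2"
          by (intro mult_right_mono gb) auto
        then show "norm (g t * (\<rho> t)\<^sup>2) \<le> norm ((LINT t|?M. cmod (k t) * \<rho> t) * (\<rho> t)\<^sup>2)"
          using g0[of t] by simp
      qed
    qed
    have main: "g x \<le> cmod (z - z0) * J + L * (LINT t:{..x}|m. g t)" for x
    proof -
      have "g x \<le> (LINT t:{..x}|?M. cmod (k t) * \<rho> t)" by (rule gk)
      also have "\<dots> \<le> (LINT t:{..x}|?M. L * (g t * (\<rho> t)\<^sup>2) + cmod (z - z0) * (cmod (y0 t) * \<rho> t))"
        unfolding set_lebesgue_integral_def
      proof (rule integral_mono)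
        show "integrable ?M (\<lambda>t. indicator {..x} t *\<^sub>R (cmod (k t) * \<rho> t))"
          using ind[OF krho] unfolding set_integrable_def by simp
        show "integrable ?M (\<lambda>t. indicator {..x} t *\<^sub>R (L * (g t * (\<rho> t)\<^sup>2) + cmod (z - z0) * (cmod (y0 t) * \<rho> t)))"
          using ind[of "\<lambda>t. L * (g t * (\<rho> t)\<^sup>2) + cmod (z - z0) * (cmod (y0 t) * \<rho> t)" "{..x}"] grint y0int
          unfolding set_integrable_def by simp
        fix t assume "t \<in> space ?M"
        then have t: "t \<in> sl_int S" by simp
        have "cmod (y t - y0 t) \<le> cmod (d1 t) * cmod (u\<^sub>a t) + cmod (d2 t) * cmod (v\<^sub>a t)"
          unfolding ydiff[OF t] by (metis norm_mult norm_triangle_ineq4)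
        also have "\<dots> \<le> g t * \<rho> t"
        proof -
          have "0 \<le> cmod (d1 t) * cmod (v\<^sub>a t)" "0 \<le> cmod (d2 t) * cmod (u\<^sub>a t)" by simp_all
          then show ?thesis using t unfolding g_def \<rho>_def by (simp add: algebra_simps)
        qed
        finally have yd: "cmod (y t - y0 t) \<le> g t * \<rho> t" .
        have "cmod (k t) \<le> cmod (z - l0) * cmod (y t - y0 t) + cmod (z - z0) * cmod (y0 t)"
          unfolding k_def by (metis norm_mult norm_triangle_ineq)
        also have "\<dots> \<le> L * (g t * \<rho> t) + cmod (z - z0) * cmod (y0 t)"
          using yd zL L by (intro add_mono mult_mono) auto
        finally have "cmod (k t) * \<rho> t \<le> (L * (g t * \<rho> t) + cmod (z - z0) * cmod (y0 t)) * \<rho> t"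
          by (rule mult_right_mono) (rule \<rho>0)
        then show "indicator {..x} t *\<^sub>R (cmod (k t) * \<rho> t)
          \<le> indicator {..x} t *\<^sub>R (L * (g t * (\<rho> t)\<^sup>2) + cmod (z - z0) * (cmod (y0 t) * \<rho> t))"
          by (auto split: split_indicator simp: power2_eq_square algebra_simps)
      qed
      also have "\<dots> = L * (LINT t:{..x}|?M. g t * (\<rho> t)\<^sup>2) + cmod (z - z0) * (LINT t:{..x}|?M. cmod (y0 t) * \<rho> t)"
        by (subst set_integral_add(2)) (use ind[OF grint] ind[OF y0int] in auto)
      also have "\<dots> \<le> L * (LINT t:{..x}|?M. g t * (\<rho> t)\<^sup>2) + cmod (z - z0) * J"
        unfolding set_lebesgue_integral_def J_def
        by (intro add_left_mono mult_left_mono integral_mono[OF ind[OF y0int, unfolded set_integrable_def] y0int])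
          (auto simp: \<rho>0 split: split_indicator)
      finally show ?thesis unfolding gint by simp
    qed
    have "g x \<le> (cmod (z - z0) * J) * G"
      by (rule G(2)[OF gm g0 gbd _ main]) (use J in auto)
    then show "cmod (wronskian y Y v\<^sub>a V\<^sub>a x - wronskian y0 Y0 v\<^sub>a V\<^sub>a x) +
      cmod (wronskian y Y u\<^sub>a U\<^sub>a x - wronskian y0 Y0 u\<^sub>a U\<^sub>a x) \<le> J * G * cmod (z - z0)"
      using x by (simp add: g_def d1_def d2_def mult_ac)
  qed
qed

end

context sl_bvp
begin

text \<open>The functions \<open>u\<^sub>b\<close> and \<open>v\<^sub>b\<close> solve the same
  equation as \<open>u\<^sub>a\<close> and \<open>v\<^sub>a\<close>, so their mutual Wronskians are
  constants. A Wronskian with \<open>u\<^sub>b\<close> or \<open>v\<^sub>b\<close> is thus a fixed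
  linear combination of the two coefficients, and the bound, uniform in \<open>x\<close>, survives
  the limit at \<open>b\<close>.\<close>

lemma boundary_value_stability:
  assumes p0: "sl_pair S z0 y0 Y0" "y0 \<in> sl_L2 S"
  obtains C where "C \<ge> 0" "\<And>z y Y. sl_pair S z y Y \<Longrightarrow> y \<in> sl_L2 S \<Longrightarrow> a0 y Y = a0 y0 Y0 \<Longrightarrow>
      a1 y Y = a1 y0 Y0 \<Longrightarrow> cmod (z - z0) \<le> 1 \<Longrightarrow>
      cmod (b0 y Y - b0 y0 Y0) \<le> C * cmod (z - z0) \<and> cmod (b1 y Y - b1 y0 Y0) \<le> C * cmod (z - z0)"
proof -
  obtain C where C: "C \<ge> 0" "\<And>z y Y x. sl_pair S z y Y \<Longrightarrow> y \<in> sl_L2 S \<Longrightarrow> a0 y Y = a0 y0 Y0 \<Longrightarrow>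
      a1 y Y = a1 y0 Y0 \<Longrightarrow> cmod (z - z0) \<le> 1 \<Longrightarrow> x \<in> sl_int S \<Longrightarrow>
      cmod (wronskian y Y v\<^sub>a V\<^sub>a x - wronskian y0 Y0 v\<^sub>a V\<^sub>a x) +
      cmod (wronskian y Y u\<^sub>a U\<^sub>a x - wronskian y0 Y0 u\<^sub>a U\<^sub>a x) \<le> C * cmod (z - z0)"
    using coefficient_stability[OF p0] by blast
  have main: "cmod (wlim_b y Y v V - wlim_b y0 Y0 v V)
      \<le> (cmod (wlim_a u\<^sub>a U\<^sub>a v V) + cmod (wlim_a v\<^sub>a V\<^sub>a v V)) * C * cmod (z - z0)"
    if v: "sl_pair S (of_real l0) v V" "v \<in> sl_L2 S" and p: "sl_pair S z y Y" "y \<in> sl_L2 S"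
      and e: "a0 y Y = a0 y0 Y0" "a1 y Y = a1 y0 Y0" "cmod (z - z0) \<le> 1" for v V z y Y
  proof (rule tendsto_upperbound[OF _ _ at_b_neq_bot])
    show "((\<lambda>x. cmod ((wronskian y Y v V \<circ> real_of_ereal) x - (wronskian y0 Y0 v V \<circ> real_of_ereal) x))
       \<longlongrightarrow> cmod (wlim_b y Y v V - wlim_b y0 Y0 v V)) at_b"
      by (intro tendsto_norm tendsto_diff wronskian_tendsto_b[OF p v] wronskian_tendsto_b[OF p0 v])
    show "eventually (\<lambda>x. cmod ((wronskian y Y v V \<circ> real_of_ereal) x - (wronskian y0 Y0 v V \<circ> real_of_ereal) x)
      \<le> (cmod (wlim_a u\<^sub>a U\<^sub>a v V) + cmod (wlim_a v\<^sub>a V\<^sub>a v V)) * C * cmod (z - z0)) at_b"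
      using eventually_at_b
    proof eventually_elim
      case (elim x')
      define x where "x = real_of_ereal x'"
      have x: "x \<in> sl_int S" using elim by (simp add: x_def)
      let ?\<alpha> = "wlim_a u\<^sub>a U\<^sub>a v V" and ?\<beta> = "wlim_a v\<^sub>a V\<^sub>a v V"
      have ab: "wronskian u\<^sub>a U\<^sub>a v V x = ?\<alpha>" "wronskian v\<^sub>a V\<^sub>a v V x = ?\<beta>"
        using wronskian_eq[OF boundary_pairs(1) boundary_L2(1) v x]
          wronskian_eq[OF boundary_pairs(2) boundary_L2(2) v x] by simp_all
      have expand: "wronskian t T v V x = wronskian t T v\<^sub>a V\<^sub>a x * ?\<alpha> - wronskian t T u\<^sub>a U\<^sub>a x * ?\<beta>" for t T
        using wronskian_Pluecker[of t T v V x u\<^sub>a U\<^sub>a v\<^sub>a V\<^sub>a] wronskian_a[OF x]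
        unfolding ab[symmetric] by (simp add: wronskian_def algebra_simps)
      have "cmod (wronskian y Y v V x - wronskian y0 Y0 v V x)
        = cmod ((wronskian y Y v\<^sub>a V\<^sub>a x - wronskian y0 Y0 v\<^sub>a V\<^sub>a x) * ?\<alpha>
            - (wronskian y Y u\<^sub>a U\<^sub>a x - wronskian y0 Y0 u\<^sub>a U\<^sub>a x) * ?\<beta>)"
        unfolding expand by (simp add: algebra_simps)
      also have "\<dots> \<le> cmod (wronskian y Y v\<^sub>a V\<^sub>a x - wronskian y0 Y0 v\<^sub>a V\<^sub>a x) * cmod ?\<alpha>
            + cmod (wronskian y Y u\<^sub>a U\<^sub>a x - wronskian y0 Y0 u\<^sub>a U\<^sub>a x) * cmod ?\<beta>"
        unfolding norm_mult[symmetric] by (rule norm_triangle_ineq4)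
      also have "\<dots> \<le> (C * cmod (z - z0)) * cmod ?\<alpha> + (C * cmod (z - z0)) * cmod ?\<beta>"
      proof (intro add_mono mult_right_mono)
        show "cmod (wronskian y Y v\<^sub>a V\<^sub>a x - wronskian y0 Y0 v\<^sub>a V\<^sub>a x) \<le> C * cmod (z - z0)"
          using C(2)[OF p e x] norm_ge_zero[of "wronskian y Y u\<^sub>a U\<^sub>a x - wronskian y0 Y0 u\<^sub>a U\<^sub>a x"] by linarith
        show "cmod (wronskian y Y u\<^sub>a U\<^sub>a x - wronskian y0 Y0 u\<^sub>a U\<^sub>a x) \<le> C * cmod (z - z0)"
          using C(2)[OF p e x] norm_ge_zero[of "wronskian y Y v\<^sub>a V\<^sub>a x - wronskian y0 Y0 v\<^sub>a V\<^sub>a x"] by linarith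
      qed auto
      finally show ?case by (simp add: x_def algebra_simps)
    qed
  qed
  define C0 where "C0 = (cmod (wlim_a u\<^sub>a U\<^sub>a v\<^sub>b V\<^sub>b) + cmod (wlim_a v\<^sub>a V\<^sub>a v\<^sub>b V\<^sub>b)) * C"
  define C1 where "C1 = (cmod (wlim_a u\<^sub>a U\<^sub>a u\<^sub>b U\<^sub>b) + cmod (wlim_a v\<^sub>a V\<^sub>a u\<^sub>b U\<^sub>b)) * C"
  show thesis
  proof (rule that[of "max C0 C1"])
    show "max C0 C1 \<ge> 0" using C(1) by (simp add: C0_def le_max_iff_disj)
    fix z y Y
    assume a: "sl_pair S z y Y" "y \<in> sl_L2 S" "a0 y Y = a0 y0 Y0" "a1 y Y = a1 y0 Y0" "cmod (z - z0) \<le> 1"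
    have "cmod (b0 y Y - b0 y0 Y0) \<le> C0 * cmod (z - z0)"
      using main[OF boundary_pairs(4) boundary_L2(4) a] by (simp add: b0_def C0_def)
    moreover have "cmod (b1 y Y - b1 y0 Y0) \<le> C1 * cmod (z - z0)"
      using main[OF boundary_pairs(3) boundary_L2(3) a] by (simp add: b1_def C1_def norm_minus_commute)
    moreover have "C0 * cmod (z - z0) \<le> max C0 C1 * cmod (z - z0)" "C1 * cmod (z - z0) \<le> max C0 C1 * cmod (z - z0)"
      by (intro mult_right_mono; simp)+
    ultimately show "cmod (b0 y Y - b0 y0 Y0) \<le> max C0 C1 * cmod (z - z0) \<and>
        cmod (b1 y Y - b1 y0 Y0) \<le> max C0 C1 * cmod (z - z0)" by linarith
  qed
qed

end

section \<open>Boundary values of the fundamental system as functions of the spectral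
  parameter\<close>

locale sl_fundamental = sl_bvp +
  fixes u1 u2 :: "complex \<Rightarrow> real \<Rightarrow> complex"
  assumes fs: "fundamental_system S ua va u1 u2"
begin

definition "Af z = qd0_b S vb (u1 z)"
definition "Bf z = qd0_b S vb (u2 z)"
definition "Cf z = qd1_b S ub (u1 z)"
definition "Df z = qd1_b S ub (u2 z)"

abbreviation U1 where "U1 z \<equiv> qderiv S (u1 z)"
abbreviation U2 where "U2 z \<equiv> qderiv S (u2 z)"

lemma fundamental_solutions: "sl_solution S z (u1 z)" "sl_solution S z (u2 z)"
  using fs by (auto simp: fundamental_system_def)

lemma fundamental_pairs: "sl_pair S z (u1 z) (U1 z)" "sl_pair S z (u2 z) (U2 z)"
  "u1 z \<in> sl_L2 S" "u2 z \<in> sl_L2 S"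
  using fundamental_solutions by (auto intro: sl_pair_qderiv sl_solution_L2)

lemma fundamental_a:
  "a0 (u1 z) (U1 z) = 1" "a1 (u1 z) (U1 z) = 0" "a0 (u2 z) (U2 z) = 0" "a1 (u2 z) (U2 z) = 1"
  using fs by (auto simp: fundamental_system_def simp flip: qd_eq)

lemma fundamental_wronskian: "x \<in> sl_int S \<Longrightarrow> wronskian (u1 z) (U1 z) (u2 z) (U2 z) x = 1"
  using wronskian_same_parameter(1)[OF fundamental_pairs(1,3,2,4)] by (simp add: fundamental_a)

lemma boundary_determinant: "Af z * Df z - Cf z * Bf z = 1"
proof -
  obtain c where c: "c \<in> sl_int S" by (rule sl_int_nonempty)
  show ?thesis
    using wronskian_same_parameter(2)[OF fundamental_pairs(1,3,2,4) c, of z] fundamental_wronskian[OF c, of z]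
    by (simp add: Af_def Bf_def Cf_def Df_def qd_eq)
qed

lemma boundary_values_Lipschitz:
  obtains C where "C \<ge> 0" "\<And>z. cmod (z - z0) \<le> 1 \<Longrightarrow>
    cmod (Af z - Af z0) \<le> C * cmod (z - z0) \<and> cmod (Bf z - Bf z0) \<le> C * cmod (z - z0) \<and>
    cmod (Df z - Df z0) \<le> C * cmod (z - z0)"
proof -
  obtain C1 where C1: "C1 \<ge> 0" "\<And>z. cmod (z - z0) \<le> 1 \<Longrightarrow>
      cmod (Af z - Af z0) \<le> C1 * cmod (z - z0)"
    using boundary_value_stability[OF fundamental_pairs(1,3)[of z0]] fundamental_pairs(1,3) fundamental_a
    unfolding Af_def qd_eq by metis
  obtain C2 where C2: "C2 \<ge> 0" "\<And>z. cmod (z - z0) \<le> 1 \<Longrightarrow>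
      cmod (Bf z - Bf z0) \<le> C2 * cmod (z - z0) \<and> cmod (Df z - Df z0) \<le> C2 * cmod (z - z0)"
    using boundary_value_stability[OF fundamental_pairs(2,4)[of z0]] fundamental_pairs(2,4) fundamental_a
    unfolding Bf_def Df_def qd_eq by metis
  show thesis
  proof (rule that[of "max C1 C2"])
    fix z assume "cmod (z - z0) \<le> 1"
    moreover have "C1 * cmod (z - z0) \<le> max C1 C2 * cmod (z - z0)" "C2 * cmod (z - z0) \<le> max C1 C2 * cmod (z - z0)"
      by (intro mult_right_mono; simp)+
    ultimately show "cmod (Af z - Af z0) \<le> max C1 C2 * cmod (z - z0) \<and>
      cmod (Bf z - Bf z0) \<le> max C1 C2 * cmod (z - z0) \<and>
      cmod (Df z - Df z0) \<le> max C1 C2 * cmod (z - z0)"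
      using C1(2)[of z] C2(2)[of z] by linarith
  qed (use C1 in simp)
qed

lemma boundary_values_continuous:
  "isCont Af z" "isCont Bf z" "isCont Df z"
proof -
  obtain C where C: "C \<ge> 0" "\<And>w. cmod (w - z) \<le> 1 \<Longrightarrow>
    cmod (Af w - Af z) \<le> C * cmod (w - z) \<and> cmod (Bf w - Bf z) \<le> C * cmod (w - z) \<and>
    cmod (Df w - Df z) \<le> C * cmod (w - z)"
    using boundary_values_Lipschitz by blast
  have "eventually (\<lambda>w. cmod (w - z) \<le> 1) (at z)"
    unfolding eventually_at by (intro exI[of _ 1]) (auto simp: dist_norm)
  then have ev: "eventually (\<lambda>w. cmod (Af w - Af z) \<le> C * cmod (w - z)) (at z)"
    "eventually (\<lambda>w. cmod (Bf w - Bf z) \<le> C * cmod (w - z)) (at z)"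
    "eventually (\<lambda>w. cmod (Df w - Df z) \<le> C * cmod (w - z)) (at z)"
    using C(2) by (auto elim: eventually_mono)
  have l: "((\<lambda>w. C * cmod (w - z)) \<longlongrightarrow> 0) (at z)"
    by (intro tendsto_eq_intros) auto
  have "((\<lambda>w. Af w - Af z) \<longlongrightarrow> 0) (at z)" "((\<lambda>w. Bf w - Bf z) \<longlongrightarrow> 0) (at z)"
    "((\<lambda>w. Df w - Df z) \<longlongrightarrow> 0) (at z)"
    using ev by (auto intro: Lim_null_comparison[OF _ l])
  then show "isCont Af z" "isCont Bf z" "isCont Df z"
    unfolding isCont_def by (simp_all add: LIM_zero_iff)
qed

lemma boundary_values_real:
  "Af (of_real l) \<in> \<real>" "Bf (of_real l) \<in> \<real>" "Df (of_real l) \<in> \<real>"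
proof -
  have *: "b0 y Y \<in> \<real> \<and> b1 y Y \<in> \<real>"
    if p: "sl_pair S (of_real l) y Y" "y \<in> sl_L2 S" and r: "a0 y Y \<in> \<real>" "a1 y Y \<in> \<real>" for y Y
  proof -
    obtain C where C: "C \<ge> 0" "\<And>z t T. sl_pair S z t T \<Longrightarrow> t \<in> sl_L2 S \<Longrightarrow> a0 t T = a0 y Y \<Longrightarrow>
      a1 t T = a1 y Y \<Longrightarrow> cmod (z - l) \<le> 1 \<Longrightarrow>
      cmod (b0 t T - b0 y Y) \<le> C * cmod (z - l) \<and> cmod (b1 t T - b1 y Y) \<le> C * cmod (z - l)"
      using boundary_value_stability[OF p] by blast
    have pc: "sl_pair S (of_real l) (\<lambda>x. cnj (y x)) (\<lambda>x. cnj (Y x))"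
      using sl_pair_cnj[OF p(1)] by simp
    have "(\<lambda>x. cnj (y x)) \<in> borel_measurable (sl_measure S)"
      by (intro continuous_measurable_sl continuous_on_cnj sl_pair_continuous(1)[OF p(1)])
    then have "(\<lambda>x. cnj (y x)) \<in> sl_L2 S" using p(2) by (simp add: sl_L2_def)
    \<comment> \<open>The conjugate has the same parameter and the same real data at
      \<open>a\<close>, so the stability estimate applies at distance zero.\<close>
    then have "cmod (cnj (b0 y Y) - b0 y Y) \<le> C * 0 \<and> cmod (cnj (b1 y Y) - b1 y Y) \<le> C * 0"
      using C(2)[OF pc] r by (simp add: a0_cnj[OF p] a1_cnj[OF p] b0_cnj[OF p] b1_cnj[OF p] Reals_cnj_iff)
    then show ?thesis by (simp add: Reals_cnj_iff)
  qed
  show "Af (of_real l) \<in> \<real>" "Bf (of_real l) \<in> \<real>" "Df (of_real l) \<in> \<real>"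
    using *[OF fundamental_pairs(1,3)] *[OF fundamental_pairs(2,4)]
    by (simp_all add: Af_def Bf_def Df_def qd_eq fundamental_a)
qed

text \<open>The condition at \<open>a\<close> makes an eigenfunction \<open>f\<close> equal to
  \<open>c * u2\<close>. Evaluating its Wronskians with \<open>u2\<close> and \<open>u1\<close> at
  \<open>b\<close> shows that \<open>b1 f\<close> times \<open>Bf z\<close> is 0 while
  \<open>b1 f\<close> times \<open>Af z\<close> is \<open>c\<close>, which is nonzero; hence
  \<open>Bf z = 0\<close>. Conversely \<open>u2\<close> is square-integrable for every z, and
  nonzero since its Wronskian with \<open>u1\<close> is 1.\<close>

lemma L_0_eigenvalue_iff: "z \<in> L_0_eigenvalues S va vb \<longleftrightarrow> Bf z = 0"
proof
  assume "z \<in> L_0_eigenvalues S va vb"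
  then obtain f where f: "(f, \<lambda>x. z * f x) \<in> L_0 S va vb" "\<not> (AE x in sl_measure S. f x = 0)"
    by (auto simp: L_0_eigenvalues_def L_0_eigenvector_def)
  then have sol: "sl_solution S z f" and a: "qd0_a S va f = 0" and b: "qd0_b S vb f = 0"
    by (auto simp: L_0_def L_max_def sl_solution_def)
  have p: "sl_pair S z f (qderiv S f)" "f \<in> sl_L2 S"
    using sol by (auto intro: sl_pair_qderiv sl_solution_L2)
  define c where "c = a1 f (qderiv S f)"
  have a0: "a0 f (qderiv S f) = 0" and b0: "b0 f (qderiv S f) = 0" using a b by (simp_all add: qd_eq)
  have w2: "wronskian f (qderiv S f) (u2 z) (U2 z) x = 0" and w1: "wronskian f (qderiv S f) (u1 z) (U1 z) x = - c"
    if "x \<in> sl_int S" for x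
    using wronskian_same_parameter(1)[OF p fundamental_pairs(2,4) that]
      wronskian_same_parameter(1)[OF p fundamental_pairs(1,3) that]
    by (simp_all add: fundamental_a a0 c_def)
  have fx: "f x = c * u2 z x" if "x \<in> sl_int S" for x
    using wronskian_expand(1)[OF fundamental_wronskian[OF that], of f "qderiv S f" z] w1[OF that] w2[OF that]
    by simp
  have "c \<noteq> 0"
  proof
    assume "c = 0"
    then have "AE x in sl_measure S. f x = 0" by (intro AE_I2) (simp add: fx)
    then show False using f(2) by simp
  qed
  moreover obtain x where x: "x \<in> sl_int S" by (rule sl_int_nonempty)
  have "wronskian f (qderiv S f) (u2 z) (U2 z) x = - b1 f (qderiv S f) * Bf z"
    using wronskian_same_parameter(2)[OF p fundamental_pairs(2,4) x] b0 by (simp add: Bf_def qd_eq)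
  then have "b1 f (qderiv S f) * Bf z = 0" using w2[OF x] by simp
  moreover have "b1 f (qderiv S f) * Af z = c"
    using wronskian_same_parameter(2)[OF p fundamental_pairs(1,3) x] b0 w1[OF x] by (simp add: Af_def qd_eq)
  ultimately show "Bf z = 0" by auto
next
  assume B: "Bf z = 0"
  have "\<not> (AE x in sl_measure S. u2 z x = 0)"
  proof
    assume "AE x in sl_measure S. u2 z x = 0"
    then have "AE x in lebesgue_on (sl_int S). 0 < ennreal (sl_w S x) \<longrightarrow> u2 z x = 0"
      unfolding sl_measure_def by (subst (asm) AE_density) simp_all
    then have "AE x in lebesgue_on (sl_int S). u2 z x = 0"
      using AE_sl_w_pos by eventually_elim simp
    then have z: "u2 z x = 0" if "x \<in> sl_int S" for x
      using continuous_AE_zero[OF sl_pair_continuous(1)[OF fundamental_pairs(2)]] that by blast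
    have "sl_pair S z (\<lambda>x. 0) (\<lambda>x. 0)"
      by (simp add: sl_pair_def AC_loc_def abs_cont_on_def)
    then have U: "U2 z x = 0" if "x \<in> sl_int S" for x
      using sl_pair_unique[OF fundamental_pairs(2)] z that by blast
    obtain x where x: "x \<in> sl_int S" by (rule sl_int_nonempty)
    show False using fundamental_wronskian[OF x, of z] z[OF x] U[OF x] by (simp add: wronskian_def)
  qed
  moreover have "(u2 z, \<lambda>x. z * u2 z x) \<in> L_0 S va vb"
    using fundamental_pairs(4)[of z] fundamental_solutions(2)[of z] B fs
    by (auto simp: L_0_def L_max_def sl_L2_def norm_mult power_mult_distrib sl_solution_def Bf_def fundamental_system_def)
  ultimately show "z \<in> L_0_eigenvalues S va vb"
    by (auto simp: L_0_eigenvalues_def L_0_eigenvector_def)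
qed

end

section \<open>Matrix-valued measures\<close>

text \<open>The trace, the diagonal entries and the polarised forms of a matrix measure are all of
  this kind: real, nonnegative and additive, with values that count on bounded sets only. Extension
  and densities are thus treated once.\<close>

locale bounded_premeasure =
  fixes \<phi> :: "real set \<Rightarrow> real"
  assumes nonneg: "\<And>B. B \<in> sets borel \<Longrightarrow> bounded B \<Longrightarrow> 0 \<le> \<phi> B"
    and sums: "\<And>A::nat \<Rightarrow> real set. range A \<subseteq> sets borel \<Longrightarrow> disjoint_family A \<Longrightarrow> bounded (\<Union>i. A i) \<Longrightarrow>
        (\<lambda>i. \<phi> (A i)) sums \<phi> (\<Union>i. A i)"
begin

definition extension :: "real measure" where
  "extension = measure_of UNIV (sets borel) (\<lambda>B. SUP n::nat. ennreal (\<phi> (B \<inter> {- real n..real n})))"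

lemma empty: "\<phi> {} = 0"
proof -
  have "(\<lambda>i::nat. \<phi> {}) sums \<phi> (\<Union>i::nat. {})"
    by (rule sums) (auto simp: disjoint_family_on_def)
  then show ?thesis by (simp add: sums_iff summable_const_iff)
qed

lemma union:
  assumes "A \<in> sets borel" "B \<in> sets borel" "bounded A" "bounded B" "A \<inter> B = {}"
  shows "\<phi> (A \<union> B) = \<phi> A + \<phi> B"
proof -
  have "(\<lambda>i. \<phi> (binaryset A B i)) sums \<phi> (\<Union>i. binaryset A B i)"
    by (rule sums) (use assms in \<open>auto simp: range_binaryset_eq UN_binaryset_eq disjoint_family_on_def binaryset_def\<close>)
  moreover have "(\<lambda>i. \<phi> (binaryset A B i)) sums (\<phi> A + \<phi> B)"
    by (rule binaryset_sums) (rule empty)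
  ultimately show ?thesis by (simp add: UN_binaryset_eq sums_unique2)
qed

lemma mono:
  assumes "A \<in> sets borel" "B \<in> sets borel" "bounded B" "A \<subseteq> B"
  shows "\<phi> A \<le> \<phi> B"
proof -
  have "bounded A" "bounded (B - A)" using assms(3,4) by (auto intro: bounded_subset)
  then have "\<phi> (A \<union> (B - A)) = \<phi> A + \<phi> (B - A)" "0 \<le> \<phi> (B - A)"
    by (intro union nonneg; use assms in auto)+
  moreover have "A \<union> (B - A) = B" using assms(4) by blast
  ultimately show ?thesis by simp
qed

lemma sets_extension [simp, measurable_cong]: "sets extension = sets borel"
  by (simp add: extension_def sigma_algebra.sets_measure_of_eq[OF sets.sigma_algebra_axioms[of borel, simplified]])

lemma space_extension [simp]: "space extension = UNIV"
  by (simp add: extension_def)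

lemma incseq_cut:
  assumes "B \<in> sets borel"
  shows "incseq (\<lambda>n::nat. ennreal (\<phi> (B \<inter> {- real n..real n})))"
  unfolding incseq_def
  by (intro allI impI ennreal_leI mono) (use assms in \<open>auto intro: bounded_subset\<close>)

text \<open>Countable additivity follows by exchanging sum and supremum, since the cuts to
  \<open>{- real n..real n}\<close> increase with \<open>n\<close>.\<close>

lemma emeasure_extension:
  assumes B: "B \<in> sets borel"
  shows "emeasure extension B = (SUP n::nat. ennreal (\<phi> (B \<inter> {- real n..real n})))"
  unfolding extension_def
proof (rule emeasure_measure_of_sigma)
  show "sigma_algebra UNIV (sets (borel::real measure))"
    using sets.sigma_algebra_axioms[of "borel::real measure"] by simp
  show "positive (sets borel) (\<lambda>B. SUP n::nat. ennreal (\<phi> (B \<inter> {- real n..real n})))"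
    by (simp add: positive_def empty)
  show "countably_additive (sets borel) (\<lambda>B. SUP n::nat. ennreal (\<phi> (B \<inter> {- real n..real n})))"
  proof (rule countably_additiveI)
    fix A :: "nat \<Rightarrow> real set"
    assume A: "range A \<subseteq> sets borel" "disjoint_family A"
    then have Ai: "A i \<in> sets borel" for i by auto
    have "(\<Sum>i. SUP n::nat. ennreal (\<phi> (A i \<inter> {- real n..real n})))
        = (SUP n::nat. \<Sum>i. ennreal (\<phi> (A i \<inter> {- real n..real n})))"
      by (rule ennreal_suminf_SUP_eq) (rule incseq_cut[OF Ai])
    also have "\<dots> = (SUP n::nat. ennreal (\<phi> ((\<Union>i. A i) \<inter> {- real n..real n})))"
    proof (rule SUP_cong[OF refl])
      fix n :: nat
      let ?K = "{- real n..real n}"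
      have "(\<lambda>i. \<phi> (A i \<inter> ?K)) sums \<phi> (\<Union>i. A i \<inter> ?K)"
      proof (rule sums)
        show "disjoint_family (\<lambda>i. A i \<inter> ?K)" using A(2) by (auto simp: disjoint_family_on_def)
        show "bounded (\<Union>i. A i \<inter> ?K)" by (rule bounded_subset[of ?K]) auto
      qed (use Ai in auto)
      moreover have "0 \<le> \<phi> (A i \<inter> ?K)" for i using Ai by (auto intro!: nonneg intro: bounded_subset)
      ultimately show "(\<Sum>i. ennreal (\<phi> (A i \<inter> ?K))) = ennreal (\<phi> ((\<Union>i. A i) \<inter> ?K))"
        by (subst suminf_ennreal2) (auto simp: sums_iff)
    qed
    finally show "(\<Sum>i. SUP n::nat. ennreal (\<phi> (A i \<inter> {- real n..real n})))
        = (SUP n::nat. ennreal (\<phi> ((\<Union>i. A i) \<inter> {- real n..real n})))" .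
  qed
qed (rule B)

lemma emeasure_bounded:
  assumes B: "B \<in> sets borel" "bounded B"
  shows "emeasure extension B = ennreal (\<phi> B)"
proof -
  obtain b where b: "\<And>x. x \<in> B \<Longrightarrow> \<bar>x\<bar> \<le> b" using B(2) by (auto simp: bounded_iff)
  obtain N :: nat where N: "b \<le> real N" using real_arch_simple by blast
  have "x \<in> {- real N..real N}" if "x \<in> B" for x using b[OF that] N by auto
  then have "B \<inter> {- real N..real N} = B" by blast
  then have "ennreal (\<phi> B) \<le> (SUP n::nat. ennreal (\<phi> (B \<inter> {- real n..real n})))"
    by (metis (no_types, lifting) SUP_upper UNIV_I)
  moreover have "(SUP n::nat. ennreal (\<phi> (B \<inter> {- real n..real n}))) \<le> ennreal (\<phi> B)"
    by (intro SUP_least ennreal_leI mono) (use B in auto)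
  ultimately show ?thesis using emeasure_extension[OF B(1)] by simp
qed

lemma measure_bounded:
  assumes B: "B \<in> sets borel" "bounded B"
  shows "measure extension B = \<phi> B"
  using emeasure_bounded[OF B] nonneg[OF B] by (simp add: measure_def)

sublocale extension: sigma_finite_measure extension
proof
  show "\<exists>A. countable A \<and> A \<subseteq> sets extension \<and> \<Union>A = space extension \<and> (\<forall>a\<in>A. emeasure extension a \<noteq> \<infinity>)"
  proof (intro exI[of _ "range (\<lambda>n::nat. {- real n..real n})"] conjI)
    show "\<Union>(range (\<lambda>n::nat. {- real n..real n})) = space extension"
    proof -
      have "\<exists>n::nat. x \<in> {- real n..real n}" for x
      proof -
        obtain n :: nat where "\<bar>x\<bar> \<le> real n" using real_arch_simple by blast
        then have "x \<in> {- real n..real n}" by auto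
        then show ?thesis ..
      qed
      then show ?thesis by auto
    qed
  qed (auto simp: emeasure_bounded)
qed

text \<open>The test sets are the bounded cuts of the set where \<open>g\<close> is negative: the
  integral over such a cut is both nonpositive and nonnegative.\<close>

lemma AE_nonneg_if_set_integrals_nonneg:
  fixes g :: "real \<Rightarrow> real"
  assumes g: "g \<in> borel_measurable borel"
    and int: "\<And>B. B \<in> sets borel \<Longrightarrow> bounded B \<Longrightarrow> set_integrable extension B g"
    and nn: "\<And>B. B \<in> sets borel \<Longrightarrow> bounded B \<Longrightarrow> 0 \<le> (LINT s:B|extension. g s)"
  shows "AE s in extension. 0 \<le> g s"
proof -
  have "AE s in extension. s \<in> {- real n..real n} \<longrightarrow> 0 \<le> g s" for n :: nat
  proof -
    define B where "B = {s. g s < 0} \<inter> {- real n..real n}"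
    have B: "B \<in> sets borel" "bounded B"
      using g unfolding B_def by (measurable, auto intro: bounded_subset)
    have i: "integrable extension (\<lambda>s. indicator B s * - g s)"
      using int[OF B] unfolding set_integrable_def by simp
    have p: "0 \<le> indicator B s * - g s" for s by (auto simp: B_def indicator_def)
    have "(LINT s|extension. indicator B s * - g s) \<le> 0"
      using nn[OF B] by (simp add: set_lebesgue_integral_def)
    moreover have "0 \<le> (LINT s|extension. indicator B s * - g s)"
      by (rule integral_nonneg_AE) (use p in simp)
    ultimately have "(LINT s|extension. indicator B s * - g s) = 0" by linarith
    then have "AE s in extension. indicator B s * - g s = 0"
      using integral_nonneg_eq_0_iff_AE[OF i] p by simp
    then show ?thesis by eventually_elim (auto simp: B_def indicator_def split: if_splits)
  qed
  then have "AE s in extension. \<forall>n::nat. s \<in> {- real n..real n} \<longrightarrow> 0 \<le> g s"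
    by (subst AE_all_countable) blast
  then show ?thesis
  proof eventually_elim
    case (elim s)
    obtain n :: nat where "\<bar>s\<bar> \<le> real n" using real_arch_simple by blast
    then have "s \<in> {- real n..real n}" by auto
    then show ?case using elim by blast
  qed
qed

text \<open>Radon-Nikodym for the extensions. Absolute continuity is assumed on bounded sets only
  and passes to the extensions because both are suprema over bounded cuts.\<close>

lemma exists_density:
  assumes "bounded_premeasure \<psi>"
    and ac: "\<And>B. B \<in> sets borel \<Longrightarrow> bounded B \<Longrightarrow> \<phi> B = 0 \<Longrightarrow> \<psi> B = 0"
  obtains h :: "real \<Rightarrow> real" where "h \<in> borel_measurable borel"
    "\<And>B. B \<in> sets borel \<Longrightarrow> bounded B \<Longrightarrow> set_integrable extension B h \<and> (LINT s:B|extension. h s) = \<psi> B"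
proof -
  interpret \<psi>: bounded_premeasure \<psi> by fact
  have "absolutely_continuous extension \<psi>.extension"
    unfolding absolutely_continuous_def
  proof
    fix B assume "B \<in> null_sets extension"
    then have B: "B \<in> sets borel" and z: "emeasure extension B = 0" by (auto simp: null_sets_def)
    have K: "B \<inter> {- real n..real n} \<in> sets borel" "bounded (B \<inter> {- real n..real n})" for n
      using B by (auto intro: bounded_subset)
    have "ennreal (\<phi> (B \<inter> {- real n..real n})) \<le> 0" for n :: nat
      unfolding z[symmetric] emeasure_extension[OF B] by (rule SUP_upper) simp
    then have "ennreal (\<phi> (B \<inter> {- real n..real n})) = 0" for n :: nat by simp
    then have "\<phi> (B \<inter> {- real n..real n}) = 0" for n :: nat
      using nonneg[OF K] by (metis ennreal_eq_0_iff order_antisym)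
    then have "\<psi> (B \<inter> {- real n..real n}) = 0" for n :: nat using ac[OF K] by blast
    then show "B \<in> null_sets \<psi>.extension"
      using B by (simp add: null_sets_def \<psi>.emeasure_extension)
  qed
  then obtain f where f: "f \<in> borel_measurable extension" "density extension f = \<psi>.extension"
    using extension.Radon_Nikodym[of \<psi>.extension] by auto
  have fm[measurable]: "f \<in> borel_measurable borel" using f(1) by simp
  show thesis
  proof (rule that[of "\<lambda>s. enn2real (f s)"])
    show "(\<lambda>s. enn2real (f s)) \<in> borel_measurable borel" by simp
    fix B :: "real set" assume B: "B \<in> sets borel" "bounded B"
    have n: "(\<integral>\<^sup>+s. f s * indicator B s \<partial>extension) = ennreal (\<psi> B)"
      using f B \<psi>.emeasure_bounded[OF B] by (metis emeasure_density sets_extension)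
    \<comment> \<open>The integral over \<open>B\<close> is finite, so \<open>f\<close> is finite
      almost everywhere on \<open>B\<close> and \<open>enn2real\<close> does not change the
      integral.\<close>
    then have "AE s in extension. f s * indicator B s \<noteq> \<infinity>"
      by (intro nn_integral_noteq_infinite) (use B f in auto)
    then have "AE s in extension. ennreal (indicator B s * enn2real (f s)) = f s * indicator B s"
      by eventually_elim (auto simp: indicator_def less_top split: if_splits)
    then have "(\<integral>\<^sup>+s. ennreal (indicator B s * enn2real (f s)) \<partial>extension) = ennreal (\<psi> B)"
      unfolding n[symmetric] by (rule nn_integral_cong_AE)
    then have "integrable extension (\<lambda>s. indicator B s * enn2real (f s)) \<and>
        (LINT s|extension. indicator B s * enn2real (f s)) = \<psi> B"
      by (subst (asm) nn_integral_eq_integrable) (use B \<psi>.nonneg[OF B] in auto)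
    then show "set_integrable extension B (\<lambda>s. enn2real (f s)) \<and>
        (LINT s:B|extension. enn2real (f s)) = \<psi> B"
      by (simp add: set_integrable_def set_lebesgue_integral_def)
  qed
qed

end

text \<open>The diagonal is tested at the unit vectors, the off-diagonal entry at (1, 1), (1, -1),
  (1, i) and (1, -i).\<close>

lemma cmat_psd_entries:
  fixes A :: "complex^2^2"
  assumes "cmat_psd A"
  shows "Im (A $ 1 $ 1) = 0" "Im (A $ 2 $ 2) = 0" "A $ 2 $ 1 = cnj (A $ 1 $ 2)"
    "0 \<le> Re (A $ 1 $ 1)" "0 \<le> Re (A $ 2 $ 2)"
    "2 * \<bar>Re (A $ 1 $ 2)\<bar> \<le> Re (A $ 1 $ 1) + Re (A $ 2 $ 2)"
    "2 * \<bar>Im (A $ 1 $ 2)\<bar> \<le> Re (A $ 1 $ 1) + Re (A $ 2 $ 2)"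
proof -
  have h: "A $ i $ j = cnj (A $ j $ i)" for i j
    using assms unfolding cmat_psd_def cmat_hermitian_def by blast
  show d1: "Im (A $ 1 $ 1) = 0" using arg_cong[OF h[of 1 1], of Im] by simp
  show d2: "Im (A $ 2 $ 2) = 0" using arg_cong[OF h[of 2 2], of Im] by simp
  show o: "A $ 2 $ 1 = cnj (A $ 1 $ 2)" using h[of 2 1] .
  have q: "0 \<le> Re (cdot (A *v v) v)" for v using assms by (simp add: cmat_psd_def)
  note e = cdot_def matrix_vector_mult_def sum_2 o d1 d2
  show "0 \<le> Re (A $ 1 $ 1)" using q[of "vector [1, 0]"] by (simp add: e)
  show "0 \<le> Re (A $ 2 $ 2)" using q[of "vector [0, 1]"] by (simp add: e)
  show "2 * \<bar>Re (A $ 1 $ 2)\<bar> \<le> Re (A $ 1 $ 1) + Re (A $ 2 $ 2)"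
    using q[of "vector [1, 1]"] q[of "vector [1, -1]"] by (simp add: e abs_if)
  show "2 * \<bar>Im (A $ 1 $ 2)\<bar> \<le> Re (A $ 1 $ 1) + Re (A $ 2 $ 2)"
    using q[of "vector [1, \<i>]"] q[of "vector [1, -\<i>]"] by (simp add: e abs_if algebra_simps)
qed

lemma set_integral_Complex:
  fixes r m :: "'a \<Rightarrow> real"
  assumes "set_integrable M B r" "set_integrable M B m"
  shows "set_integrable M B (\<lambda>s. Complex (r s) (m s))"
    and "(LINT s:B|M. Complex (r s) (m s)) = Complex (LINT s:B|M. r s) (LINT s:B|M. m s)"
proof -
  have e: "indicator B s *\<^sub>R Complex (r s) (m s)
      = complex_of_real (indicator B s *\<^sub>R r s) + \<i> * complex_of_real (indicator B s *\<^sub>R m s)" for s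
    by (simp add: complex_eq_iff)
  show "set_integrable M B (\<lambda>s. Complex (r s) (m s))"
    using assms unfolding set_integrable_def e
    by (intro Bochner_Integration.integrable_add integrable_mult_right integrable_of_real)
  show "(LINT s:B|M. Complex (r s) (m s)) = Complex (LINT s:B|M. r s) (LINT s:B|M. m s)"
    using assms unfolding set_integrable_def set_lebesgue_integral_def e
    by (subst Bochner_Integration.integral_add) (auto simp: complex_eq_iff simp del: of_real_mult real_scaleR_def)
qed

section \<open>Densities of a matrix measure with respect to its trace\<close>

locale psd_matrix_measure =
  fixes \<mu> :: "real set \<Rightarrow> complex^2^2"
  assumes mm: "matrix_measure \<mu>"
begin

lemma psd: "B \<in> sets borel \<Longrightarrow> bounded B \<Longrightarrow> cmat_psd (\<mu> B)"
  using mm by (simp add: matrix_measure_def)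

lemma entry_sums:
  assumes "range A \<subseteq> sets borel" "disjoint_family A" "bounded (\<Union>i. A i)"
  shows "(\<lambda>n. \<mu> (A n) $ i $ j) sums (\<mu> (\<Union>i. A i) $ i $ j)"
proof -
  have "(\<lambda>n. \<mu> (A n)) sums \<mu> (\<Union>i. A i)" using mm assms unfolding matrix_measure_def by blast
  then have "(\<lambda>n. (\<Sum>k<n. \<mu> (A k)) $ i $ j) \<longlonglongrightarrow> \<mu> (\<Union>i. A i) $ i $ j"
    unfolding sums_def by (intro tendsto_vec_nth)
  then show ?thesis by (simp add: sums_def sum_component)
qed

sublocale tr: bounded_premeasure "\<lambda>B. Re (trace (\<mu> B))"
proof
  fix B :: "real set" assume "B \<in> sets borel" "bounded B"
  then show "0 \<le> Re (trace (\<mu> B))" using cmat_psd_entries[OF psd] by (simp add: trace_def sum_2)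
next
  fix A :: "nat \<Rightarrow> real set" assume A: "range A \<subseteq> sets borel" "disjoint_family A" "bounded (\<Union>i. A i)"
  show "(\<lambda>i. Re (trace (\<mu> (A i)))) sums Re (trace (\<mu> (\<Union>i. A i)))"
    unfolding trace_def sum_2 by (intro sums_Re sums_add entry_sums A)
qed

abbreviation \<tau> where "\<tau> \<equiv> trace_measure \<mu>"

lemma trace_measure_eq: "trace_measure \<mu> = tr.extension"
  by (simp add: trace_measure_def tr.extension_def)

lemma premeasures:
  "bounded_premeasure (\<lambda>B. Re (\<mu> B $ i $ i))"
  "bounded_premeasure (\<lambda>B. Re (\<mu> B $ 1 $ 1) + Re (\<mu> B $ 2 $ 2) + 2 * Re (\<mu> B $ 1 $ 2))"
  "bounded_premeasure (\<lambda>B. Re (\<mu> B $ 1 $ 1) + Re (\<mu> B $ 2 $ 2) + 2 * Im (\<mu> B $ 1 $ 2))"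
proof -
  show "bounded_premeasure (\<lambda>B. Re (\<mu> B $ i $ i))"
  proof
    show "0 \<le> Re (\<mu> B $ i $ i)" if "B \<in> sets borel" "bounded B" for B
      using cmat_psd_entries[OF psd[OF that]] exhaust_2[of i] by auto
  qed (intro sums_Re entry_sums)
  show "bounded_premeasure (\<lambda>B. Re (\<mu> B $ 1 $ 1) + Re (\<mu> B $ 2 $ 2) + 2 * Re (\<mu> B $ 1 $ 2))"
  proof
    show "0 \<le> Re (\<mu> B $ 1 $ 1) + Re (\<mu> B $ 2 $ 2) + 2 * Re (\<mu> B $ 1 $ 2)"
      if "B \<in> sets borel" "bounded B" for B
      using cmat_psd_entries(6)[OF psd[OF that]] by linarith
  qed (intro sums_add sums_mult sums_Re entry_sums)
  show "bounded_premeasure (\<lambda>B. Re (\<mu> B $ 1 $ 1) + Re (\<mu> B $ 2 $ 2) + 2 * Im (\<mu> B $ 1 $ 2))"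
  proof
    show "0 \<le> Re (\<mu> B $ 1 $ 1) + Re (\<mu> B $ 2 $ 2) + 2 * Im (\<mu> B $ 1 $ 2)"
      if "B \<in> sets borel" "bounded B" for B
      using cmat_psd_entries(7)[OF psd[OF that]] by linarith
  qed (intro sums_add sums_mult sums_Re sums_Im entry_sums)
qed

text \<open>The off-diagonal density comes from polarization: the forms at \<open>(1, 1)\<close> and \<open>(1, -\<i>)\<close> are
  positive measures as well.\<close>

lemma exists_matrix_density: "\<exists>W. is_matrix_density \<mu> W"
proof -
  have null: "Re (\<mu> B $ 1 $ 1) = 0" "Re (\<mu> B $ 2 $ 2) = 0" "Re (\<mu> B $ 1 $ 2) = 0" "Im (\<mu> B $ 1 $ 2) = 0"
    if "B \<in> sets borel" "bounded B" "Re (trace (\<mu> B)) = 0" for B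
    using cmat_psd_entries[OF psd[OF that(1,2)]] that(3) by (auto simp: trace_def sum_2)
  obtain h1 where h1: "h1 \<in> borel_measurable borel" "\<And>B. B \<in> sets borel \<Longrightarrow> bounded B \<Longrightarrow>
      set_integrable tr.extension B h1 \<and> (LINT s:B|tr.extension. h1 s) = Re (\<mu> B $ 1 $ 1)"
    using tr.exists_density[OF premeasures(1)[of 1]] null by blast
  obtain h2 where h2: "h2 \<in> borel_measurable borel" "\<And>B. B \<in> sets borel \<Longrightarrow> bounded B \<Longrightarrow>
      set_integrable tr.extension B h2 \<and> (LINT s:B|tr.extension. h2 s) = Re (\<mu> B $ 2 $ 2)"
    using tr.exists_density[OF premeasures(1)[of 2]] null by blast
  obtain h3 where h3: "h3 \<in> borel_measurable borel" "\<And>B. B \<in> sets borel \<Longrightarrow> bounded B \<Longrightarrow>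
      set_integrable tr.extension B h3 \<and> (LINT s:B|tr.extension. h3 s)
        = Re (\<mu> B $ 1 $ 1) + Re (\<mu> B $ 2 $ 2) + 2 * Re (\<mu> B $ 1 $ 2)"
    by (rule tr.exists_density[OF premeasures(2)]) (use null in auto)
  obtain h4 where h4: "h4 \<in> borel_measurable borel" "\<And>B. B \<in> sets borel \<Longrightarrow> bounded B \<Longrightarrow>
      set_integrable tr.extension B h4 \<and> (LINT s:B|tr.extension. h4 s)
        = Re (\<mu> B $ 1 $ 1) + Re (\<mu> B $ 2 $ 2) + 2 * Im (\<mu> B $ 1 $ 2)"
    by (rule tr.exists_density[OF premeasures(3)]) (use null in auto)
  note [measurable] = h1(1) h2(1) h3(1) h4(1)
  define r where "r s = (h3 s - (h1 s + h2 s)) / 2" for s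
  define m where "m s = (h4 s - (h1 s + h2 s)) / 2" for s
  have rm [measurable]: "r \<in> borel_measurable borel" "m \<in> borel_measurable borel"
    unfolding r_def[abs_def] m_def[abs_def] by measurable
  have r: "set_integrable tr.extension B r \<and> (LINT s:B|tr.extension. r s) = Re (\<mu> B $ 1 $ 2)"
    and m: "set_integrable tr.extension B m \<and> (LINT s:B|tr.extension. m s) = Im (\<mu> B $ 1 $ 2)"
    if "B \<in> sets borel" "bounded B" for B
    using h1(2)[OF that] h2(2)[OF that] h3(2)[OF that] h4(2)[OF that]
    by (auto simp: r_def[abs_def] m_def[abs_def])
  define W :: "real \<Rightarrow> complex^2^2" where
    "W s = vector [vector [Complex (h1 s) 0, Complex (r s) (m s)], vector [Complex (r s) (- m s), Complex (h2 s) 0]]" for s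
  have cm: "(\<lambda>s. Complex (f s) (g s)) \<in> borel_measurable borel"
    if "f \<in> borel_measurable borel" "g \<in> borel_measurable borel" for f g :: "real \<Rightarrow> real"
    using that unfolding borel_measurable_complex_iff by simp
  have "is_matrix_density \<mu> W"
    unfolding is_matrix_density_def
  proof (intro conjI allI impI)
    fix i j :: 2
    show "(\<lambda>s. W s $ i $ j) \<in> borel_measurable borel"
      using exhaust_2[of i] exhaust_2[of j] by (auto simp: W_def intro!: cm)
  next
    fix B :: "real set" and i j :: 2
    assume "B \<in> sets borel \<and> bounded B"
    then have B: "B \<in> sets borel" "bounded B" by auto
    have z: "set_integrable tr.extension B (\<lambda>s. 0::real)" by (simp add: set_integrable_def)
    note p = cmat_psd_entries(1-3)[OF psd[OF B]]
    have m': "set_integrable tr.extension B (\<lambda>s. - m s)" "(LINT s:B|tr.extension. - m s) = - Im (\<mu> B $ 1 $ 2)"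
      using m[OF B] by (auto simp: set_integrable_def set_lebesgue_integral_def)
    show "set_integrable \<tau> B (\<lambda>s. W s $ i $ j)"
      unfolding trace_measure_eq
      using exhaust_2[of i] exhaust_2[of j] h1(2)[OF B] h2(2)[OF B] r[OF B] m[OF B] m' z
      by (auto simp: W_def intro!: set_integral_Complex)
    show "\<mu> B $ i $ j = (LINT s:B|\<tau>. W s $ i $ j)"
      unfolding trace_measure_eq
      using exhaust_2[of i] exhaust_2[of j] h1(2)[OF B] h2(2)[OF B] r[OF B] m[OF B] m' z p
      by (auto simp: W_def set_integral_Complex complex_eq_iff)
  qed
  then show ?thesis by blast
qed

abbreviation W where "W \<equiv> matrix_density \<mu>"

lemma matrix_density: "is_matrix_density \<mu> W"
  unfolding matrix_density_def using exists_matrix_density by (rule someI_ex)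

lemma W_measurable [measurable]: "(\<lambda>s. W s $ i $ j) \<in> borel_measurable borel"
  using matrix_density by (simp add: is_matrix_density_def)

lemma W_set_integral:
  assumes "B \<in> sets borel" "bounded B"
  shows "set_integrable \<tau> B (\<lambda>s. W s $ i $ j)" "(LINT s:B|\<tau>. W s $ i $ j) = \<mu> B $ i $ j"
  using matrix_density assms by (auto simp: is_matrix_density_def)

lemma sets_tau [simp, measurable_cong]: "sets \<tau> = sets borel"
  by (simp add: trace_measure_eq)

lemma space_tau [simp]: "space \<tau> = UNIV"
  by (simp add: trace_measure_eq)

lemma measure_tau: "B \<in> sets borel \<Longrightarrow> bounded B \<Longrightarrow> measure \<tau> B = Re (trace (\<mu> B))"
  "B \<in> sets borel \<Longrightarrow> bounded B \<Longrightarrow> emeasure \<tau> B = ennreal (Re (trace (\<mu> B)))"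
  by (simp_all add: trace_measure_eq tr.measure_bounded tr.emeasure_bounded)

lemma entry_bounds:
  assumes "B \<in> sets borel" "bounded B"
  shows "\<bar>Re (\<mu> B $ i $ j)\<bar> \<le> Re (trace (\<mu> B))" "\<bar>Im (\<mu> B $ i $ j)\<bar> \<le> Re (trace (\<mu> B))"
  using exhaust_2[of i] exhaust_2[of j] cmat_psd_entries[OF psd[OF assms]]
  by (auto simp: trace_def sum_2)

text \<open>Transfers inequalities for the matrices of all bounded sets to the density, for any real
  affine functional of the entries; the constant term integrates to a multiple of the trace.
  Equalities follow by using a functional and its negative.\<close>

lemma AE_W_functional_nonneg:
  fixes \<Lambda> :: "complex^2^2 \<Rightarrow> real"
  assumes \<Lambda>: "\<And>A. \<Lambda> A = c + (\<Sum>i\<in>UNIV. \<Sum>j\<in>UNIV. p i j * Re (A $ i $ j) + q i j * Im (A $ i $ j))"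
    and nn: "\<And>B. B \<in> sets borel \<Longrightarrow> bounded B \<Longrightarrow>
      0 \<le> c * Re (trace (\<mu> B)) + (\<Sum>i\<in>UNIV. \<Sum>j\<in>UNIV. p i j * Re (\<mu> B $ i $ j) + q i j * Im (\<mu> B $ i $ j))"
  shows "AE s in \<tau>. 0 \<le> \<Lambda> (W s)"
proof -
  have *: "set_integrable \<tau> B (\<lambda>s. \<Lambda> (W s)) \<and> (LINT s:B|\<tau>. \<Lambda> (W s)) =
      c * Re (trace (\<mu> B)) + (\<Sum>i\<in>UNIV. \<Sum>j\<in>UNIV. p i j * Re (\<mu> B $ i $ j) + q i j * Im (\<mu> B $ i $ j))"
    if B: "B \<in> sets borel" "bounded B" for B
  proof -
    have re: "integrable \<tau> (\<lambda>s. indicator B s * Re (W s $ i $ j))" "(LINT s|\<tau>. indicator B s * Re (W s $ i $ j)) = Re (\<mu> B $ i $ j)"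
      and im: "integrable \<tau> (\<lambda>s. indicator B s * Im (W s $ i $ j))" "(LINT s|\<tau>. indicator B s * Im (W s $ i $ j)) = Im (\<mu> B $ i $ j)"
      for i j
      using integrable_Re[OF W_set_integral(1)[OF B, unfolded set_integrable_def]]
        integral_Re[OF W_set_integral(1)[OF B, unfolded set_integrable_def]]
        integrable_Im[OF W_set_integral(1)[OF B, unfolded set_integrable_def]]
        integral_Im[OF W_set_integral(1)[OF B, unfolded set_integrable_def]]
        W_set_integral(2)[OF B, unfolded set_lebesgue_integral_def] by simp_all
    have ib: "integrable \<tau> (\<lambda>s. indicator B s :: real)" "(LINT s|\<tau>. indicator B s) = Re (trace (\<mu> B))"
      using measure_tau[OF B] B by (auto simp: integrable_indicator_iff)
    have e: "indicator B s *\<^sub>R \<Lambda> (W s) = c * indicator B s + (\<Sum>i\<in>UNIV. \<Sum>j\<in>UNIV.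
        p i j * (indicator B s * Re (W s $ i $ j)) + q i j * (indicator B s * Im (W s $ i $ j)))" for s
      unfolding \<Lambda> by (simp add: sum_distrib_left algebra_simps)
    have I1: "integrable \<tau> (\<lambda>s. c * indicator B s)" using ib by simp
    have I2: "integrable \<tau> (\<lambda>s. p i j * (indicator B s * Re (W s $ i $ j)) + q i j * (indicator B s * Im (W s $ i $ j)))" for i j
      by (intro Bochner_Integration.integrable_add integrable_mult_right re im)
    have I3: "(LINT s|\<tau>. p i j * (indicator B s * Re (W s $ i $ j)) + q i j * (indicator B s * Im (W s $ i $ j)))
        = p i j * Re (\<mu> B $ i $ j) + q i j * Im (\<mu> B $ i $ j)" for i j
      by (subst Bochner_Integration.integral_add) (use re im in auto)
    show ?thesis
      unfolding set_integrable_def set_lebesgue_integral_def e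
      using I1 I2 ib by (simp add: Bochner_Integration.integral_sum I3)
  qed
  show ?thesis
    unfolding trace_measure_eq
  proof (rule tr.AE_nonneg_if_set_integrals_nonneg)
    show "(\<lambda>s. \<Lambda> (W s)) \<in> borel_measurable borel" unfolding \<Lambda> by measurable
  qed (use * nn in \<open>auto simp: trace_measure_eq\<close>)
qed

end

section \<open>Matrix-valued Herglotz functions\<close>

context psd_matrix_measure
begin

text \<open>The trace of a positive semidefinite matrix dominates the real and imaginary part of
  every entry, so those of the density are at most 1; the 2 is their sum.\<close>

lemma AE_W_bounded: "AE s in \<tau>. \<forall>i j. cmod (W s $ i $ j) \<le> 2"
proof -
  have re: "AE s in \<tau>. 0 \<le> 1 + \<sigma> * Re (W s $ i $ j)" and im: "AE s in \<tau>. 0 \<le> 1 + \<sigma> * Im (W s $ i $ j)"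
    if "\<sigma> = 1 \<or> \<sigma> = -1" for \<sigma> i j
  proof -
    have b: "0 \<le> 1 * Re (trace (\<mu> B)) + \<sigma> * Re (\<mu> B $ i $ j)" "0 \<le> 1 * Re (trace (\<mu> B)) + \<sigma> * Im (\<mu> B $ i $ j)"
      if "B \<in> sets borel" "bounded B" for B
      using entry_bounds[OF that, of i j] \<open>\<sigma> = 1 \<or> \<sigma> = -1\<close> by auto
    have ij: "(i = 1 \<or> i = 2) \<and> (j = 1 \<or> j = 2)" using exhaust_2 by blast
    show "AE s in \<tau>. 0 \<le> 1 + \<sigma> * Re (W s $ i $ j)"
      by (rule AE_W_functional_nonneg[of "\<lambda>A. 1 + \<sigma> * Re (A $ i $ j)" 1
            "\<lambda>a b. if a = i \<and> b = j then \<sigma> else 0" "\<lambda>_ _. 0"])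
        (use b ij in \<open>auto simp: sum_2\<close>)
    show "AE s in \<tau>. 0 \<le> 1 + \<sigma> * Im (W s $ i $ j)"
      by (rule AE_W_functional_nonneg[of "\<lambda>A. 1 + \<sigma> * Im (A $ i $ j)" 1
            "\<lambda>_ _. 0" "\<lambda>a b. if a = i \<and> b = j then \<sigma> else 0"])
        (use b ij in \<open>auto simp: sum_2\<close>)
  qed
  have "AE s in \<tau>. cmod (W s $ i $ j) \<le> 2" for i j
    using re[of 1 i j, simplified] re[of "-1" i j, simplified] im[of 1 i j, simplified] im[of "-1" i j, simplified]
  proof eventually_elim
    case (elim s)
    then show ?case using cmod_le[of "W s $ i $ j"] by linarith
  qed
  then have "AE s in \<tau>. \<forall>j. cmod (W s $ i $ j) \<le> 2" for i
    by (subst AE_all_countable) blast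
  then show ?thesis by (subst AE_all_countable) blast
qed

text \<open>The trace measure has density 1 with respect to itself.\<close>

lemma AE_W_trace: "AE s in \<tau>. W s $ 1 $ 1 + W s $ 2 $ 2 = 1"
proof -
  have e: "Re (trace (\<mu> B)) = Re (\<mu> B $ 1 $ 1) + Re (\<mu> B $ 2 $ 2)" for B by (simp add: trace_def sum_2)
  have i: "Im (\<mu> B $ 1 $ 1) = 0" "Im (\<mu> B $ 2 $ 2) = 0" if "B \<in> sets borel" "bounded B" for B
    using cmat_psd_entries[OF psd[OF that]] by auto
  have "AE s in \<tau>. 0 \<le> \<sigma> * (1 - (Re (W s $ 1 $ 1) + Re (W s $ 2 $ 2)))" for \<sigma>
    by (rule AE_W_functional_nonneg[of "\<lambda>A. \<sigma> * (1 - (Re (A $ 1 $ 1) + Re (A $ 2 $ 2)))" \<sigma>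
          "\<lambda>a b. if a = b then - \<sigma> else 0" "\<lambda>_ _. 0"])
      (auto simp: sum_2 e algebra_simps)
  from this[of 1] this[of "-1"]
  have "AE s in \<tau>. Re (W s $ 1 $ 1) + Re (W s $ 2 $ 2) = 1" by eventually_elim simp
  moreover have "AE s in \<tau>. 0 \<le> \<sigma> * (Im (W s $ 1 $ 1) + Im (W s $ 2 $ 2))" for \<sigma>
    by (rule AE_W_functional_nonneg[of "\<lambda>A. \<sigma> * (Im (A $ 1 $ 1) + Im (A $ 2 $ 2))" 0
          "\<lambda>_ _. 0" "\<lambda>a b. if a = b then \<sigma> else 0"])
      (auto simp: sum_2 i algebra_simps)
  from this[of 1] this[of "-1"]
  have "AE s in \<tau>. Im (W s $ 1 $ 1) + Im (W s $ 2 $ 2) = 0" by eventually_elim simp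
  ultimately show ?thesis by eventually_elim (simp add: complex_eq_iff)
qed

text \<open>The null intervals around points outside \<open>\<Lambda>\<close> may be uncountably
  many; by Lindelof countably many of them have the same union.\<close>

lemma AE_mem_if_locally_null:
  assumes "\<And>x. x \<notin> \<Lambda> \<Longrightarrow> \<exists>r>0. measure \<tau> {x - r..x + r} = 0"
  shows "AE s in \<tau>. s \<in> \<Lambda>"
proof -
  have "\<exists>r. x \<notin> \<Lambda> \<longrightarrow> r > 0 \<and> measure \<tau> {x - r..x + r} = 0" for x
    using assms[of x] by (cases "x \<in> \<Lambda>") auto
  then obtain r where r: "\<And>x. x \<notin> \<Lambda> \<Longrightarrow> r x > 0 \<and> measure \<tau> {x - r x..x + r x} = 0" by metis
  define \<F> where "\<F> = (\<lambda>x. {x - r x<..<x + r x}) ` (- \<Lambda>)"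
  have "\<And>S. S \<in> \<F> \<Longrightarrow> open S" by (auto simp: \<F>_def)
  then obtain \<F>' where F': "\<F>' \<subseteq> \<F>" "countable \<F>'" "\<Union>\<F>' = \<Union>\<F>" by (rule Lindelof)
  have "S \<in> null_sets \<tau>" if "S \<in> \<F>'" for S
  proof -
    have "S \<in> \<F>" using F'(1) that by blast
    then obtain x where x: "x \<notin> \<Lambda>" "S = {x - r x<..<x + r x}" by (auto simp: \<F>_def)
    have "emeasure \<tau> {x - r x..x + r x} = 0"
      using r[OF x(1)] by (simp add: measure_tau)
    then have "emeasure \<tau> S = 0"
      using emeasure_mono[of S "{x - r x..x + r x}" \<tau>] unfolding x(2) by force
    then show ?thesis by (simp add: null_sets_def x(2))
  qed
  then have "(\<Union>S\<in>\<F>'. S) \<in> null_sets \<tau>" by (intro null_sets_UN' F'(2))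
  moreover have "{s \<in> space \<tau>. s \<notin> \<Lambda>} \<subseteq> (\<Union>S\<in>\<F>'. S)"
  proof
    fix s assume "s \<in> {s \<in> space \<tau>. s \<notin> \<Lambda>}"
    then have "s \<in> {s - r s<..<s + r s}" "{s - r s<..<s + r s} \<in> \<F>" using r[of s] by (auto simp: \<F>_def)
    then have "s \<in> \<Union>\<F>" by blast
    then show "s \<in> (\<Union>S\<in>\<F>'. S)" using F'(3) by simp
  qed
  ultimately show ?thesis by (rule AE_I')
qed

end

section \<open>The kernel of the Herglotz representation\<close>

definition herglotz_kernel :: "complex \<Rightarrow> real \<Rightarrow> complex" where
  "herglotz_kernel z s = 1 / (of_real s - z) - of_real (s / (1 + s\<^sup>2))"

lemma one_plus_square_neq_0: "1 + (complex_of_real s)\<^sup>2 \<noteq> 0"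
proof -
  have "1 + (complex_of_real s)\<^sup>2 = complex_of_real (1 + s\<^sup>2)" by simp
  moreover have "1 + s\<^sup>2 \<noteq> 0" using zero_le_power2[of s] by linarith
  ultimately show ?thesis by (metis of_real_eq_0_iff)
qed

text \<open>Splits off \<open>1 / (1 + s^2)\<close>, the weight integrable against the trace
  measure; the remaining factor is bounded in \<open>s\<close>.\<close>

lemma herglotz_kernel_eq:
  assumes "Im z > 0"
  shows "herglotz_kernel z s = (z + (1 + z\<^sup>2) / (of_real s - z)) / of_real (1 + s\<^sup>2)"
proof -
  have "of_real s - z \<noteq> 0" using assms by (auto simp: complex_eq_iff)
  then show ?thesis
    using one_plus_square_neq_0[of s] unfolding herglotz_kernel_def
    by (simp add: divide_simps) (simp add: algebra_simps power2_eq_square)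
qed

lemma Im_le_dist_real: "0 < Im z \<Longrightarrow> Im z \<le> cmod (of_real s - z)"
  using abs_Im_le_cmod[of "of_real s - z"] by simp

lemma herglotz_kernel_bound:
  assumes z: "Im z > 0"
  shows "cmod (herglotz_kernel z s) \<le> (cmod z + cmod (1 + z\<^sup>2) / Im z) * (1 / (1 + s\<^sup>2))"
proof -
  have p: "1 + s\<^sup>2 > 0" using zero_le_power2[of s] by linarith
  have "cmod (z + (1 + z\<^sup>2) / (of_real s - z)) \<le> cmod z + cmod (1 + z\<^sup>2) / cmod (of_real s - z)"
    by (metis norm_divide norm_triangle_ineq)
  also have "\<dots> \<le> cmod z + cmod (1 + z\<^sup>2) / Im z"
    using Im_le_dist_real[OF z, of s] z by (intro add_left_mono divide_left_mono mult_pos_pos) auto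
  finally have "cmod (z + (1 + z\<^sup>2) / (of_real s - z)) / (1 + s\<^sup>2) \<le> (cmod z + cmod (1 + z\<^sup>2) / Im z) / (1 + s\<^sup>2)"
    using p by (intro divide_right_mono) auto
  then show ?thesis
    unfolding herglotz_kernel_eq[OF z] norm_divide norm_of_real using p by simp
qed

text \<open>This is pi times the Poisson kernel of the upper half-plane.\<close>

lemma Im_herglotz_kernel: "Im (herglotz_kernel z s) = Im z / ((s - Re z)\<^sup>2 + (Im z)\<^sup>2)"
  by (simp add: herglotz_kernel_def Im_divide)

lemma herglotz_kernel_measurable [measurable]: "herglotz_kernel z \<in> borel_measurable borel"
  unfolding herglotz_kernel_def[abs_def] by measurable

text \<open>Only the quotient \<open>- \<i> * S n / (s - l - \<i> * S n)\<close> matters: it is 1 at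
  \<open>s = l\<close> and tends to 0 elsewhere. The other terms carry a free factor
  \<open>S n\<close>.\<close>

lemma herglotz_kernel_at_atom:
  assumes S: "S \<longlonglongrightarrow> (0::real)" "\<And>n. 0 < S n"
  shows "(\<lambda>n. (- \<i> * of_real (S n)) * herglotz_kernel (Complex l (S n)) s) \<longlonglongrightarrow> indicator {l} s"
proof -
  have z: "(\<lambda>n. Complex l (S n)) \<longlonglongrightarrow> of_real l"
    using tendsto_Complex[OF tendsto_const S(1)] by (simp add: complex_of_real_def)
  have e: "(\<lambda>n. - \<i> * of_real (S n)) \<longlonglongrightarrow> 0"
    using tendsto_mult[OF tendsto_const tendsto_of_real[OF S(1)], of "- \<i>"] by simp
  have k: "(- \<i> * of_real (S n)) * herglotz_kernel (Complex l (S n)) s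
     = ((- \<i> * of_real (S n)) * Complex l (S n) + (1 + (Complex l (S n))\<^sup>2) *
        ((- \<i> * of_real (S n)) / (of_real s - Complex l (S n)))) / of_real (1 + s\<^sup>2)" for n
  proof -
    have *: "e * ((c + a / v) / q) = (e * c + a * (e / v)) / q" for e c a v q :: complex
      by (simp add: distrib_left mult.commute)
    have "Im (Complex l (S n)) > 0" using S(2)[of n] by simp
    from herglotz_kernel_eq[OF this, of s] show ?thesis by (simp only: *)
  qed
  have q: "(\<lambda>n. (- \<i> * of_real (S n)) / (of_real s - Complex l (S n))) \<longlonglongrightarrow> indicator {l} s"
  proof (cases "s = l")
    case True
    have "(- \<i> * of_real (S n)) / (of_real s - Complex l (S n)) = 1" for n
    proof -
      have "of_real s - Complex l (S n) = - \<i> * of_real (S n)"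
        using True by (simp add: complex_eq_iff)
      moreover have "- \<i> * of_real (S n) \<noteq> 0" using S(2)[of n] by simp
      ultimately show ?thesis by simp
    qed
    then show ?thesis using True by simp
  next
    case False
    then have "of_real s - of_real l \<noteq> 0" by simp
    from tendsto_divide[OF e tendsto_diff[OF tendsto_const z] this] show ?thesis using False by simp
  qed
  have "(\<lambda>n. ((- \<i> * of_real (S n)) * Complex l (S n) + (1 + (Complex l (S n))\<^sup>2) *
        ((- \<i> * of_real (S n)) / (of_real s - Complex l (S n)))) / of_real (1 + s\<^sup>2))
     \<longlonglongrightarrow> (0 * of_real l + (1 + (of_real l)\<^sup>2) * indicator {l} s) / of_real (1 + s\<^sup>2)"
    by (intro tendsto_divide tendsto_add tendsto_mult tendsto_power tendsto_const e z q)
      (use one_plus_square_neq_0[of s] in simp)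
  moreover have "(0 * complex_of_real l + (1 + (of_real l)\<^sup>2) * indicator {l} s) / of_real (1 + s\<^sup>2)
      = indicator {l} s"
    using one_plus_square_neq_0[of s] by (auto simp: indicator_def)
  ultimately show ?thesis unfolding k by simp
qed

section \<open>Recovering null intervals and atoms from boundary behaviour\<close>

locale matrix_herglotz =
  fixes M :: "complex \<Rightarrow> complex^2^2" and C D :: "complex^2^2" and \<mu> :: "real set \<Rightarrow> complex^2^2"
  assumes hr: "herglotz_representation M C D \<mu>"
begin

sublocale psd_matrix_measure \<mu>
  by unfold_locales (use hr in \<open>simp add: herglotz_representation_def\<close>)

lemma weight_integrable: "integrable \<tau> (\<lambda>s. 1 / (1 + s\<^sup>2))"
  using hr by (simp add: herglotz_representation_def)

lemma representation:
  assumes "Im z > 0"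
  shows "M z $ i $ j = C $ i $ j + D $ i $ j * z + (LINT s|\<tau>. herglotz_kernel z s * W s $ i $ j)"
  using hr assms by (simp add: herglotz_representation_def herglotz_kernel_def)

lemma kernel_integrable:
  assumes z: "Im z > 0"
  shows "integrable \<tau> (\<lambda>s. herglotz_kernel z s * W s $ i $ j)" "integrable \<tau> (herglotz_kernel z)"
proof -
  let ?K = "cmod z + cmod (1 + z\<^sup>2) / Im z"
  have K: "?K \<ge> 0" using z by simp
  have p: "1 + s\<^sup>2 > 0" for s :: real using zero_le_power2[of s] by linarith
  show "integrable \<tau> (\<lambda>s. herglotz_kernel z s * W s $ i $ j)"
  proof (rule Bochner_Integration.integrable_bound)
    show "integrable \<tau> (\<lambda>s. (?K * 2) * (1 / (1 + s\<^sup>2)))" using weight_integrable by (rule integrable_mult_right)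
    show "AE s in \<tau>. norm (herglotz_kernel z s * W s $ i $ j) \<le> norm ((?K * 2) * (1 / (1 + s\<^sup>2)))"
      using AE_W_bounded
    proof eventually_elim
      case (elim s)
      have "cmod (herglotz_kernel z s) * cmod (W s $ i $ j) \<le> (?K * (1 / (1 + s\<^sup>2))) * 2"
        using herglotz_kernel_bound[OF z, of s] elim p[of s] K by (intro mult_mono) auto
      then show ?case using p[of s] K by (simp add: norm_mult mult_ac abs_mult)
    qed
  qed measurable
  show "integrable \<tau> (herglotz_kernel z)"
  proof (rule Bochner_Integration.integrable_bound)
    show "integrable \<tau> (\<lambda>s. ?K * (1 / (1 + s\<^sup>2)))" using weight_integrable by (rule integrable_mult_right)
    show "AE s in \<tau>. norm (herglotz_kernel z s) \<le> norm (?K * (1 / (1 + s\<^sup>2)))"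
    proof (rule AE_I2)
      fix s
      show "norm (herglotz_kernel z s) \<le> norm (?K * (1 / (1 + s\<^sup>2)))"
        using herglotz_kernel_bound[OF z, of s] abs_ge_self[of "?K * (1 / (1 + s\<^sup>2))"] by simp
    qed
  qed measurable
qed

text \<open>As the density has trace 1, the imaginary part of the trace of \<open>M\<close> is the
  integral of the kernel's imaginary part plus a nonnegative term from \<open>D\<close>. At height
  \<open>\<epsilon>\<close> that kernel is at least \<open>1 / (2 * \<epsilon>)\<close> within
  distance \<open>\<epsilon>\<close> of \<open>x\<close>.\<close>

lemma interval_mass_bound:
  assumes \<epsilon>: "\<epsilon> > 0"
  shows "measure \<tau> {x - \<epsilon>..x + \<epsilon>} \<le> 2 * \<epsilon> * Im (M (Complex x \<epsilon>) $ 1 $ 1 + M (Complex x \<epsilon>) $ 2 $ 2)"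
proof -
  let ?z = "Complex x \<epsilon>"
  have z: "Im ?z > 0" using \<epsilon> by simp
  have "cmat_hermitian C" and D: "cmat_psd D" using hr by (simp_all add: herglotz_representation_def)
  then have Ch: "C $ i $ i = cnj (C $ i $ i)" for i unfolding cmat_hermitian_def by blast
  have C: "Im (C $ i $ i) = 0" for i using arg_cong[OF Ch[of i], of Im] by simp
  note D = cmat_psd_entries[OF D]
  have "(LINT s|\<tau>. herglotz_kernel ?z s * W s $ 1 $ 1) + (LINT s|\<tau>. herglotz_kernel ?z s * W s $ 2 $ 2)
      = (LINT s|\<tau>. herglotz_kernel ?z s * W s $ 1 $ 1 + herglotz_kernel ?z s * W s $ 2 $ 2)"
    by (rule Bochner_Integration.integral_add[symmetric]) (intro kernel_integrable z)+
  also have "\<dots> = (LINT s|\<tau>. herglotz_kernel ?z s)"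
  proof (rule integral_cong_AE)
    show "AE s in \<tau>. herglotz_kernel ?z s * W s $ 1 $ 1 + herglotz_kernel ?z s * W s $ 2 $ 2 = herglotz_kernel ?z s"
      using AE_W_trace
    proof eventually_elim
      case (elim s)
      have "herglotz_kernel ?z s * W s $ 1 $ 1 + herglotz_kernel ?z s * W s $ 2 $ 2
          = herglotz_kernel ?z s * (W s $ 1 $ 1 + W s $ 2 $ 2)" by (simp add: distrib_left)
      then show ?case using elim by simp
    qed
  qed measurable
  finally have "M ?z $ 1 $ 1 + M ?z $ 2 $ 2
      = C $ 1 $ 1 + C $ 2 $ 2 + (D $ 1 $ 1 + D $ 2 $ 2) * ?z + (LINT s|\<tau>. herglotz_kernel ?z s)"
    using representation[OF z, of 1 1] representation[OF z, of 2 2] by (simp add: algebra_simps)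
  then have "Im (M ?z $ 1 $ 1 + M ?z $ 2 $ 2) = (Re (D $ 1 $ 1) + Re (D $ 2 $ 2)) * \<epsilon> + Im (LINT s|\<tau>. herglotz_kernel ?z s)"
    using C[of 1] C[of 2] D(1,2) by simp
  moreover have "(Re (D $ 1 $ 1) + Re (D $ 2 $ 2)) * \<epsilon> \<ge> 0" using D(4,5) \<epsilon> by simp
  moreover have "Im (LINT s|\<tau>. herglotz_kernel ?z s) = (LINT s|\<tau>. Im (herglotz_kernel ?z s))"
    using kernel_integrable(2)[OF z] by simp
  moreover have "measure \<tau> {x - \<epsilon>..x + \<epsilon>} / (2 * \<epsilon>) \<le> (LINT s|\<tau>. Im (herglotz_kernel ?z s))"
  proof -
    have i: "integrable \<tau> (\<lambda>s. indicator {x - \<epsilon>..x + \<epsilon>} s * (1 / (2 * \<epsilon>)))"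
      by (intro integrable_mult_left) (simp add: integrable_indicator_iff measure_tau)
    have "measure \<tau> {x - \<epsilon>..x + \<epsilon>} / (2 * \<epsilon>) = (LINT s|\<tau>. indicator {x - \<epsilon>..x + \<epsilon>} s * (1 / (2 * \<epsilon>)))"
      by simp
    also have "\<dots> \<le> (LINT s|\<tau>. Im (herglotz_kernel ?z s))"
    proof (rule integral_mono[OF i])
      show "integrable \<tau> (\<lambda>s. Im (herglotz_kernel ?z s))" using kernel_integrable(2)[OF z] by (rule integrable_Im)
      fix s
      show "indicator {x - \<epsilon>..x + \<epsilon>} s * (1 / (2 * \<epsilon>)) \<le> Im (herglotz_kernel ?z s)"
      proof (cases "s \<in> {x - \<epsilon>..x + \<epsilon>}")
        case True
        then have "(s - x)\<^sup>2 \<le> \<epsilon>\<^sup>2" by (intro abs_le_square_iff[THEN iffD1]) auto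
        then have "(s - x)\<^sup>2 + \<epsilon>\<^sup>2 \<le> 2 * \<epsilon>\<^sup>2" by simp
        moreover have "0 < (s - x)\<^sup>2 + \<epsilon>\<^sup>2" using \<epsilon> by (simp add: add_nonneg_pos)
        ultimately have "\<epsilon> / (2 * \<epsilon>\<^sup>2) \<le> \<epsilon> / ((s - x)\<^sup>2 + \<epsilon>\<^sup>2)" using \<epsilon> by (intro divide_left_mono) auto
        then show ?thesis using True \<epsilon> by (simp add: Im_herglotz_kernel power2_eq_square)
      next
        case False
        then show ?thesis using \<epsilon> by (simp add: Im_herglotz_kernel)
      qed
    qed
    finally show ?thesis .
  qed
  ultimately have "measure \<tau> {x - \<epsilon>..x + \<epsilon>} / (2 * \<epsilon>) \<le> Im (M ?z $ 1 $ 1 + M ?z $ 2 $ 2)" by linarith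
  then show ?thesis using \<epsilon> by (simp add: field_simps)
qed

text \<open>A one-sided Stieltjes inversion. \<open>F\<close> extends the trace of \<open>M\<close>
  continuously to the real axis, where it is real; by uniform continuity its imaginary part is at
  most \<open>\<delta>\<close> at small height. Tiling the interval by pieces of half-width
  \<open>\<epsilon>\<close>, each of mass at most \<open>2 * \<epsilon> * \<delta>\<close>, bounds
  the total mass by \<open>2 * r * \<delta>\<close>.\<close>

lemma interval_null:
  assumes r: "r > 0" and cont: "continuous_on (cball (of_real x0) (2 * r)) F"
    and re: "\<And>x. \<bar>x - x0\<bar> \<le> r \<Longrightarrow> Im (F (of_real x)) = 0"
    and eq: "\<And>z. Im z > 0 \<Longrightarrow> z \<in> cball (of_real x0) (2 * r) \<Longrightarrow> M z $ 1 $ 1 + M z $ 2 $ 2 = F z"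
  shows "measure \<tau> {x0 - r..x0 + r} = 0"
proof -
  have "measure \<tau> {x0 - r..x0 + r} \<le> 2 * r * \<delta>" if \<delta>: "\<delta> > 0" for \<delta>
  proof -
    have "uniformly_continuous_on (cball (of_real x0) (2 * r)) F"
      using cont by (rule compact_uniformly_continuous) simp
    then obtain d where d: "d > 0" "\<And>z z'. z \<in> cball (of_real x0) (2 * r) \<Longrightarrow>
        z' \<in> cball (of_real x0) (2 * r) \<Longrightarrow> dist z' z < d \<Longrightarrow> dist (F z') (F z) < \<delta>"
      using \<delta> unfolding uniformly_continuous_on_def by metis
    have step: "measure \<tau> {x - \<epsilon>..x + \<epsilon>} \<le> 2 * \<epsilon> * \<delta>"
      if x: "\<bar>x - x0\<bar> \<le> r" and \<epsilon>: "0 < \<epsilon>" "\<epsilon> \<le> r" "\<epsilon> < d" for x \<epsilon>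
    proof -
      have "dist (complex_of_real x) (of_real x0) = \<bar>x - x0\<bar>"
        unfolding dist_of_real by (simp add: dist_real_def)
      moreover have dz: "dist (Complex x \<epsilon>) (of_real x) = \<epsilon>"
      proof -
        have "Complex x \<epsilon> - of_real x = \<i> * of_real \<epsilon>" by (simp add: complex_eq_iff)
        then show ?thesis using \<epsilon> by (simp add: dist_norm norm_mult)
      qed
      ultimately have "complex_of_real x \<in> cball (of_real x0) (2 * r)"
        "Complex x \<epsilon> \<in> cball (of_real x0) (2 * r)"
        using x \<epsilon> r dist_triangle[of "Complex x \<epsilon>" "of_real x0" "of_real x"]
        by (auto simp: dist_commute)
      then have "dist (F (Complex x \<epsilon>)) (F (of_real x)) < \<delta>"
        and Mz: "M (Complex x \<epsilon>) $ 1 $ 1 + M (Complex x \<epsilon>) $ 2 $ 2 = F (Complex x \<epsilon>)"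
        using d(2) dz \<epsilon> eq by auto
      then have "\<bar>Im (F (Complex x \<epsilon>) - F (of_real x))\<bar> < \<delta>"
        using abs_Im_le_cmod le_less_trans unfolding dist_norm by blast
      then have "Im (F (Complex x \<epsilon>)) \<le> \<delta>" using re[OF x] by simp
      then have "2 * \<epsilon> * Im (F (Complex x \<epsilon>)) \<le> 2 * \<epsilon> * \<delta>" using \<epsilon> by simp
      then show ?thesis using interval_mass_bound[OF \<epsilon>(1), of x] unfolding Mz by linarith
    qed
    obtain n :: nat where n: "r / d < real n" using reals_Archimedean2 by blast
    \<comment> \<open>The successor ensures \<open>N \<ge> 1\<close>, hence
      \<open>\<epsilon> \<le> r\<close>.\<close>
    define N where "N = Suc n"
    define \<epsilon> where "\<epsilon> = r / real N"
    have N: "real N > 0" "real N \<ge> 1" "r / d < real N" using n by (auto simp: N_def)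
    have \<epsilon>: "0 < \<epsilon>" "\<epsilon> \<le> r" "\<epsilon> < d" and rN: "r = real N * \<epsilon>"
      using N r d(1) by (auto simp: \<epsilon>_def field_simps)
    define c where "c j = x0 - r + (2 * real j + 1) * \<epsilon>" for j
    have c: "\<bar>c j - x0\<bar> \<le> r" if "j < N" for j
    proof -
      have "real j + 1 \<le> real N" using that by simp
      then have "(real j + 1) * \<epsilon> \<le> r" unfolding rN using \<epsilon> by (intro mult_right_mono) auto
      moreover have "0 \<le> real j * \<epsilon>" using \<epsilon> by simp
      ultimately show ?thesis unfolding c_def using \<epsilon> by (auto simp: algebra_simps abs_le_iff)
    qed
    have cover: "{x0 - r..x0 + r} \<subseteq> (\<Union>j\<in>{..<N}. {c j - \<epsilon>..c j + \<epsilon>})"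
    proof
      fix t assume t: "t \<in> {x0 - r..x0 + r}"
      define u where "u = (t - (x0 - r)) / (2 * \<epsilon>)"
      have "u * (2 * \<epsilon>) = t - (x0 - r)" using \<epsilon> by (simp add: u_def)
      then have tu: "t = x0 - r + u * (2 * \<epsilon>)" by linarith
      have u: "0 \<le> u" "u \<le> real N" using t \<epsilon> rN by (auto simp: u_def field_simps)
      obtain j where j: "j < N" "real j \<le> u" "u \<le> real j + 1"
      proof (cases "u < real N")
        case True
        have "real (nat \<lfloor>u\<rfloor>) \<le> u" "u \<le> real (nat \<lfloor>u\<rfloor>) + 1" using u(1) by linarith+
        moreover then have "nat \<lfloor>u\<rfloor> < N" using True by (metis le_less_trans of_nat_less_iff)
        ultimately show thesis using that by blast
      next
        case False
        \<comment> \<open>Only the right endpoint is left, where \<open>u = N\<close>; it belongs to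
          the last piece, whose index is \<open>n = N - 1\<close>.\<close>
        then show thesis using that[of n] u by (auto simp: N_def)
      qed
      have "real j * (2 * \<epsilon>) \<le> u * (2 * \<epsilon>)" "u * (2 * \<epsilon>) \<le> (real j + 1) * (2 * \<epsilon>)"
        using j \<epsilon> by (intro mult_right_mono; simp)+
      then have "t \<in> {c j - \<epsilon>..c j + \<epsilon>}" by (simp add: tu c_def algebra_simps)
      then show "t \<in> (\<Union>j\<in>{..<N}. {c j - \<epsilon>..c j + \<epsilon>})" using j(1) by blast
    qed
    have "measure \<tau> {x0 - r..x0 + r} \<le> measure \<tau> (\<Union>j\<in>{..<N}. {c j - \<epsilon>..c j + \<epsilon>})"
    proof (rule measure_mono_fmeasurable[OF cover])
      have "bounded (\<Union>j\<in>{..<N}. {c j - \<epsilon>..c j + \<epsilon>})" by (intro bounded_UN) auto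
      then show "(\<Union>j\<in>{..<N}. {c j - \<epsilon>..c j + \<epsilon>}) \<in> fmeasurable \<tau>"
        by (intro fmeasurableI) (auto simp: measure_tau)
    qed auto
    also have "\<dots> \<le> (\<Sum>j\<in>{..<N}. measure \<tau> {c j - \<epsilon>..c j + \<epsilon>})" by (rule measure_UNION_le) auto
    also have "\<dots> \<le> (\<Sum>j\<in>{..<N}. 2 * \<epsilon> * \<delta>)" by (intro sum_mono step \<epsilon> c) auto
    also have "\<dots> = 2 * r * \<delta>" by (simp add: rN)
    finally show ?thesis .
  qed
  then have "measure \<tau> {x0 - r..x0 + r} \<le> e" if "e > 0" for e
    using that r by (metis (no_types, opaque_lifting) divide_pos_pos mult_pos_pos nonzero_mult_div_cancel_left
      order_less_irrefl times_divide_eq_right zero_less_numeral)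
  then have "measure \<tau> {x0 - r..x0 + r} \<le> 0" by (rule field_le_epsilon[of _ 0, simplified])
  then show ?thesis by (simp add: measure_le_0_iff)
qed

text \<open>Dominated convergence under the integral of the representation: the scaled kernels tend
  to the indicator of the atom, while the constant and linear terms are killed by the factor
  \<open>\<epsilon>\<close>.\<close>

lemma atom_limit:
  "((\<lambda>\<epsilon>. (- \<i> * of_real \<epsilon>) * M (Complex l \<epsilon>) $ i $ j) \<longlongrightarrow> \<mu> {l} $ i $ j) (at_right 0)"
proof (rule tendsto_at_right_sequentially[of 0 1])
  fix S :: "nat \<Rightarrow> real"
  assume S0: "\<And>n. 0 < S n" and S1: "\<And>n. S n < 1" and S: "S \<longlonglongrightarrow> 0"
  let ?z = "\<lambda>n. Complex l (S n)" and ?e = "\<lambda>n. - \<i> * of_real (S n)"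
  have z: "?z \<longlonglongrightarrow> of_real l"
    using tendsto_Complex[OF tendsto_const S] by (simp add: complex_of_real_def)
  have e: "?e \<longlonglongrightarrow> 0"
    using tendsto_mult[OF tendsto_const tendsto_of_real[OF S], of "- \<i>"] by simp
  have p: "1 + s\<^sup>2 > 0" for s :: real using zero_le_power2[of s] by linarith
  \<comment> \<open>For \<open>0 < \<epsilon> < 1\<close> the point \<open>z\<close> has modulus at
    most \<open>\<bar>l\<bar> + 1\<close>, which gives both summands; the factor
    \<open>\<epsilon>\<close> cancels the \<open>1 / Im z\<close> of the kernel bound.\<close>
  define K where "K = (\<bar>l\<bar> + 1) + (1 + (\<bar>l\<bar> + 1)\<^sup>2)"
  have K0: "K \<ge> 0" by (simp add: K_def)
  have bound: "cmod (?e n * herglotz_kernel (?z n) s) \<le> K * (1 / (1 + s\<^sup>2))" for n s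
  proof -
    have zn: "cmod (?z n) \<le> \<bar>l\<bar> + 1" using cmod_le[of "?z n"] S0[of n] S1[of n] by simp
    have "cmod (1 + (?z n)\<^sup>2) \<le> 1 + (cmod (?z n))\<^sup>2"
      by (metis norm_one norm_power norm_triangle_ineq)
    also have "\<dots> \<le> 1 + (\<bar>l\<bar> + 1)\<^sup>2" using zn by (intro add_left_mono power_mono) auto
    finally have z2: "cmod (1 + (?z n)\<^sup>2) \<le> 1 + (\<bar>l\<bar> + 1)\<^sup>2" .
    have "S n * cmod (?z n) \<le> 1 * cmod (?z n)" using S1[of n] by (intro mult_right_mono) auto
    then have zS: "S n * cmod (?z n) \<le> \<bar>l\<bar> + 1" using zn by linarith
    have "cmod (?e n * herglotz_kernel (?z n) s) = S n * cmod (herglotz_kernel (?z n) s)"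
      using S0[of n] by (simp add: norm_mult)
    also have "\<dots> \<le> S n * ((cmod (?z n) + cmod (1 + (?z n)\<^sup>2) / S n) * (1 / (1 + s\<^sup>2)))"
      using herglotz_kernel_bound[of "?z n" s] S0[of n] by (intro mult_left_mono) auto
    also have "\<dots> = (S n * cmod (?z n) + cmod (1 + (?z n)\<^sup>2)) * (1 / (1 + s\<^sup>2))"
    proof -
      have "S n * (cmod (1 + (?z n)\<^sup>2) / S n) = cmod (1 + (?z n)\<^sup>2)" using S0[of n] by simp
      then show ?thesis by (simp only: distrib_left mult.assoc[symmetric])
    qed
    also have "\<dots> \<le> K * (1 / (1 + s\<^sup>2))"
      unfolding K_def using zS z2 p[of s] by (intro mult_right_mono add_mono) auto
    finally show ?thesis .
  qed
  have "(\<lambda>n. LINT s|\<tau>. ?e n * herglotz_kernel (?z n) s * W s $ i $ j)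
      \<longlonglongrightarrow> (LINT s|\<tau>. indicator {l} s * W s $ i $ j)"
  proof (rule integral_dominated_convergence[where w="\<lambda>s. (K * 2) * (1 / (1 + s\<^sup>2))"])
    show "integrable \<tau> (\<lambda>s. (K * 2) * (1 / (1 + s\<^sup>2)))" using weight_integrable by (rule integrable_mult_right)
    show "AE s in \<tau>. (\<lambda>n. ?e n * herglotz_kernel (?z n) s * W s $ i $ j) \<longlonglongrightarrow> indicator {l} s * W s $ i $ j"
      by (intro AE_I2 tendsto_mult tendsto_const herglotz_kernel_at_atom[OF S S0])
    show "AE s in \<tau>. norm (?e n * herglotz_kernel (?z n) s * W s $ i $ j) \<le> (K * 2) * (1 / (1 + s\<^sup>2))" for n
      using AE_W_bounded
    proof eventually_elim
      case (elim s)
      have "cmod (?e n * herglotz_kernel (?z n) s) * cmod (W s $ i $ j) \<le> (K * (1 / (1 + s\<^sup>2))) * 2"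
        using bound[of n s] elim K0 p[of s] by (intro mult_mono) auto
      then show ?case by (simp only: norm_mult mult_ac)
    qed
  qed measurable
  moreover have "(LINT s|\<tau>. indicator {l} s * W s $ i $ j) = \<mu> {l} $ i $ j"
  proof -
    have "indicator {l} s * W s $ i $ j = indicator {l} s *\<^sub>R W s $ i $ j" for s by (simp add: indicator_def)
    then show ?thesis using W_set_integral(2)[of "{l}" i j] by (simp add: set_lebesgue_integral_def)
  qed
  moreover have "(\<lambda>n. ?e n * (C $ i $ j + D $ i $ j * ?z n)) \<longlonglongrightarrow> 0 * (C $ i $ j + D $ i $ j * of_real l)"
    by (intro tendsto_intros e z)
  ultimately have "(\<lambda>n. ?e n * (C $ i $ j + D $ i $ j * ?z n) + (LINT s|\<tau>. ?e n * herglotz_kernel (?z n) s * W s $ i $ j))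
      \<longlonglongrightarrow> \<mu> {l} $ i $ j"
    using tendsto_add by fastforce
  moreover have "?e n * (C $ i $ j + D $ i $ j * ?z n) + (LINT s|\<tau>. ?e n * herglotz_kernel (?z n) s * W s $ i $ j)
      = ?e n * M (?z n) $ i $ j" for n
  proof -
    have "(LINT s|\<tau>. ?e n * herglotz_kernel (?z n) s * W s $ i $ j)
        = ?e n * (LINT s|\<tau>. herglotz_kernel (?z n) s * W s $ i $ j)"
      by (simp only: mult.assoc integral_mult_right_zero)
    then show ?thesis using representation[of "?z n" i j] S0[of n] by (simp add: distrib_left)
  qed
  ultimately show "(\<lambda>n. ?e n * M (?z n) $ i $ j) \<longlonglongrightarrow> \<mu> {l} $ i $ j" by simp
qed simp

end

section \<open>Pure point measures of rank one\<close>

text \<open>A measure that consists of the atoms \<open>\<kappa> n v\<^sub>n v\<^sub>n\<^sup>*\<close> at \<open>lam n\<close>, where \<open>v\<^sub>n = (1, d n)\<close>.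
  The class of \<open>f\<close> in \<open>L\<^sup>2(\<mu>)\<close> is determined by the scalars \<open>\<langle>f(lam n), v\<^sub>n\<rangle>\<close>, written \<open>coord n f\<close>.\<close>

locale pure_point_rank_one = psd_matrix_measure +
  fixes lam :: "nat \<Rightarrow> real" and \<kappa> d :: "nat \<Rightarrow> real"
  assumes inj_lam: "inj lam"
    and \<kappa>_pos: "\<And>n. \<kappa> n > 0"
    and atoms: "\<And>n. \<mu> {lam n} $ 1 $ 1 = of_real (\<kappa> n)" "\<And>n. \<mu> {lam n} $ 1 $ 2 = of_real (\<kappa> n * d n)"
      "\<And>n. \<mu> {lam n} $ 2 $ 2 = of_real (\<kappa> n * (d n)\<^sup>2)"
    and support: "AE s in \<tau>. s \<in> range lam"
begin

definition coord :: "nat \<Rightarrow> (real \<Rightarrow> complex^2) \<Rightarrow> complex" where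
  "coord n f = f (lam n) $ 1 + of_real (d n) * f (lam n) $ 2"

lemma one_plus_d_pos: "1 + (d n)\<^sup>2 > 0"
  using zero_le_power2[of "d n"] by linarith

lemma tau_atom: "measure \<tau> {lam n} = \<kappa> n * (1 + (d n)\<^sup>2)"
  by (simp add: measure_tau trace_def sum_2 atoms algebra_simps)

text \<open>A density is determined pointwise at an atom, as the quotient of the masses, whichever
  representative was chosen.\<close>

lemma W_atom:
  "W (lam n) $ 1 $ 1 = of_real (1 / (1 + (d n)\<^sup>2))"
  "W (lam n) $ 1 $ 2 = of_real (d n / (1 + (d n)\<^sup>2))"
  "W (lam n) $ 2 $ 1 = of_real (d n / (1 + (d n)\<^sup>2))"
  "W (lam n) $ 2 $ 2 = of_real ((d n)\<^sup>2 / (1 + (d n)\<^sup>2))"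
proof -
  have W: "W (lam n) $ i $ j * of_real (\<kappa> n * (1 + (d n)\<^sup>2)) = \<mu> {lam n} $ i $ j" for i j
  proof -
    have "(LINT s:{lam n}|\<tau>. W s $ i $ j) = (LINT s|\<tau>. indicator {lam n} s *\<^sub>R W (lam n) $ i $ j)"
      unfolding set_lebesgue_integral_def by (rule Bochner_Integration.integral_cong) (auto simp: indicator_def)
    also have "\<dots> = of_real (measure \<tau> {lam n}) * W (lam n) $ i $ j"
      by (subst integral_scaleR_left) (auto simp: integrable_indicator_iff measure_tau scaleR_conv_of_real)
    finally show ?thesis using W_set_integral(2)[of "{lam n}" i j] by (simp add: tau_atom mult.commute)
  qed
  have eq: "w = of_real (x / (1 + (d n)\<^sup>2))" if "w * of_real (\<kappa> n * (1 + (d n)\<^sup>2)) = of_real (\<kappa> n * x)"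
    for w :: complex and x :: real
  proof -
    have "of_real (\<kappa> n * (1 + (d n)\<^sup>2)) \<noteq> (0::complex)"
      using \<kappa>_pos[of n] one_plus_d_pos[of n] by (simp only: of_real_eq_0_iff) simp
    then have "w = of_real (\<kappa> n * x) / of_real (\<kappa> n * (1 + (d n)\<^sup>2))"
      using that by (simp only: eq_divide_eq) simp
    also have "\<dots> = of_real (\<kappa> n * x / (\<kappa> n * (1 + (d n)\<^sup>2)))" by (simp only: of_real_divide)
    also have "\<kappa> n * x / (\<kappa> n * (1 + (d n)\<^sup>2)) = x / (1 + (d n)\<^sup>2)" using \<kappa>_pos[of n] by simp
    finally show ?thesis .
  qed
  have "\<mu> {lam n} $ 2 $ 1 = of_real (\<kappa> n * d n)"
    using cmat_psd_entries(3)[OF psd[of "{lam n}"]] by (simp add: atoms)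
  then show "W (lam n) $ 1 $ 1 = of_real (1 / (1 + (d n)\<^sup>2))"
    "W (lam n) $ 1 $ 2 = of_real (d n / (1 + (d n)\<^sup>2))"
    "W (lam n) $ 2 $ 1 = of_real (d n / (1 + (d n)\<^sup>2))"
    "W (lam n) $ 2 $ 2 = of_real ((d n)\<^sup>2 / (1 + (d n)\<^sup>2))"
    using W[of 1 1] W[of 1 2] W[of 2 1] W[of 2 2] by (intro eq; simp only: atoms mult_1_right)+
qed

text \<open>At \<open>lam n\<close> the density is the orthogonal projection onto the line of
  \<open>(1, d n)\<close>, so the form sees only the component of \<open>f\<close> along that
  vector.\<close>

lemma mm_form_atom: "mm_form \<mu> f (lam n) = (cmod (coord n f))\<^sup>2 / (1 + (d n)\<^sup>2)"
proof -
  let ?f1 = "f (lam n) $ 1" and ?f2 = "f (lam n) $ 2" and ?D = "complex_of_real (d n)"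
    and ?r = "complex_of_real (1 / (1 + (d n)\<^sup>2))"
  have r: "of_real (d n / (1 + (d n)\<^sup>2)) = ?r * ?D" "of_real ((d n)\<^sup>2 / (1 + (d n)\<^sup>2)) = ?r * ?D * ?D"
    by (simp_all only: of_real_mult[symmetric] power2_eq_square) simp_all
  have "cdot (W (lam n) *v f (lam n)) (f (lam n)) = ?r * ((?f1 + ?D * ?f2) * cnj (?f1 + ?D * ?f2))"
    by (simp only: cdot_def matrix_vector_mult_def sum_2 vec_lambda_beta W_atom r)
      (simp add: algebra_simps)
  also have "\<dots> = of_real ((cmod (coord n f))\<^sup>2 / (1 + (d n)\<^sup>2))"
    by (simp only: coord_def complex_norm_square[symmetric] of_real_mult[symmetric]) simp
  finally show ?thesis unfolding mm_form_def by simp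
qed

text \<open>A null set contains no atom, and the complement of the atoms is null. This turns every
  almost-everywhere condition into one on a sequence.\<close>

lemma AE_iff: "(AE s in \<tau>. P s) \<longleftrightarrow> (\<forall>n. P (lam n))"
proof
  assume "AE s in \<tau>. P s"
  then obtain N where N: "{s \<in> space \<tau>. \<not> P s} \<subseteq> N" "N \<in> sets \<tau>" "emeasure \<tau> N = 0" by (rule AE_E)
  show "\<forall>n. P (lam n)"
  proof (rule allI, rule ccontr)
    fix n assume "\<not> P (lam n)"
    then have "{lam n} \<subseteq> N" using N(1) by auto
    then have "emeasure \<tau> {lam n} \<le> 0" using emeasure_mono[of "{lam n}" N \<tau>] N by simp
    then have "measure \<tau> {lam n} = 0" by (simp add: measure_def)
    then show False using tau_atom[of n] \<kappa>_pos[of n] one_plus_d_pos[of n] by simp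
  qed
next
  assume "\<forall>n. P (lam n)"
  then show "AE s in \<tau>. P s" using support by (auto elim!: eventually_mono)
qed

lemma mm_form_nonneg: "AE s in \<tau>. 0 \<le> mm_form \<mu> f s"
  unfolding AE_iff mm_form_atom using one_plus_d_pos by (auto intro: divide_nonneg_nonneg less_imp_le)

lemma mm_form_measurable:
  assumes "\<And>i. (\<lambda>s. f s $ i) \<in> borel_measurable borel"
  shows "mm_form \<mu> f \<in> borel_measurable borel"
proof -
  note [measurable] = assms
  have "cnj \<in> borel_measurable borel"
    by (intro borel_measurable_continuous_onI continuous_on_cnj continuous_on_id)
  then have [measurable]: "(\<lambda>s. cnj (f s $ i)) \<in> borel_measurable borel" for i
    using measurable_compose[OF assms] by blast
  have "(\<lambda>s. cdot (W s *v f s) (f s)) \<in> borel_measurable borel"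
    unfolding cdot_def matrix_vector_mult_def sum_2 vec_lambda_beta by measurable
  then show ?thesis unfolding mm_form_def[abs_def] by measurable
qed

lemma mm_L2_bound:
  assumes "\<And>i. (\<lambda>s. f s $ i) \<in> borel_measurable borel" "integrable \<tau> g"
    and "\<And>n. (cmod (coord n f))\<^sup>2 / (1 + (d n)\<^sup>2) \<le> g (lam n)"
  shows "f \<in> mm_L2 \<mu>"
proof -
  have "integrable \<tau> (mm_form \<mu> f)"
  proof (rule Bochner_Integration.integrable_bound[OF assms(2)])
    show "mm_form \<mu> f \<in> borel_measurable \<tau>" using mm_form_measurable[OF assms(1)] by simp
    have "norm (mm_form \<mu> f (lam n)) \<le> norm (g (lam n))" for n
    proof -
      have "0 \<le> (cmod (coord n f))\<^sup>2 / (1 + (d n)\<^sup>2)" using one_plus_d_pos[of n] by simp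
      then show ?thesis using assms(3)[of n] by (simp add: mm_form_atom)
    qed
    then show "AE s in \<tau>. norm (mm_form \<mu> f s) \<le> norm (g s)" unfolding AE_iff by blast
  qed
  then show ?thesis using assms(1) by (simp add: mm_L2_def)
qed

lemma coord_simps:
  "coord n (\<lambda>s. f s + g s) = coord n f + coord n g"
  "coord n (\<lambda>s. f s - g s) = coord n f - coord n g"
  "coord n (\<lambda>s. c *s f s) = c * coord n f"
  "coord n (mult_x f) = of_real (lam n) * coord n f"
  "coord n (\<lambda>s. 0) = 0"
  by (simp_all add: coord_def mult_x_def algebra_simps)

lemma coord_sum: "coord n (\<lambda>s. \<Sum>k\<in>A. F k s) = (\<Sum>k\<in>A. coord n (F k))"
  by (simp add: coord_def sum_component sum.distrib sum_distrib_left)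

lemma mm_L2_diff:
  assumes f: "f \<in> mm_L2 \<mu>" and g: "g \<in> mm_L2 \<mu>"
  shows "(\<lambda>s. f s - g s) \<in> mm_L2 \<mu>"
proof (rule mm_L2_bound)
  show "integrable \<tau> (\<lambda>s. 2 * mm_form \<mu> f s + 2 * mm_form \<mu> g s)" using f g by (simp add: mm_L2_def)
  show "(\<lambda>s. (f s - g s) $ i) \<in> borel_measurable borel" for i using f g by (auto simp: mm_L2_def intro!: borel_measurable_diff)
  fix n
  have "(cmod (coord n f - coord n g))\<^sup>2 \<le> (cmod (coord n f) + cmod (coord n g))\<^sup>2"
    by (intro power_mono norm_triangle_ineq4) simp
  also have "\<dots> \<le> 2 * (cmod (coord n f))\<^sup>2 + 2 * (cmod (coord n g))\<^sup>2"
    using sum_squares_bound[of "cmod (coord n f)" "cmod (coord n g)"] by (simp add: power2_sum)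
  finally have "(cmod (coord n f - coord n g))\<^sup>2 / (1 + (d n)\<^sup>2)
      \<le> (2 * (cmod (coord n f))\<^sup>2 + 2 * (cmod (coord n g))\<^sup>2) / (1 + (d n)\<^sup>2)"
    using one_plus_d_pos[of n] by (intro divide_right_mono) auto
  then show "(cmod (coord n (\<lambda>s. f s - g s)))\<^sup>2 / (1 + (d n)\<^sup>2) \<le> 2 * mm_form \<mu> f (lam n) + 2 * mm_form \<mu> g (lam n)"
    by (simp add: coord_simps mm_form_atom add_divide_distrib)
qed

lemma mm_L2_cmult:
  assumes f: "f \<in> mm_L2 \<mu>"
  shows "(\<lambda>s. c *s f s) \<in> mm_L2 \<mu>"
proof (rule mm_L2_bound)
  show "integrable \<tau> (\<lambda>s. (cmod c)\<^sup>2 * mm_form \<mu> f s)" using f by (simp add: mm_L2_def)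
  show "(\<lambda>s. (c *s f s) $ i) \<in> borel_measurable borel" for i
    using f by (auto simp: mm_L2_def intro!: borel_measurable_times)
qed (simp add: coord_simps mm_form_atom norm_mult power_mult_distrib)

lemma mm_norm_eq_0_iff:
  assumes "f \<in> mm_L2 \<mu>"
  shows "mm_norm \<mu> f = 0 \<longleftrightarrow> (\<forall>n. coord n f = 0)"
proof -
  have i: "integrable \<tau> (mm_form \<mu> f)" using assms by (simp add: mm_L2_def)
  have "mm_norm \<mu> f = 0 \<longleftrightarrow> (LINT s|\<tau>. mm_form \<mu> f s) = 0" by (simp add: mm_norm_def)
  also have "\<dots> \<longleftrightarrow> (AE s in \<tau>. mm_form \<mu> f s = 0)"
    by (rule integral_nonneg_eq_0_iff_AE[OF i mm_form_nonneg])
  also have "\<dots> \<longleftrightarrow> (\<forall>n. coord n f = 0)"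
    unfolding AE_iff mm_form_atom using one_plus_d_pos by (metis divide_eq_0_iff less_irrefl norm_eq_zero power_eq_0_iff zero_power2)
  finally show ?thesis .
qed

lemma mm_eq_iff:
  assumes "f \<in> mm_L2 \<mu>" "g \<in> mm_L2 \<mu>"
  shows "mm_eq \<mu> f g \<longleftrightarrow> (\<forall>n. coord n f = coord n g)"
  using mm_norm_eq_0_iff[OF mm_L2_diff[OF assms]] by (simp add: mm_eq_def coord_simps)

text \<open>The claimed eigenvector, once \<open>d n\<close> is identified with the negative
  boundary value of \<open>u2\<close>.\<close>

definition atom_vector :: "nat \<Rightarrow> real \<Rightarrow> complex^2" where
  "atom_vector n x = indicator {lam n} x *s vector [1, of_real (d n)]"

lemma coord_atom_vector: "coord m (atom_vector n) = (if m = n then of_real (1 + (d n)\<^sup>2) else 0)"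
  using inj_lam by (auto simp: coord_def atom_vector_def indicator_def inj_def power2_eq_square)

lemma atom_vector_L2: "atom_vector n \<in> mm_L2 \<mu>"
proof (rule mm_L2_bound)
  show "integrable \<tau> (\<lambda>s. indicator {lam n} s * (1 + (d n)\<^sup>2))"
    by (intro integrable_mult_left) (simp add: integrable_indicator_iff measure_tau)
  show "(\<lambda>s. atom_vector n s $ i) \<in> borel_measurable borel" for i
    unfolding atom_vector_def vector_smult_component by measurable
  fix m
  show "(cmod (coord m (atom_vector n)))\<^sup>2 / (1 + (d m)\<^sup>2) \<le> indicator {lam n} (lam m) * (1 + (d n)\<^sup>2)"
  proof (cases "m = n")
    case True
    then have "cmod (coord m (atom_vector n)) = 1 + (d n)\<^sup>2"
      using one_plus_d_pos[of n] by (simp only: coord_atom_vector norm_of_real abs_of_pos if_True simp_thms)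
    moreover have "(1 + (d n)\<^sup>2)\<^sup>2 / (1 + (d n)\<^sup>2) = 1 + (d n)\<^sup>2"
      using one_plus_d_pos[of n] by (simp add: power2_eq_square[of "1 + (d n)\<^sup>2"])
    ultimately show ?thesis using True by simp
  qed (use one_plus_d_pos[of n] in \<open>simp add: coord_atom_vector\<close>)
qed

lemma atom_vector_mult_x: "mult_x (atom_vector n) = (\<lambda>s. of_real (lam n) *s atom_vector n s)"
  by (auto simp: mult_x_def atom_vector_def indicator_def)

lemma one_plus_d_neq_0: "complex_of_real (1 + (d n)\<^sup>2) \<noteq> 0"
  using one_plus_d_pos[of n] by (metis of_real_eq_0_iff order_less_irrefl)

lemma zero_L2: "(\<lambda>s. 0) \<in> mm_L2 \<mu>"
  using mm_L2_diff[OF atom_vector_L2[of 0] atom_vector_L2[of 0]] by simp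

lemma atom_vector_eigenvector: "mult_eigenvector \<mu> (of_real (lam n)) (atom_vector n)"
proof -
  have "mult_x (atom_vector n) \<in> mm_L2 \<mu>"
    unfolding atom_vector_mult_x by (rule mm_L2_cmult[OF atom_vector_L2])
  moreover have "\<not> mm_eq \<mu> (atom_vector n) (\<lambda>x. 0)"
    unfolding mm_eq_iff[OF atom_vector_L2 zero_L2]
    using one_plus_d_neq_0[of n] by (auto simp: coord_atom_vector coord_simps simp del: of_real_add intro!: exI[of _ n])
  moreover have "mm_eq \<mu> (mult_x (atom_vector n)) (\<lambda>x. of_real (lam n) *s atom_vector n x)"
    using mm_eq_iff[OF calculation(1) calculation(1)] by (simp add: atom_vector_mult_x)
  ultimately show ?thesis by (simp add: mult_eigenvector_def mult_dom_def atom_vector_L2)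
qed

text \<open>Multiplication scales the coordinate \<open>coord m\<close> by \<open>lam m\<close>, and
  \<open>lam\<close> is injective, so an eigenvector at \<open>lam n\<close> has only its coordinate
  \<open>n\<close> left.\<close>

lemma mult_eigenvector_unique:
  assumes g: "mult_eigenvector \<mu> (of_real (lam n)) g"
  shows "\<exists>c. c \<noteq> 0 \<and> mm_eq \<mu> g (\<lambda>x. c *s atom_vector n x)"
proof -
  have gL: "g \<in> mm_L2 \<mu>" "mult_x g \<in> mm_L2 \<mu>" and n0: "\<not> mm_eq \<mu> g (\<lambda>x. 0)"
    and eq: "mm_eq \<mu> (mult_x g) (\<lambda>x. of_real (lam n) *s g x)"
    using g by (auto simp: mult_eigenvector_def mult_dom_def)
  have zero: "coord m g = 0" if "m \<noteq> n" for m
  proof -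
    have "coord m (mult_x g) = coord m (\<lambda>x. of_real (lam n) *s g x)"
      using eq mm_eq_iff[OF gL(2) mm_L2_cmult[OF gL(1)]] by blast
    then have "of_real (lam m) * coord m g = of_real (lam n) * coord m g"
      unfolding coord_simps .
    moreover have "lam m \<noteq> lam n" using that inj_lam by (auto simp: inj_def)
    ultimately show ?thesis by simp
  qed
  define c where "c = coord n g / of_real (1 + (d n)\<^sup>2)"
  have cn: "coord n g = c * of_real (1 + (d n)\<^sup>2)" using one_plus_d_neq_0[of n] unfolding c_def by simp
  have "coord m g = coord m (\<lambda>x. c *s atom_vector n x)" for m
    using zero[of m] cn by (simp add: coord_simps coord_atom_vector del: of_real_add)
  then have "mm_eq \<mu> g (\<lambda>x. c *s atom_vector n x)"
    using mm_eq_iff[OF gL(1) mm_L2_cmult[OF atom_vector_L2]] by blast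
  moreover have "c \<noteq> 0"
  proof
    assume "c = 0"
    then have "coord m g = 0" for m using zero[of m] cn by (cases "m = n") auto
    then show False using n0 mm_eq_iff[OF gL(1) zero_L2] by (simp add: coord_simps)
  qed
  ultimately show ?thesis by blast
qed

text \<open>The coefficient \<open>c n\<close> matches coordinate \<open>n\<close> exactly. Hence
  the remainder after \<open>N\<close> terms has its first \<open>N\<close> coordinates equal to 0
  and the others unchanged, so its form is dominated by that of \<open>f\<close> and tends to 0 at
  every atom.\<close>

lemma atom_vectors_span: "mm_L2 \<mu> = mm_closed_span \<mu> atom_vector"
proof
  show "mm_closed_span \<mu> atom_vector \<subseteq> mm_L2 \<mu>" by (auto simp: mm_closed_span_def)
  show "mm_L2 \<mu> \<subseteq> mm_closed_span \<mu> atom_vector"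
  proof
    fix f assume f: "f \<in> mm_L2 \<mu>"
    define c where "c n = coord n f / of_real (1 + (d n)\<^sup>2)" for n
    define R where "R N = (\<lambda>x. f x - (\<Sum>n<N. c n *s atom_vector n x))" for N
    have fi: "integrable \<tau> (mm_form \<mu> f)" and fm: "(\<lambda>s. f s $ i) \<in> borel_measurable borel" for i
      using f by (auto simp: mm_L2_def)
    have cR: "coord m (R N) = (if m < N then 0 else coord m f)" for m N
    proof -
      have "coord m (R N) = coord m f - (\<Sum>n<N. c n * (if m = n then of_real (1 + (d n)\<^sup>2) else 0))"
        unfolding R_def coord_simps coord_sum coord_atom_vector ..
      also have "(\<Sum>n<N. c n * (if m = n then of_real (1 + (d n)\<^sup>2) else 0))
          = (\<Sum>n<N. if m = n then coord m f else 0)"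
        using one_plus_d_neq_0 by (intro sum.cong) (auto simp: c_def simp del: of_real_add)
      also have "\<dots> = (if m < N then coord m f else 0)" by simp
      finally show ?thesis by simp
    qed
    have Rm: "(\<lambda>s. R N s $ i) \<in> borel_measurable borel" for N i
      using fm atom_vector_L2 unfolding R_def mm_L2_def vector_minus_component sum_component vector_smult_component
      by (intro borel_measurable_diff borel_measurable_sum borel_measurable_times) auto
    have "(\<lambda>N. LINT s|\<tau>. mm_form \<mu> (R N) s) \<longlonglongrightarrow> (LINT s|\<tau>. 0)"
    proof (rule integral_dominated_convergence[OF _ _ fi])
      show "mm_form \<mu> (R N) \<in> borel_measurable \<tau>" for N using mm_form_measurable[OF Rm] by simp
      show "AE s in \<tau>. (\<lambda>N. mm_form \<mu> (R N) s) \<longlonglongrightarrow> 0"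
        unfolding AE_iff
      proof
        fix m
        have "eventually (\<lambda>N. mm_form \<mu> (R N) (lam m) = 0) sequentially"
          by (rule eventually_sequentiallyI[of "Suc m"]) (simp add: mm_form_atom cR)
        then show "(\<lambda>N. mm_form \<mu> (R N) (lam m)) \<longlonglongrightarrow> 0" by (rule tendsto_eventually)
      qed
      show "AE s in \<tau>. norm (mm_form \<mu> (R N) s) \<le> mm_form \<mu> f s" for N
        unfolding AE_iff mm_form_atom cR using one_plus_d_pos by (auto intro: divide_nonneg_nonneg less_imp_le)
    qed simp
    then have "(\<lambda>N. mm_norm \<mu> (R N)) \<longlonglongrightarrow> sqrt 0"
      unfolding mm_norm_def by (intro tendsto_real_sqrt) simp
    then have lim: "(\<lambda>N. mm_norm \<mu> (R N)) \<longlonglongrightarrow> 0" by simp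
    have "\<exists>N. \<exists>c::nat \<Rightarrow> complex. mm_norm \<mu> (\<lambda>x. f x - (\<Sum>n<N. c n *s atom_vector n x)) < e" if "e > 0" for e
    proof -
      have "eventually (\<lambda>N. mm_norm \<mu> (R N) < e) sequentially" using order_tendstoD(2)[OF lim that] .
      then obtain N where "mm_norm \<mu> (R N) < e" unfolding eventually_sequentially by blast
      then show ?thesis unfolding R_def by blast
    qed
    then show "f \<in> mm_closed_span \<mu> atom_vector" using f by (auto simp: mm_closed_span_def)
  qed
qed

text \<open>\<open>U\<close> is linear and intertwining only up to \<open>mm_eq\<close>; passing to
  coordinates gives honest equalities that can be chained. The image is nonzero because
  \<open>U\<close> preserves norms.\<close>

lemma spectral_transform_eigenvector:
  assumes U: "spectral_transform S va vb \<mu> U" and \<phi>: "L_0_eigenvector S va vb z \<phi>"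
  shows "mult_eigenvector \<mu> z (U \<phi>)"
proof -
  have L0: "(\<phi>, \<lambda>x. z * \<phi> x) \<in> L_0 S va vb" and n0: "\<not> (AE x in sl_measure S. \<phi> x = 0)"
    using \<phi> by (auto simp: L_0_eigenvector_def)
  then have \<phi>L: "\<phi> \<in> sl_L2 S" and z\<phi>L: "(\<lambda>x. z * \<phi> x) \<in> sl_L2 S" by (auto simp: L_0_def L_max_def)
  have dom: "U \<phi> \<in> mult_dom \<mu>"
  proof -
    have "\<phi> \<in> Domain (L_0 S va vb)" using L0 by blast
    then show ?thesis using U \<phi>L unfolding spectral_transform_def by fastforce
  qed
  then have UL: "U \<phi> \<in> mm_L2 \<mu>" "mult_x (U \<phi>) \<in> mm_L2 \<mu>" by (auto simp: mult_dom_def)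
  have UzL: "U (\<lambda>x. z * \<phi> x) \<in> mm_L2 \<mu>" using U z\<phi>L by (simp add: spectral_transform_def)
  have "mm_eq \<mu> (U (\<lambda>x. z * \<phi> x)) (\<lambda>s. z *s U \<phi> s)" using U \<phi>L by (simp add: spectral_transform_def)
  then have e1: "coord n (U (\<lambda>x. z * \<phi> x)) = coord n (\<lambda>s. z *s U \<phi> s)" for n
    using mm_eq_iff[OF UzL mm_L2_cmult[OF UL(1)]] by blast
  have "mm_eq \<mu> (U (\<lambda>x. z * \<phi> x)) (mult_x (U \<phi>))"
    using U L0 unfolding spectral_transform_def by blast
  then have e2: "coord n (U (\<lambda>x. z * \<phi> x)) = coord n (mult_x (U \<phi>))" for n
    using mm_eq_iff[OF UzL UL(2)] by blast
  have "mm_eq \<mu> (mult_x (U \<phi>)) (\<lambda>s. z *s U \<phi> s)"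
    unfolding mm_eq_iff[OF UL(2) mm_L2_cmult[OF UL(1)]] using e1 e2 by metis
  moreover have "\<not> mm_eq \<mu> (U \<phi>) (\<lambda>x. 0)"
  proof
    assume "mm_eq \<mu> (U \<phi>) (\<lambda>x. 0)"
    then have "mm_norm \<mu> (U \<phi>) = 0" by (simp add: mm_eq_def)
    moreover have "(mm_norm \<mu> (U \<phi>))\<^sup>2 = Re (sl_inner S \<phi> \<phi>)"
      using U \<phi>L by (simp add: spectral_transform_def)
    moreover have "sl_inner S \<phi> \<phi> = of_real (LINT x|sl_measure S. (cmod (\<phi> x))\<^sup>2)"
      unfolding sl_inner_def integral_complex_of_real[symmetric] complex_norm_square ..
    ultimately have "(LINT x|sl_measure S. (cmod (\<phi> x))\<^sup>2) = 0" by simp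
    moreover have "integrable (sl_measure S) (\<lambda>x. (cmod (\<phi> x))\<^sup>2)" using \<phi>L by (simp add: sl_L2_def)
    ultimately have "AE x in sl_measure S. (cmod (\<phi> x))\<^sup>2 = 0"
      by (subst (asm) integral_nonneg_eq_0_iff_AE) auto
    then show False using n0 by simp
  qed
  ultimately show ?thesis using dom by (simp add: mult_eigenvector_def)
qed

end

section \<open>The Weyl function\<close>

locale sl_spectral = sl_fundamental +
  fixes lam :: "nat \<Rightarrow> real" and C D :: "complex^2^2" and \<mu> :: "real set \<Rightarrow> complex^2^2"
  assumes enum: "eigenvalue_enumeration S va vb lam"
    and weyl: "herglotz_representation (weyl_M0 S ub vb u1 u2) C D \<mu>"
begin

sublocale matrix_herglotz "weyl_M0 S ub vb u1 u2" C D \<mu>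
  by unfold_locales (rule weyl)

lemma weyl_entries:
  "weyl_M0 S ub vb u1 u2 z $ 1 $ 1 = - Af z / Bf z" "weyl_M0 S ub vb u1 u2 z $ 1 $ 2 = 1 / Bf z"
  "weyl_M0 S ub vb u1 u2 z $ 2 $ 2 = - Df z / Bf z"
  by (simp_all add: weyl_M0_def Let_def Af_def Bf_def Df_def)

lemma Bf_eq_0_iff: "Bf z = 0 \<longleftrightarrow> z \<in> range (\<lambda>n. of_real (lam n))"
  using enum unfolding L_0_eigenvalue_iff[symmetric] eigenvalue_enumeration_def bij_betw_def by simp

lemma Bf_real_eq_0_iff: "Bf (of_real x) = 0 \<longleftrightarrow> x \<in> range lam"
  unfolding Bf_eq_0_iff by auto

text \<open>Zeros are eigenvalues, and the enumeration exhausts these by real numbers.\<close>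

lemma Bf_nonreal: "Im z \<noteq> 0 \<Longrightarrow> Bf z \<noteq> 0"
  unfolding Bf_eq_0_iff by auto

lemma lam_inj: "inj lam"
proof (rule injI)
  fix m n assume "lam m = lam n"
  then have "complex_of_real (lam m) = complex_of_real (lam n)" by simp
  moreover have "inj (\<lambda>n. complex_of_real (lam n))"
    using enum unfolding eigenvalue_enumeration_def bij_betw_def by blast
  ultimately show "m = n" by (rule injD[rotated])
qed

lemma spectral_support: "AE s in \<tau>. s \<in> range lam"
proof (rule AE_mem_if_locally_null)
  fix x assume "x \<notin> range lam"
  then have Bx: "Bf (of_real x) \<noteq> 0" by (simp add: Bf_real_eq_0_iff)
  have "eventually (\<lambda>z. Bf z \<noteq> 0) (nhds (of_real x))"
    using boundary_values_continuous(2)[of "of_real x"] Bx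
    by (simp add: continuous_at tendsto_imp_eventually_ne eventually_nhds_conv_at isCont_def)
  then obtain e where e: "e > 0" "\<And>z. dist z (of_real x) < e \<Longrightarrow> Bf z \<noteq> 0"
    unfolding eventually_nhds_metric by blast
  \<comment> \<open>Any radius with \<open>2 * r < e\<close> keeps the closed ball inside the
    zero-free disc.\<close>
  define r where "r = e / 3"
  have r: "r > 0" using e(1) by (simp add: r_def)
  have B: "Bf z \<noteq> 0" if "z \<in> cball (of_real x) (2 * r)" for z
    using that e by (intro e(2)) (simp add: r_def dist_commute)
  define F where "F z = - Af z / Bf z + - Df z / Bf z" for z
  have "measure \<tau> {x - r..x + r} = 0"
  proof (rule interval_null[OF r])
    show "continuous_on (cball (of_real x) (2 * r)) F"
      unfolding F_def[abs_def]
      by (intro continuous_on_add continuous_on_divide continuous_on_minus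
          continuous_at_imp_continuous_on ballI boundary_values_continuous B)
    show "Im (F (of_real t)) = 0" if "\<bar>t - x\<bar> \<le> r" for t
    proof -
      have "F (of_real t) \<in> \<real>"
        unfolding F_def by (intro Reals_add Reals_divide Reals_minus boundary_values_real)
      then show ?thesis by (simp add: complex_is_Real_iff)
    qed
    show "\<And>z. weyl_M0 S ub vb u1 u2 z $ 1 $ 1 + weyl_M0 S ub vb u1 u2 z $ 2 $ 2 = F z"
      by (simp add: weyl_entries F_def)
  qed
  then show "\<exists>r>0. measure \<tau> {x - r..x + r} = 0" using r by blast
qed

lemma tendsto_vertical:
  "((\<lambda>\<epsilon>. Af (Complex l \<epsilon>)) \<longlongrightarrow> Af (of_real l)) (at_right 0)"
  "((\<lambda>\<epsilon>. Df (Complex l \<epsilon>)) \<longlongrightarrow> Df (of_real l)) (at_right 0)"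
proof -
  have z: "((\<lambda>\<epsilon>. Complex l \<epsilon>) \<longlongrightarrow> of_real l) (at_right 0)"
    using tendsto_Complex[OF tendsto_const tendsto_ident_at, of l 0 "{0<..}"] by (simp add: complex_of_real_def)
  show "((\<lambda>\<epsilon>. Af (Complex l \<epsilon>)) \<longlongrightarrow> Af (of_real l)) (at_right 0)"
    "((\<lambda>\<epsilon>. Df (Complex l \<epsilon>)) \<longlongrightarrow> Df (of_real l)) (at_right 0)"
    using boundary_values_continuous by (auto intro: isCont_tendsto_compose[OF _ z])
qed

text \<open>The zero of \<open>Bf\<close> at \<open>lam n\<close> is simple: \<open>Bf\<close> is Lipschitz there, so \<open>1 / Bf\<close> grows at least
  like \<open>1 / \<epsilon>\<close>, while a Herglotz function cannot grow faster.\<close>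

lemma spectral_atom:
  defines "m n \<equiv> \<mu> {lam n} $ 1 $ 2"
  shows "m n \<noteq> 0" "\<mu> {lam n} $ 1 $ 1 = - Af (of_real (lam n)) * m n"
    "\<mu> {lam n} $ 2 $ 2 = - Df (of_real (lam n)) * m n"
proof -
  let ?z = "\<lambda>\<epsilon>. Complex (lam n) \<epsilon>" and ?e = "\<lambda>\<epsilon>. - \<i> * of_real \<epsilon>"
  have B0: "Bf (of_real (lam n)) = 0" by (simp add: Bf_real_eq_0_iff)
  have e: "- a * (e * (1 / b)) = e * (- a / b)" for a b e :: complex by simp
  \<comment> \<open>The off-diagonal entry carries the whole singularity: the diagonal entries are
    this quantity times factors that converge to \<open>- Af\<close> and \<open>- Df\<close> at the
    eigenvalue.\<close>
  have lim12: "((\<lambda>\<epsilon>. ?e \<epsilon> * (1 / Bf (?z \<epsilon>))) \<longlongrightarrow> m n) (at_right 0)"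
    using atom_limit[of "lam n" 1 2] by (simp only: weyl_entries m_def)
  have "((\<lambda>\<epsilon>. - Af (?z \<epsilon>) * (?e \<epsilon> * (1 / Bf (?z \<epsilon>)))) \<longlongrightarrow> - Af (of_real (lam n)) * m n) (at_right 0)"
    by (intro tendsto_mult tendsto_minus tendsto_vertical lim12)
  moreover have "((\<lambda>\<epsilon>. - Af (?z \<epsilon>) * (?e \<epsilon> * (1 / Bf (?z \<epsilon>)))) \<longlongrightarrow> \<mu> {lam n} $ 1 $ 1) (at_right 0)"
    using atom_limit[of "lam n" 1 1] by (simp only: weyl_entries e)
  ultimately show "\<mu> {lam n} $ 1 $ 1 = - Af (of_real (lam n)) * m n"
    by (intro tendsto_unique[OF trivial_limit_at_right_real]) assumption+
  have "((\<lambda>\<epsilon>. - Df (?z \<epsilon>) * (?e \<epsilon> * (1 / Bf (?z \<epsilon>)))) \<longlongrightarrow> - Df (of_real (lam n)) * m n) (at_right 0)"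
    by (intro tendsto_mult tendsto_minus tendsto_vertical lim12)
  moreover have "((\<lambda>\<epsilon>. - Df (?z \<epsilon>) * (?e \<epsilon> * (1 / Bf (?z \<epsilon>)))) \<longlongrightarrow> \<mu> {lam n} $ 2 $ 2) (at_right 0)"
    using atom_limit[of "lam n" 2 2] by (simp only: weyl_entries e)
  ultimately show "\<mu> {lam n} $ 2 $ 2 = - Df (of_real (lam n)) * m n"
    by (intro tendsto_unique[OF trivial_limit_at_right_real]) assumption+
  obtain K where K: "K \<ge> 0" "\<And>z. cmod (z - of_real (lam n)) \<le> 1 \<Longrightarrow>
      cmod (Bf z - Bf (of_real (lam n))) \<le> K * cmod (z - of_real (lam n))"
    by (rule boundary_values_Lipschitz[of "of_real (lam n)"]) blast
  \<comment> \<open>The Lipschitz constant \<open>K\<close> may be 0, hence \<open>K + 1\<close> in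
    the denominator.\<close>
  have "eventually (\<lambda>\<epsilon>. 1 / (K + 1) \<le> cmod (?e \<epsilon> * (1 / Bf (?z \<epsilon>)))) (at_right 0)"
    unfolding eventually_at_right[OF zero_less_one]
  proof (intro exI[of _ 1] conjI allI impI zero_less_one)
    fix \<epsilon> :: real assume \<epsilon>: "0 < \<epsilon>" "\<epsilon> < 1"
    have "?z \<epsilon> - of_real (lam n) = \<i> * of_real \<epsilon>" by (simp add: complex_eq_iff)
    then have "cmod (?z \<epsilon> - of_real (lam n)) = \<epsilon>" using \<epsilon> by (simp add: norm_mult)
    then have "cmod (Bf (?z \<epsilon>)) \<le> K * \<epsilon>" using K(2)[of "?z \<epsilon>"] B0 \<epsilon> by simp
    then have le: "cmod (Bf (?z \<epsilon>)) \<le> (K + 1) * \<epsilon>" using \<epsilon> by (simp add: algebra_simps)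
    have "cmod (Bf (?z \<epsilon>)) > 0" using Bf_nonreal[of "?z \<epsilon>"] \<epsilon> by simp
    then have "1 / (K + 1) \<le> \<epsilon> / cmod (Bf (?z \<epsilon>))"
      using le K(1) by (simp add: field_simps)
    then show "1 / (K + 1) \<le> cmod (?e \<epsilon> * (1 / Bf (?z \<epsilon>)))"
      using \<epsilon> by (simp add: norm_mult norm_divide)
  qed
  then have "1 / (K + 1) \<le> cmod (m n)"
    by (rule tendsto_lowerbound[OF tendsto_norm[OF lim12]]) simp
  moreover have "1 / (K + 1) > 0" using K(1) by simp
  ultimately show "m n \<noteq> 0" by auto
qed

text \<open>The boundary value is already real; taking \<open>Re\<close> only changes its
  type.\<close>

definition "slope n = - Re (Df (of_real (lam n)))"

lemma Df_lam: "Df (of_real (lam n)) = of_real (- slope n)"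
  using boundary_values_real(3)[of "lam n"] by (simp add: slope_def complex_is_Real_iff complex_eq_iff)

sublocale pure_point_rank_one \<mu> lam "\<lambda>n. Re (\<mu> {lam n} $ 1 $ 1)" slope
proof
  fix n
  let ?m = "\<mu> {lam n} $ 1 $ 2" and ?D = "Df (of_real (lam n))" and ?A = "Af (of_real (lam n))"
  note sa = spectral_atom[of n]
  have "Bf (of_real (lam n)) = 0" by (simp add: Bf_real_eq_0_iff)
  then have AD: "?A * ?D = 1" using boundary_determinant[of "of_real (lam n)"] by simp
  note p = cmat_psd_entries[OF psd[of "{lam n}"], simplified]
  show c: "\<mu> {lam n} $ 1 $ 1 = of_real (Re (\<mu> {lam n} $ 1 $ 1))"
    using p(1) by (simp add: complex_eq_iff)
  \<comment> \<open>\<open>?A * ?D = 1\<close> excludes \<open>?A = 0\<close>, and the off-diagonal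
    mass is nonzero.\<close>
  have "\<mu> {lam n} $ 1 $ 1 \<noteq> 0" using sa(1,2) AD by auto
  then have "Re (\<mu> {lam n} $ 1 $ 1) \<noteq> 0" using c by (metis of_real_0)
  then show "Re (\<mu> {lam n} $ 1 $ 1) > 0" using p(4) by simp
  \<comment> \<open>Multiplying the formula for the first diagonal entry by \<open>- ?D\<close> and
    using \<open>?A * ?D = 1\<close> solves it for the off-diagonal entry, so every entry becomes a
    multiple of the first by 1, \<open>slope n\<close> or its square.\<close>
  have "- ?D * \<mu> {lam n} $ 1 $ 1 = (?A * ?D) * ?m" unfolding sa(2) by (simp add: mult_ac)
  then have m: "?m = - ?D * \<mu> {lam n} $ 1 $ 1" unfolding AD by simp
  then show m': "\<mu> {lam n} $ 1 $ 2 = of_real (Re (\<mu> {lam n} $ 1 $ 1) * slope n)"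
    unfolding Df_lam using c by (metis (no_types, lifting) minus_minus mult.commute of_real_minus of_real_mult)
  show "\<mu> {lam n} $ 2 $ 2 = of_real (Re (\<mu> {lam n} $ 1 $ 1) * (slope n)\<^sup>2)"
    unfolding sa(3) m' Df_lam by (simp add: power2_eq_square mult_ac)
qed (auto simp: lam_inj spectral_support)

lemma eigen_f_eq: "eigen_f S ub u2 (lam n) = atom_vector n"
proof -
  have "Lim (at_right 0) (\<lambda>\<epsilon>. qd1_b S ub (u2 (Complex (lam n) \<epsilon>))) = Df (of_real (lam n))"
    using tendsto_vertical(2)[of "lam n"] unfolding Df_def
    by (intro tendsto_Lim) auto
  then show ?thesis by (auto simp: eigen_f_def atom_vector_def Df_lam)
qed

end

theorem corollary5p3:
  fixes S :: sl_expr
    and K l0 :: real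
    and ua va ub vb :: "real \<Rightarrow> real"
    and u1 u2 :: "complex \<Rightarrow> real \<Rightarrow> complex"
    and lam :: "nat \<Rightarrow> real"
    and C D :: "complex^2^2"
    and \<mu> :: "real set \<Rightarrow> complex^2^2"
  assumes "sl_coefficients S"
    and "limit_circle_a S" and "limit_circle_b S"
    and "L_min_bounded_below S K"
    and "boundary_pair_a S l0 ua va" and "boundary_pair_b S l0 ub vb"
    and "fundamental_system S ua va u1 u2"
    and "eigenvalue_enumeration S va vb lam"
    and "herglotz_representation (weyl_M0 S ub vb u1 u2) C D \<mu>"
  shows "(\<forall>n.
      (\<exists>l. ((\<lambda>\<epsilon>. qd1_b S ub (u2 (Complex (lam n) \<epsilon>))) \<longlongrightarrow> l) (at_right 0)) \<and>
      eigen_f S ub u2 (lam n) \<in> mm_L2 \<mu> \<and>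
      mult_eigenvector \<mu> (complex_of_real (lam n)) (eigen_f S ub u2 (lam n)) \<and>
      (\<forall>g. mult_eigenvector \<mu> (complex_of_real (lam n)) g \<longrightarrow>
         (\<exists>c. c \<noteq> 0 \<and> mm_eq \<mu> g (\<lambda>x. c *s eigen_f S ub u2 (lam n) x))) \<and>
      (\<forall>U \<phi>. spectral_transform S va vb \<mu> U \<longrightarrow>
         L_0_eigenvector S va vb (complex_of_real (lam n)) \<phi> \<longrightarrow>
         (\<exists>c. c \<noteq> 0 \<and> mm_eq \<mu> (U \<phi>) (\<lambda>x. c *s eigen_f S ub u2 (lam n) x))))
    \<and> mm_L2 \<mu> = mm_closed_span \<mu> (\<lambda>n. eigen_f S ub u2 (lam n))"
proof -
  interpret sl_spectral S l0 ua va ub vb u1 u2 lam C D \<mu>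
    by unfold_locales (use assms in auto)
  have "\<exists>l. ((\<lambda>\<epsilon>. qd1_b S ub (u2 (Complex (lam n) \<epsilon>))) \<longlongrightarrow> l) (at_right 0)" for n
    using tendsto_vertical(2)[of "lam n"] unfolding Df_def by blast
  then show ?thesis
    unfolding eigen_f_eq
    using atom_vector_L2 atom_vector_eigenvector mult_eigenvector_unique spectral_transform_eigenvector
      atom_vectors_span
    by blast
qed

end
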